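(* There exist absolute constants $c>0$, $C>0$ and $N_0$ such that for every integer $N\ge N_0$ the following holds. If $\mathcal{A}\subset\{1,\ldots,N\}$ is such that there are no solutions to $a-b=n^2$ with $a,b\in\mathcal{A}$ and $n\ge 1$ an integer, then $$|\mathcal{A}|\le C\,\frac{N}{(\log N)^{c\log\log\log N}}.$$ *)

theory Defs
  imports Complex_Main
begin

end

theory Submission
  imports Defs "HOL-Analysis.Analysis" "HOL-Real_Asymp.Real_Asymp"
begin

text \<open>The argument is a density increment in the style of Bloom and Maynard. Split a set \<open>A\<close> of density
  \<open>\<alpha>\<close> into its left and right halves. The squares, weighted by \<open>2 n - 1\<close>, agree in Fourier sup norm
  with the sum over \<open>q \<le> Q\<close> of their local densities modulo \<open>q\<close>, where \<open>Q\<close> is a power of \<open>1 / \<alpha>\<close>. As no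
  difference between the halves is a square, the term \<open>q = 1\<close> must be cancelled by the terms
  \<open>q \<ge> 2\<close>. If \<open>A\<close> has no density increment by a factor \<open>1 + \<nu>\<close> on progressions of
  square difference, then \<open>A\<close> is nearly equidistributed in residue classes, so each of these terms is small
  in \<open>L\<^sup>2\<close>. Their \<open>2m\<close>-th moment is nearly as small as if the terms
  were independent: a product of them averages to zero unless each prime power in the least common multiple
  of the moduli is attained twice, and otherwise its average is at most the product of the \<open>L\<^sup>2\<close>-norms
  divided by that multiple. Hence \<open>\<nu>\<close> is at least about \<open>\<alpha>\<close> to the power \<open>1 / m\<close>, with
  \<open>m\<close> of order \<open>ln (ln (1 / \<alpha>))\<close>, and iterating the increment gives the bound.\<close>

section \<open>Exponential sums\<close>

text \<open>A progression of difference \<open>q\<^sup>2\<close> can be rescaled to an interval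
  without creating square differences, so the increment repeats; this is why residue classes modulo
  \<open>q\<close> are cut into classes modulo \<open>q\<^sup>2\<close>. The weight is the gap
  between consecutive squares: it gives the squares mean density one, so the term
  \<open>q = 1\<close> is the product of the sizes of the halves. The obstacle is the number of
  moduli, a power of \<open>1 / \<alpha>\<close>: adding their \<open>L\<^sup>2\<close> norms would
  lose that power. In the moment, tuples of moduli are weighted by the reciprocal of their least
  common multiple, which costs only a power of a logarithm, but with exponent \<open>4 ^ m\<close>.
  This stays below a power of \<open>1 / \<alpha>\<close> only while \<open>m\<close> is at most a
  small multiple of \<open>ln (ln (1 / \<alpha>))\<close>. Each increment costs a power of
  \<open>1 / \<alpha>\<close> in length and their number is of order
  \<open>ln (1 / \<alpha>) / \<nu>\<close>, which must stay below \<open>ln N\<close>; hence \<nu>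
  is chosen as \<open>ln N\<close> to the power -1/4. With \<open>y = ln (ln (ln N))\<close> and
  \<open>m\<close> about \<open>y / 4\<close>, \<open>\<nu> ^ m\<close> is roughly
  \<open>ln N\<close> to the power \<open>- y / 16\<close>, safely below \<alpha>, which is the
  power \<open>- y / 40\<close>.\<close>

definition ee :: "real \<Rightarrow> complex" where "ee x = cis (2 * pi * x)"

lemma ee_0 [simp]: "ee 0 = 1" by (simp add: ee_def)

lemma ee_add: "ee (x + y) = ee x * ee y"
  by (simp add: ee_def cis_mult ring_distribs)

lemma ee_of_int [simp]: "ee (of_int k) = 1"
  using cis_multiple_2pi[of "of_int k"] by (simp add: ee_def)

lemma ee_add_int [simp]: "ee (x + of_int k) = ee x"
  by (simp add: ee_add)

lemma norm_ee [simp]: "norm (ee x) = 1" by (simp add: ee_def)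

lemma cnj_ee: "cnj (ee x) = ee (- x)" by (simp add: ee_def cis_cnj)

lemma ee_power: "ee x ^ n = ee (real n * x)"
  by (simp add: ee_def Complex.DeMoivre mult_ac)

lemma ee_eq_intdiff: "x - y = of_int k \<Longrightarrow> ee x = ee y"
  by (metis ee_add_int add.commute diff_add_cancel)

lemma ee_eq_1_iff: "ee x = 1 \<longleftrightarrow> x \<in> \<int>"
proof
  assume "ee x = 1"
  then have "cos (2 * pi * x) = 1" by (simp add: ee_def complex_eq_iff)
  then obtain n where "2 * pi * x = of_int n * 2 * pi"
    unfolding cos_one_2pi_int by blast
  then have "x = of_int n" by simp
  then show "x \<in> \<int>" by simp
qed (auto elim: Ints_cases)

lemma norm_ee_minus_one: "norm (ee x - 1) = 2 * \<bar>sin (pi * x)\<bar>"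
proof -
  have "(norm (ee x - 1))\<^sup>2 = (cos (2 * (pi * x)) - 1)\<^sup>2 + (sin (2 * (pi * x)))\<^sup>2"
    by (simp add: ee_def cmod_power2 mult_ac)
  also have "\<dots> = (cos (2 * (pi * x)))\<^sup>2 + (sin (2 * (pi * x)))\<^sup>2 + 1 - 2 * cos (2 * (pi * x))"
    by (simp add: power2_eq_square algebra_simps)
  also have "\<dots> = 2 - 2 * cos (2 * (pi * x))" by simp
  also have "\<dots> = (2 * \<bar>sin (pi * x)\<bar>)\<^sup>2"
    by (simp add: cos_double_sin power_mult_distrib)
  finally show ?thesis by (rule power2_eq_imp_eq) auto
qed

lemma norm_ee_diff_le: "norm (ee x - ee y) \<le> 2 * pi * \<bar>x - y\<bar>"
proof -
  have "ee x - ee y = ee y * (ee (x - y) - 1)"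
    by (simp add: ring_distribs flip: ee_add)
  then have "norm (ee x - ee y) = 2 * \<bar>sin (pi * (x - y))\<bar>"
    by (simp add: norm_mult norm_ee_minus_one)
  also have "\<dots> \<le> 2 * \<bar>pi * (x - y)\<bar>"
    using abs_sin_x_le_abs_x by simp
  finally show ?thesis by (simp add: abs_mult)
qed

text \<open>The factor \<open>1 / 2\<close> is weaker than the optimal \<open>2 / pi\<close>, but
  the cubic Taylor bound alone gives it: \<open>x\<^sup>2 / 6\<close> stays below
  \<open>1 / 2\<close> because \<open>(pi / 2)\<^sup>2 < 3\<close>.\<close>

lemma abs_sin_ge_half:
  fixes x :: real assumes "\<bar>x\<bar> \<le> pi / 2" shows "\<bar>x\<bar> / 2 \<le> \<bar>sin x\<bar>"
proof -
  have p: "pi \<le> 3.2" using pi_approx by simp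
  have "\<bar>sin x - (\<Sum>m<3. sin_coeff m * x ^ m)\<bar> \<le> inverse (fact 3) * \<bar>x\<bar> ^ 3"
    by (rule Maclaurin_sin_bound)
  then have 1: "\<bar>sin x - x\<bar> \<le> \<bar>x\<bar> ^ 3 / 6"
    by (simp add: eval_nat_numeral sin_coeff_def)
  have "\<bar>x\<bar> ^ 2 \<le> 1.6 ^ 2" using assms p by (intro power_mono) auto
  then have "\<bar>x\<bar> ^ 2 * \<bar>x\<bar> \<le> 3 * \<bar>x\<bar>" by (intro mult_right_mono) (auto simp: power2_eq_square)
  then have "\<bar>x\<bar> ^ 3 / 6 \<le> \<bar>x\<bar> / 2" by (simp add: eval_nat_numeral)
  with 1 show ?thesis by linarith
qed

text \<open>Comparison with every integer encodes the distance to the nearest one; subtracting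
  \<open>round x\<close> brings the sine bound into range.\<close>

lemma norm_ee_minus_one_ge:
  assumes "\<And>k::int. \<delta> \<le> \<bar>x - of_int k\<bar>" "0 \<le> \<delta>"
  shows "2 * \<delta> \<le> norm (ee x - 1)"
proof -
  define y where "y = x - of_int (round x)"
  have "\<bar>y\<bar> \<le> 1/2" using of_int_round_abs_le[of x] by (simp add: y_def abs_minus_commute)
  have "ee x = ee y" by (rule ee_eq_intdiff[of _ _ "round x"]) (simp add: y_def)
  have "\<bar>pi * y\<bar> \<le> pi / 2" using \<open>\<bar>y\<bar> \<le> 1/2\<close> by (simp add: abs_mult)
  from abs_sin_ge_half[OF this] have "pi * \<bar>y\<bar> \<le> 2 * \<bar>sin (pi * y)\<bar>"
    by (simp add: abs_mult)
  moreover have "2 * \<bar>y\<bar> \<le> pi * \<bar>y\<bar>" using pi_ge_two by (intro mult_right_mono) auto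
  moreover have "\<delta> \<le> \<bar>y\<bar>" using assms(1) by (simp add: y_def)
  ultimately show ?thesis by (simp add: \<open>ee x = ee y\<close> norm_ee_minus_one)
qed

lemma norm_sum_ee_le:
  assumes "\<And>k::int. \<delta> \<le> \<bar>\<theta> - of_int k\<bar>" "0 < \<delta>"
  shows "norm (\<Sum>t<n. ee (\<theta> * real t + c)) \<le> 1 / \<delta>"
proof -
  have ge: "2 * \<delta> \<le> norm (ee \<theta> - 1)"
    by (rule norm_ee_minus_one_ge) (use assms in auto)
  then have ne: "ee \<theta> \<noteq> 1" using assms(2) by auto
  have "(\<Sum>t<n. ee (\<theta> * real t + c)) = ee c * (\<Sum>t<n. ee \<theta> ^ t)"
    by (simp add: ee_add ee_power sum_distrib_left mult_ac)
  also have "\<dots> = ee c * ((ee \<theta> ^ n - 1) / (ee \<theta> - 1))"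
    using ne by (simp add: geometric_sum)
  finally have "norm (\<Sum>t<n. ee (\<theta> * real t + c)) = norm (ee \<theta> ^ n - 1) / norm (ee \<theta> - 1)"
    by (simp add: norm_mult norm_divide)
  also have "norm (ee \<theta> ^ n - 1) \<le> 2"
    using norm_triangle_ineq4[of "ee \<theta> ^ n" 1] by (simp add: norm_power)
  also have "2 / norm (ee \<theta> - 1) \<le> 2 / (2 * \<delta>)"
    using ge assms(2) by (intro divide_left_mono mult_pos_pos) auto
  finally show ?thesis by (simp add: divide_right_mono)
qed

lemma norm_sum_ee_le':
  assumes "\<And>k::int. \<delta> \<le> \<bar>\<theta> - of_int k\<bar>" "0 < \<delta>"
  shows "norm (\<Sum>t\<in>{1..n}. ee (\<theta> * real t)) \<le> 1 / \<delta>"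
proof -
  have "(\<Sum>t\<in>{1..n}. ee (\<theta> * real t)) = (\<Sum>t<n. ee (\<theta> * real t + \<theta>))"
    by (rule sum.reindex_bij_witness[of _ Suc "\<lambda>t. t - 1"]) (auto simp: ring_distribs add.commute)
  then show ?thesis using norm_sum_ee_le[OF assms, of \<theta> n] by simp
qed

text \<open>Orthogonality of additive characters modulo \<open>M\<close>: if \<open>M\<close> does
  not divide \<open>j\<close>, the sum is geometric with a nontrivial root of unity as
  ratio.\<close>

lemma sum_ee_roots:
  fixes j :: int assumes "0 < M"
  shows "(\<Sum>k<M. ee (real k * of_int j / real M)) = (if int M dvd j then of_nat M else 0)"
proof (cases "int M dvd j")
  case True
  then obtain i where j: "j = int M * i" by blast
  have "ee (real k * of_int j / real M) = 1" for k
  proof -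
    have "real k * of_int j / real M = of_int (int k * i)" using assms by (simp add: j)
    then show ?thesis using ee_of_int by metis
  qed
  then show ?thesis using True by simp
next
  case False
  define z where "z = ee (of_int j / real M)"
  have "z \<noteq> 1"
  proof
    assume "z = 1"
    then have "of_int j / real M \<in> \<int>" unfolding z_def ee_eq_1_iff .
    then obtain i where "of_int j / real M = of_int i" by (auto elim: Ints_cases)
    then have "real_of_int j = of_int (int M * i)" using assms by (simp add: field_simps)
    then have "j = int M * i" by (simp only: of_int_eq_iff)
    then show False using False by auto
  qed
  have "z ^ M = 1" using assms by (simp add: z_def ee_power)
  have "(\<Sum>k<M. ee (real k * of_int j / real M)) = (\<Sum>k<M. z ^ k)"
    by (simp add: z_def ee_power)
  also have "\<dots> = 0" using geometric_sum[OF \<open>z \<noteq> 1\<close>, of M] \<open>z ^ M = 1\<close> by simp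
  finally show ?thesis using False by simp
qed

text \<open>Summation by parts: a weight costs its final value plus its total variation. It attaches
  the weights \<open>2 * n + 1\<close>, and later a slowly varying phase, to bounds for unweighted
  partial sums.\<close>

lemma norm_sum_abel:
  fixes c w :: "nat \<Rightarrow> complex"
  assumes "\<And>k. k \<le> n \<Longrightarrow> norm (\<Sum>i<k. c i) \<le> B"
  shows "norm (\<Sum>i<n. c i * w i) \<le> B * (norm (w n) + (\<Sum>i<n. norm (w (Suc i) - w i)))"
proof -
  have eq: "(\<Sum>i<n. c i * w i) = (\<Sum>i<n. c i) * w n - (\<Sum>i<n. (\<Sum>j<Suc i. c j) * (w (Suc i) - w i))"
    by (induction n) (simp_all add: algebra_simps)
  have "norm (\<Sum>i<n. c i * w i) \<le> norm ((\<Sum>i<n. c i) * w n) + norm (\<Sum>i<n. (\<Sum>j<Suc i. c j) * (w (Suc i) - w i))"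
    unfolding eq by (rule norm_triangle_ineq4)
  also have "\<dots> \<le> B * norm (w n) + (\<Sum>i<n. B * norm (w (Suc i) - w i))"
  proof (intro add_mono order_trans[OF norm_sum] sum_mono)
    show "norm ((\<Sum>i<n. c i) * w n) \<le> B * norm (w n)"
      unfolding norm_mult by (intro mult_right_mono assms) auto
  next
    fix i assume "i \<in> {..<n}"
    then show "norm ((\<Sum>j<Suc i. c j) * (w (Suc i) - w i)) \<le> B * norm (w (Suc i) - w i)"
      unfolding norm_mult by (intro mult_right_mono assms) auto
  qed
  also have "\<dots> = B * (norm (w n) + (\<Sum>i<n. norm (w (Suc i) - w i)))"
    by (simp add: ring_distribs sum_distrib_left)
  finally show ?thesis .
qed

section \<open>Square sums and Weyl differencing\<close>

text \<open>The square is expanded and pairs are grouped by their difference \<open>h\<close>; pairs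
  in opposite order are conjugate, hence the factor 2. For a quadratic phase each correlation is a
  geometric sum.\<close>

lemma norm_sum_squared_le_correlations:
  fixes z :: "nat \<Rightarrow> complex"
  shows "(norm (\<Sum>n<m. z n))\<^sup>2 \<le> (\<Sum>n<m. (norm (z n))\<^sup>2)
           + 2 * (\<Sum>h\<in>{1..<m}. norm (\<Sum>n<m-h. z (n + h) * cnj (z n)))"
proof -
  define D where "D = (\<Sum>i<m. \<Sum>j<i. z i * cnj (z j))"
  have D: "D = (\<Sum>h\<in>{1..<m}. \<Sum>n<m-h. z (n + h) * cnj (z n))"
    unfolding D_def sum.Sigma[OF finite_lessThan ballI[OF finite_lessThan]]
      sum.Sigma[OF finite_atLeastLessThan ballI[OF finite_lessThan]]
    by (rule sum.reindex_bij_witness[of _ "\<lambda>(h, n). (n + h, n)" "\<lambda>(i, j). (i - j, j)"]) auto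
  have "of_real ((norm (\<Sum>n<m. z n))\<^sup>2) = of_real (\<Sum>n<m. (norm (z n))\<^sup>2) + D + cnj D"
    unfolding D_def
  proof (induction m)
    case (Suc m)
    define S where "S = (\<Sum>n<m. z n)"
    have "of_real ((norm (S + z m))\<^sup>2) = of_real ((norm S)\<^sup>2) + of_real ((norm (z m))\<^sup>2)
            + z m * cnj S + S * cnj (z m)"
      by (simp add: complex_norm_square algebra_simps del: of_real_power)
    then show ?case using Suc.IH
      by (simp add: S_def algebra_simps sum_distrib_left del: of_real_power)
  qed simp
  then have "(norm (\<Sum>n<m. z n))\<^sup>2 = Re (of_real (\<Sum>n<m. (norm (z n))\<^sup>2) + D + cnj D)"
    by (metis Re_complex_of_real)
  also have "\<dots> = (\<Sum>n<m. (norm (z n))\<^sup>2) + 2 * Re D" by simp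
  also have "Re D \<le> norm D" by (rule complex_Re_le_cmod)
  also have "norm D \<le> (\<Sum>h\<in>{1..<m}. norm (\<Sum>n<m-h. z (n + h) * cnj (z n)))"
    unfolding D by (rule norm_sum)
  finally show ?thesis by simp
qed

text \<open>Within a window of length \<open>q / 4\<close> the points \<open>2 h \<theta>\<close> are \<open>1 / (2 q)\<close>-separated modulo one.\<close>

lemma card_near_integers_le:
  fixes a :: int and q R :: nat and \<theta> \<delta> :: real
  assumes q: "0 < q" and cop: "coprime a (int q)"
    and \<theta>: "\<bar>\<theta> - of_int a / real q\<bar> \<le> 1 / (real q)\<^sup>2" and \<delta>: "0 < \<delta>"
  shows "real (card {h\<in>{1..R}. \<exists>k::int. \<bar>2 * real h * \<theta> - of_int k\<bar> < \<delta>})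
          \<le> (4 * real R / real q + 1) * (4 * real q * \<delta> + 3)"
proof -
  define B where "B = {h\<in>{1..R}. \<exists>k::int. \<bar>2 * real h * \<theta> - of_int k\<bar> < \<delta>}"
  have "\<exists>kk. \<forall>h\<in>B. \<bar>2 * real h * \<theta> - of_int (kk h)\<bar> < \<delta>"
    by (rule bchoice) (auto simp: B_def)
  then obtain kk :: "nat \<Rightarrow> int" where kk: "\<And>h. h \<in> B \<Longrightarrow> \<bar>2 * real h * \<theta> - of_int (kk h)\<bar> < \<delta>"
    by blast
  \<comment> \<open>Two members of one window differ by at most \<open>q div 4\<close>, the most
    that the separation argument tolerates.\<close>
  define w where "w = q div 4 + 1"
  define d where "d h = 2 * real h * \<theta> - of_int (kk h)" for h
  \<comment> \<open>\<open>\<Phi>\<close> records the window of \<open>h\<close> and the cell, of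
    width \<open>1 / (2 * q)\<close>, that holds the signed offset of
    \<open>2 * h * \<theta>\<close> from an integer. Once \<open>\<Phi>\<close> is injective, the
    count is at most windows times cells.\<close>
  define \<Phi> where "\<Phi> h = (h div w, \<lfloor>2 * real q * d h\<rfloor>)" for h
  define c where "c = \<lceil>2 * real q * \<delta>\<rceil>"
  have w0: "0 < w" by (simp add: w_def)
  have c0: "0 \<le> c" proof -
    have "0 \<le> 2 * real q * \<delta>" using \<delta> by simp
    then show ?thesis unfolding c_def by linarith
  qed
  have inj: "inj_on \<Phi> B"
  proof (rule inj_onI, rule ccontr)
    fix x y assume xy: "x \<in> B" "y \<in> B" "\<Phi> x = \<Phi> y" "x \<noteq> y"
    define j where "j = int x - int y"
    have j0: "j \<noteq> 0" using xy by (simp add: j_def)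
    have "x = w * (x div w) + x mod w" by simp
    moreover have "y = w * (x div w) + y mod w"
      using xy mult_div_mod_eq[of w y] by (simp add: \<Phi>_def)
    moreover have "x mod w < w" "y mod w < w" using w0 by auto
    ultimately have "\<bar>j\<bar> < int w" unfolding j_def
      by (smt (verit, ccfv_threshold) of_nat_add of_nat_less_iff of_nat_0_le_iff)
    then have jle: "4 * \<bar>j\<bar> \<le> int q" unfolding w_def by linarith
    have "\<lfloor>2 * real q * d x\<rfloor> = \<lfloor>2 * real q * d y\<rfloor>" using xy by (simp add: \<Phi>_def)
    then have "\<bar>2 * real q * d x - 2 * real q * d y\<bar> < 1" by linarith
    then have dd: "\<bar>2 * real q * (d x - d y)\<bar> < 1" by (simp add: right_diff_distrib)
    define \<beta> where "\<beta> = \<theta> - of_int a / real q"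
    have ab: "\<bar>real q * real q * \<beta>\<bar> \<le> 1"
      using \<theta> q by (simp add: \<beta>_def[symmetric] abs_mult power2_eq_square pos_le_divide_eq mult.commute)
    have "4 * \<bar>real_of_int j\<bar> \<le> real q" using jle by linarith
    have "\<bar>4 * real_of_int j * (real q * \<beta>)\<bar> \<le> \<bar>real q * (real q * \<beta>)\<bar>"
      unfolding abs_mult using \<open>4 * \<bar>real_of_int j\<bar> \<le> real q\<close> by (intro mult_right_mono) auto
    then have jb: "\<bar>2 * real_of_int j * real q * \<beta>\<bar> \<le> 1 / 2" using ab by (simp add: mult_ac)
    \<comment> \<open>Both terms on the right are at most 1/2 in absolute value, the first strictly.
      So the integer on the left is 0 and \<open>q\<close> divides \<open>2 * j\<close>, which is
      nonzero and at most \<open>q / 2\<close>.\<close>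
    have "real_of_int (2 * j * a - (kk x - kk y) * int q)
            = real q * (d x - d y) - 2 * real_of_int j * real q * \<beta>"
      using q by (simp add: d_def \<beta>_def j_def field_simps)
    then have "\<bar>real_of_int (2 * j * a - (kk x - kk y) * int q)\<bar> < 1" using dd jb by linarith
    then have "2 * j * a - (kk x - kk y) * int q = 0" by linarith
    then have "int q dvd 2 * j * a" by (metis dvd_triv_right eq_iff_diff_eq_0)
    then have "int q dvd 2 * j"
      using cop by (simp add: coprime_commute coprime_dvd_mult_left_iff)
    then have "int q \<le> 2 * \<bar>j\<bar>" using j0 dvd_imp_le_int[of "2*j" "int q"] by simp
    then show False using jle j0 by linarith
  qed
  have sub: "\<Phi> ` B \<subseteq> {0..R div w} \<times> {-c..c}"
  proof
    fix p assume "p \<in> \<Phi> ` B"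
    then obtain h where h: "h \<in> B" "p = \<Phi> h" by blast
    have "h div w \<le> R div w" using h by (auto simp: B_def intro: div_le_mono)
    moreover have "\<bar>2 * real q * d h\<bar> \<le> 2 * real q * \<delta>"
      unfolding abs_mult using kk[OF h(1)] by (simp add: d_def mult_left_mono)
    then have "-c \<le> \<lfloor>2 * real q * d h\<rfloor>" "\<lfloor>2 * real q * d h\<rfloor> \<le> c" unfolding c_def by linarith+
    ultimately show "p \<in> {0..R div w} \<times> {-c..c}" by (simp add: h \<Phi>_def)
  qed
  have "card B = card (\<Phi> ` B)" using inj by (simp add: card_image)
  also have "\<dots> \<le> card ({0..R div w} \<times> {-c..c})" by (rule card_mono[OF _ sub]) auto
  also have "\<dots> = (R div w + 1) * nat (2 * c + 1)" by (simp add: card_cartesian_product)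
  finally have "real (card B) \<le> real (R div w + 1) * real (nat (2 * c + 1))"
    by (metis of_nat_le_iff of_nat_mult)
  also have "\<dots> \<le> (4 * real R / real q + 1) * (4 * real q * \<delta> + 3)"
  proof (intro mult_mono)
    have "real (R div w) \<le> real R / real w" by (rule of_nat_div_le_of_nat)
    also have "\<dots> \<le> real R / (real q / 4)"
    proof (intro divide_left_mono)
      have "q \<le> 4 * w" unfolding w_def by presburger
      then show "real q / 4 \<le> real w" by linarith
    qed (use q w0 in auto)
    finally show "real (R div w + 1) \<le> 4 * real R / real q + 1" by (simp add: mult.commute)
    have "real_of_int c \<le> 2 * real q * \<delta> + 1" unfolding c_def by linarith
    then show "real (nat (2 * c + 1)) \<le> 4 * real q * \<delta> + 3" using c0 by simp
  qed (use \<delta> in auto)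
  finally show ?thesis by (simp add: B_def)
qed

text \<open>Shifts \<open>h\<close> for which \<open>2 * h * \<theta>\<close> is within
  \<open>\<tau> / R\<close> of an integer are bounded trivially and counted by the previous lemma;
  all others give geometric sums. \<open>\<tau>\<close> is left free to balance the two. All lengths
  \<open>m \<le> R\<close> are treated because summation by parts asks for every partial
  sum.\<close>

lemma weyl_square_sum:
  fixes a :: int and q R m :: nat and \<theta> \<tau> :: real
  assumes q: "0 < q" and cop: "coprime a (int q)"
    and \<theta>: "\<bar>\<theta> - of_int a / real q\<bar> \<le> 1 / (real q)\<^sup>2" and \<tau>: "0 < \<tau>" and m: "m \<le> R" and R: "0 < R"
  shows "(norm (\<Sum>n<m. ee (\<theta> * (real (Suc n))\<^sup>2)))\<^sup>2
     \<le> real R + 2 * (real R)\<^sup>2 / \<tau> + 2 * real R * ((4 * real R / real q + 1) * (4 * real q * (\<tau> / real R) + 3))"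
proof -
  define \<delta> where "\<delta> = \<tau> / real R"
  have \<delta>: "0 < \<delta>" using \<tau> R by (simp add: \<delta>_def)
  define B where "B = {h\<in>{1..R}. \<exists>k::int. \<bar>2 * real h * \<theta> - of_int k\<bar> < \<delta>}"
  define z where "z n = ee (\<theta> * (real (Suc n))\<^sup>2)" for n
  define T where "T = (4 * real R / real q + 1) * (4 * real q * \<delta> + 3)"
  have inner: "norm (\<Sum>n<m-h. z (n + h) * cnj (z n)) \<le> (if h \<in> B then real R else 0) + 1 / \<delta>"
    if h: "h \<in> {1..<m}" for h
  proof (cases "h \<in> B")
    case True
    have "norm (\<Sum>n<m-h. z (n + h) * cnj (z n)) \<le> real (card {..<m-h}) * 1"
      by (rule sum_norm_bound) (simp add: z_def norm_mult)
    also have "\<dots> \<le> real R" using m by simp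
    finally show ?thesis using True \<delta> by (simp add: add_increasing2)
  next
    case False
    have "z (n + h) * cnj (z n) = ee ((2 * real h * \<theta>) * real n + \<theta> * (2 * real h + (real h)\<^sup>2))" for n
      unfolding z_def cnj_ee ee_add[symmetric]
      by (rule arg_cong[of _ _ ee]) (simp add: power2_eq_square algebra_simps)
    then have "norm (\<Sum>n<m-h. z (n + h) * cnj (z n))
                = norm (\<Sum>n<m-h. ee ((2 * real h * \<theta>) * real n + \<theta> * (2 * real h + (real h)\<^sup>2)))"
      by simp
    also have "\<dots> \<le> 1 / \<delta>"
      by (rule norm_sum_ee_le[OF _ \<delta>]) (use False h m in \<open>auto simp: B_def not_less\<close>)
    finally show ?thesis using False by simp
  qed
  have "(norm (\<Sum>n<m. z n))\<^sup>2 \<le> (\<Sum>n<m. (norm (z n))\<^sup>2)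
           + 2 * (\<Sum>h\<in>{1..<m}. norm (\<Sum>n<m-h. z (n + h) * cnj (z n)))"
    by (rule norm_sum_squared_le_correlations)
  also have "(\<Sum>n<m. (norm (z n))\<^sup>2) = real m" by (simp add: z_def)
  also have "(\<Sum>h\<in>{1..<m}. norm (\<Sum>n<m-h. z (n + h) * cnj (z n)))
              \<le> (\<Sum>h\<in>{1..<m}. (if h \<in> B then real R else 0) + 1 / \<delta>)"
    by (rule sum_mono) (rule inner)
  also have "\<dots> \<le> (\<Sum>h\<in>{1..R}. (if h \<in> B then real R else 0) + 1 / \<delta>)"
    by (rule sum_mono2) (use m \<delta> in auto)
  also have "\<dots> = real R * real (card B) + real R / \<delta>"
  proof -
    have "{1..R} \<inter> B = B" by (auto simp: B_def)
    then show ?thesis by (simp add: sum.distrib sum.If_cases mult.commute)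
  qed
  also have "real (card B) \<le> (4 * real R / real q + 1) * (4 * real q * \<delta> + 3)"
    unfolding B_def by (rule card_near_integers_le[OF q cop \<theta> \<delta>])
  finally have "(norm (\<Sum>n<m. z n))\<^sup>2 \<le> real m + 2 * (real R * T + real R / \<delta>)"
    by (simp add: mult_left_mono T_def)
  moreover have "real R / \<delta> = (real R)\<^sup>2 / \<tau>" using R by (simp add: \<delta>_def power2_eq_square)
  moreover have "real m \<le> real R" using m by simp
  ultimately have "(norm (\<Sum>n<m. z n))\<^sup>2 \<le> real R + 2 * (real R)\<^sup>2 / \<tau> + 2 * real R * T"
    by simp
  then show ?thesis unfolding z_def \<delta>_def T_def .
qed

lemma sum_periodic_shift:
  fixes f :: "nat \<Rightarrow> complex"
  assumes "\<And>n. f (n + q) = f n"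
  shows "(\<Sum>h<q. f (s + h)) = (\<Sum>h<q. f h)"
proof (induction s)
  case (Suc s)
  have "(\<Sum>h<Suc q. f (s + h)) = f s + (\<Sum>h<q. f (s + Suc h))"
    by (subst sum.lessThan_Suc_shift) simp
  then show ?case using Suc.IH assms[of s] by (simp add: add_ac)
qed simp

text \<open>Whole periods cancel, and what remains is shorter than one period.\<close>

lemma norm_sum_periodic_le:
  fixes c :: "nat \<Rightarrow> complex"
  assumes "0 < q" "\<And>n. c (n + q) = c n" "(\<Sum>n<q. c n) = 0" "\<And>n. norm (c n) \<le> 2"
  shows "norm (\<Sum>n<k. c n) \<le> 2 * real q"
proof (induction k rule: less_induct)
  case (less k)
  show ?case
  proof (cases "k < q")
    case True
    have "norm (\<Sum>n<k. c n) \<le> real (card {..<k}) * 2" by (rule sum_norm_bound) (use assms in auto)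
    then show ?thesis using True by simp
  next
    case False
    then obtain j where j: "k = j + q" by (metis add.commute le_Suc_ex not_less)
    have "(\<Sum>n<j + q. c n) = (\<Sum>n<j. c n) + (\<Sum>h<q. c (j + h))"
      by (induction q) (simp_all add: add_ac)
    then have "(\<Sum>n<k. c n) = (\<Sum>n<j. c n)" using sum_periodic_shift[of c q j] assms j by simp
    then show ?thesis using less.IH[of j] j assms by simp
  qed
qed

section \<open>Normalised quadratic Gauss sums\<close>

definition gauss :: "nat \<Rightarrow> nat \<Rightarrow> complex" where
  "gauss a q = (\<Sum>r<q. ee (real a * (real r)\<^sup>2 / real q)) / of_nat q"

lemma ee_square_periodic:
  assumes "0 < q"
  shows "ee (real a * (real (n + q))\<^sup>2 / real q) = ee (real a * (real n)\<^sup>2 / real q)"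
  by (rule ee_eq_intdiff[of _ _ "int (a * (2 * n + q))"])
     (use assms in \<open>simp add: field_simps power2_eq_square\<close>)

lemma gauss_shift:
  assumes "0 < q"
  shows "(\<Sum>r<q. ee (real a * (real (Suc r))\<^sup>2 / real q)) = of_nat q * gauss a q"
  using sum_periodic_shift[where f = "\<lambda>n. ee (real a * (real n)\<^sup>2 / real q)" and q = q and s = 1]
    ee_square_periodic[OF assms] assms by (simp add: gauss_def)

text \<open>Opening the square and shifting by \<open>h\<close> leaves a complete character sum in
  \<open>s\<close>, which vanishes unless \<open>q\<close> divides \<open>2 * h\<close>. Only
  \<open>h = 0\<close> and, for even \<open>q\<close>, \<open>h = q div 2\<close> survive; hence the
  2.\<close>

lemma norm_gauss_squared_le:
  assumes q: "0 < q" and cop: "coprime a q"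
  shows "(norm (gauss a q))\<^sup>2 \<le> 2 / real q"
proof -
  define z where "z n = ee (real a * (real n)\<^sup>2 / real q)" for n
  define T where "T = (\<Sum>r<q. z r)"
  have zper: "z (n + q) = z n" for n unfolding z_def by (rule ee_square_periodic[OF q])
  have corr: "z (s + h) * cnj (z s) = ee (real a * (real h)\<^sup>2 / real q) * ee (real s * of_int (int (2 * a * h)) / real q)" for s h
    unfolding z_def cnj_ee ee_add[symmetric]
    by (rule arg_cong[of _ _ ee]) (use q in \<open>simp add: field_simps power2_eq_square\<close>)
  have "of_real ((norm T)\<^sup>2) = T * cnj T" by (rule complex_norm_square)
  also have "\<dots> = (\<Sum>s<q. T * cnj (z s))" by (simp add: T_def sum_distrib_left)
  also have "\<dots> = (\<Sum>s<q. \<Sum>h<q. z (s + h) * cnj (z s))"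
  proof (intro sum.cong refl)
    fix s
    have "T = (\<Sum>h<q. z (s + h))" unfolding T_def by (rule sum_periodic_shift[symmetric]) (rule zper)
    then show "T * cnj (z s) = (\<Sum>h<q. z (s + h) * cnj (z s))" by (simp add: sum_distrib_right)
  qed
  also have "\<dots> = (\<Sum>h<q. \<Sum>s<q. z (s + h) * cnj (z s))" by (rule sum.swap)
  also have "\<dots> = (\<Sum>h<q. ee (real a * (real h)\<^sup>2 / real q) * (if int q dvd int (2 * a * h) then of_nat q else 0))"
    unfolding corr sum_distrib_left[symmetric] sum_ee_roots[OF q] ..
  finally have "(norm T)\<^sup>2 = norm (\<Sum>h<q. ee (real a * (real h)\<^sup>2 / real q) * (if int q dvd int (2 * a * h) then of_nat q else 0))"
    by (metis norm_of_real abs_of_nonneg zero_le_power2)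
  also have "\<dots> \<le> (\<Sum>h<q. (if int q dvd int (2 * a * h) then real q else 0))"
    by (intro order_trans[OF norm_sum] sum_mono) (auto simp: norm_mult)
  also have "\<dots> = real q * real (card {h\<in>{..<q}. int q dvd int (2 * a * h)})"
    by (subst sum.inter_filter[symmetric]) auto
  also have "\<dots> \<le> real q * 2"
  proof (intro mult_left_mono)
    have "{h\<in>{..<q}. int q dvd int (2 * a * h)} \<subseteq> {0, q div 2}"
    proof (rule subsetI, rule ccontr)
      fix h assume "h \<in> {h\<in>{..<q}. int q dvd int (2 * a * h)}" and hn: "h \<notin> {0, q div 2}"
      then have h: "h < q" "int q dvd int (2 * a * h)" "h \<noteq> 0" by auto
      have "q dvd a * (2 * h)" using h(2) by (simp only: int_dvd_int_iff mult_ac)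
      then have "q dvd 2 * h" using cop by (simp add: coprime_commute coprime_dvd_mult_right_iff)
      then obtain k where k: "2 * h = q * k" by blast
      have "k \<noteq> 0"
      proof
        assume "k = 0"
        then show False using k h(3) by simp
      qed
      moreover have "k < 2" using k h(1) by (metis mult.commute mult_less_cancel1 not_less nat_mult_le_cancel1 less_le_trans mult_le_mono1 nat_mult_less_cancel1 pos2)
      ultimately have "k = 1" by simp
      then have "q div 2 = h" using k by auto
      then show False using hn by simp
    qed
    then have "card {h\<in>{..<q}. int q dvd int (2 * a * h)} \<le> card {0, q div 2}" by (intro card_mono) auto
    also have "\<dots> \<le> 2" by (simp add: card_insert_if)
    finally show "real (card {h\<in>{..<q}. int q dvd int (2 * a * h)}) \<le> 2" by simp
  qed auto
  finally have "(norm T)\<^sup>2 \<le> real q * 2" .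
  moreover have "(norm (gauss a q))\<^sup>2 = (norm T)\<^sup>2 / (real q)\<^sup>2"
    by (simp add: gauss_def T_def z_def norm_divide power_divide)
  ultimately have "(norm (gauss a q))\<^sup>2 \<le> real q * 2 / (real q)\<^sup>2" by (simp add: divide_right_mono)
  then show ?thesis using q by (simp add: power2_eq_square)
qed

lemma norm_gauss_le_1: "norm (gauss a q) \<le> 1"
proof (cases "q = 0")
  case False
  have "norm (\<Sum>r<q. ee (real a * (real r)\<^sup>2 / real q)) \<le> real (card {..<q}) * 1"
    by (rule sum_norm_bound) auto
  then show ?thesis using False by (simp add: gauss_def norm_divide)
qed (simp add: gauss_def)

section \<open>Approximating the weighted exponential sum over squares by a sum over
  rationals\<close>

definition square_sum :: "nat \<Rightarrow> real \<Rightarrow> complex" where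
  "square_sum R \<theta> = (\<Sum>n<R. of_nat (2 * n + 1) * ee (\<theta> * (real (Suc n))\<^sup>2))"

definition reduced_residues :: "nat \<Rightarrow> nat set" where "reduced_residues q = {a\<in>{..<q}. coprime a q}"

text \<open>The circle method prediction near \<open>a / q\<close>, but summed over all fractions
  with denominator up to \<open>Q\<close> and used at every \<theta>, so that later arguments see no
  division into arcs. The case \<open>q = 1\<close> enters through the residue 0.\<close>

definition model_sum :: "nat \<Rightarrow> nat \<Rightarrow> real \<Rightarrow> complex" where
  "model_sum Q X \<theta> = (\<Sum>q\<in>{1..Q}. \<Sum>a\<in>reduced_residues q.
     gauss a q * (\<Sum>t\<in>{1..X}. ee ((\<theta> - real a / real q) * real t)))"

text \<open>\<open>square_sum\<close> indexes squares by \<open>Suc n\<close>, so its weight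
  \<open>2 * n + 1\<close> is the number of integers in the block that ends at
  \<open>(Suc n)\<^sup>2\<close>.\<close>

lemma sum_upto_square:
  fixes f :: "nat \<Rightarrow> complex"
  shows "(\<Sum>t\<in>{1..R\<^sup>2}. f t) = (\<Sum>n<R. \<Sum>t\<in>{n\<^sup>2<..(Suc n)\<^sup>2}. f t)"
proof (induction R)
  case (Suc R)
  have "{1..v} = {1..u} \<union> {u<..v}" if "u \<le> v" for u v :: nat using that by auto
  from this[of "R\<^sup>2" "(Suc R)\<^sup>2"]
  have "{1..(Suc R)\<^sup>2} = {1..R\<^sup>2} \<union> {R\<^sup>2<..(Suc R)\<^sup>2}" by (simp add: power_mono)
  then have "(\<Sum>t\<in>{1..(Suc R)\<^sup>2}. f t) = (\<Sum>t\<in>{1..R\<^sup>2}. f t) + (\<Sum>t\<in>{R\<^sup>2<..(Suc R)\<^sup>2}. f t)"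
    by (simp only:) (rule sum.union_disjoint, auto)
  then show ?case using Suc.IH by simp
qed simp

text \<open>Each \<open>t\<close> is compared with the square at the right end of its block; the
  arguments of \<open>ee\<close> then differ by at most
  \<open>\<bar>\<beta>\<bar> * (2 * n + 1)\<close>.\<close>

lemma square_sum_near_zero:
  "norm (square_sum R \<beta> - (\<Sum>t\<in>{1..R\<^sup>2}. ee (\<beta> * real t))) \<le> 8 * pi * \<bar>\<beta>\<bar> * real R ^ 3"
proof -
  have card: "card {n\<^sup>2<..(Suc n)\<^sup>2} = 2 * n + 1" for n :: nat by (simp add: power2_eq_square)
  have "square_sum R \<beta> = (\<Sum>n<R. \<Sum>t\<in>{n\<^sup>2<..(Suc n)\<^sup>2}. ee (\<beta> * (real (Suc n))\<^sup>2))"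
    unfolding square_sum_def by (simp only: sum_constant card)
  then have "square_sum R \<beta> - (\<Sum>t\<in>{1..R\<^sup>2}. ee (\<beta> * real t))
      = (\<Sum>n<R. \<Sum>t\<in>{n\<^sup>2<..(Suc n)\<^sup>2}. ee (\<beta> * (real (Suc n))\<^sup>2) - ee (\<beta> * real t))"
    by (simp only: sum_upto_square sum_subtractf)
  also have "norm \<dots> \<le> real (card {..<R}) * (8 * pi * \<bar>\<beta>\<bar> * (real R)\<^sup>2)"
  proof (rule sum_norm_bound)
    fix n assume n: "n \<in> {..<R}"
    have "norm (\<Sum>t\<in>{n\<^sup>2<..(Suc n)\<^sup>2}. ee (\<beta> * (real (Suc n))\<^sup>2) - ee (\<beta> * real t))
            \<le> real (card {n\<^sup>2<..(Suc n)\<^sup>2}) * (2 * pi * (\<bar>\<beta>\<bar> * real (2 * n + 1)))"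
    proof (rule sum_norm_bound)
      fix t assume t: "t \<in> {n\<^sup>2<..(Suc n)\<^sup>2}"
      have "norm (ee (\<beta> * (real (Suc n))\<^sup>2) - ee (\<beta> * real t)) \<le> 2 * pi * \<bar>\<beta> * (real (Suc n))\<^sup>2 - \<beta> * real t\<bar>"
        by (rule norm_ee_diff_le)
      also have "\<beta> * (real (Suc n))\<^sup>2 - \<beta> * real t = \<beta> * real_of_int (int ((Suc n)\<^sup>2) - int t)"
        by (simp add: right_diff_distrib)
      also have "2 * pi * \<bar>\<beta> * real_of_int (int ((Suc n)\<^sup>2) - int t)\<bar> \<le> 2 * pi * (\<bar>\<beta>\<bar> * real (2 * n + 1))"
      proof -
        have "n\<^sup>2 < t" "t \<le> (Suc n)\<^sup>2" using t by auto
        then have "int (n\<^sup>2) < int t" "int t \<le> int ((Suc n)\<^sup>2)" by (simp_all only: of_nat_le_iff of_nat_less_iff)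
        moreover have "int ((Suc n)\<^sup>2) = int (n\<^sup>2) + int (2 * n + 1)" by (simp add: power2_eq_square)
        ultimately have "\<bar>int ((Suc n)\<^sup>2) - int t\<bar> \<le> int (2 * n + 1)" by linarith
        then have "\<bar>real_of_int (int ((Suc n)\<^sup>2) - int t)\<bar> \<le> real (2 * n + 1)"
          by (metis of_int_abs of_int_le_iff of_int_of_nat_eq)
        then show ?thesis unfolding abs_mult by (intro mult_left_mono) auto
      qed
      finally show "norm (ee (\<beta> * (real (Suc n))\<^sup>2) - ee (\<beta> * real t)) \<le> 2 * pi * (\<bar>\<beta>\<bar> * real (2 * n + 1))" .
    qed
    also have "\<dots> = (2 * pi * \<bar>\<beta>\<bar>) * (real (2 * n + 1))\<^sup>2" unfolding card by (simp only: power2_eq_square mult_ac)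
    also have "\<dots> \<le> (2 * pi * \<bar>\<beta>\<bar>) * (2 * real R)\<^sup>2"
      using n by (intro mult_left_mono power_mono) auto
    finally show "norm (\<Sum>t\<in>{n\<^sup>2<..(Suc n)\<^sup>2}. ee (\<beta> * (real (Suc n))\<^sup>2) - ee (\<beta> * real t)) \<le> 8 * pi * \<bar>\<beta>\<bar> * (real R)\<^sup>2"
      by (simp add: power_mult_distrib)
  qed
  finally show ?thesis by (simp add: power2_eq_square power3_eq_cube mult_ac)
qed

text \<open>The deviation \<open>c\<close> of the rational phase from its mean, the Gauss sum, has
  partial sums bounded by periodicity. Two summations by parts attach the weight and then the slow
  phase in \<beta>; the mean is left to the estimate near zero.\<close>

lemma square_sum_near_rational:
  assumes q: "0 < q"
  shows "norm (square_sum R (real a / real q + \<beta>) - gauss a q * (\<Sum>t\<in>{1..R\<^sup>2}. ee (\<beta> * real t)))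
     \<le> 10 * real q * real R + 216 * real q * real R ^ 3 * \<bar>\<beta>\<bar>"
proof -
  define c where "c n = ee (real a * (real (Suc n))\<^sup>2 / real q) - gauss a q" for n
  define w where "w n = (of_nat (2 * n + 1) :: complex)" for n
  define v where "v n = ee (\<beta> * (real (Suc n))\<^sup>2)" for n
  have c_le: "norm (\<Sum>n<k. c n) \<le> 2 * real q" for k
  proof (rule norm_sum_periodic_le[OF q])
    show "c (n + q) = c n" for n
      using ee_square_periodic[OF q, of a "Suc n"] by (simp add: c_def)
    show "(\<Sum>n<q. c n) = 0" by (simp add: c_def sum_subtractf gauss_shift[OF q, simplified])
    show "norm (c n) \<le> 2" for n
      unfolding c_def using norm_triangle_ineq4[of "ee (real a * (real (Suc n))\<^sup>2 / real q)" "gauss a q"]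
        norm_gauss_le_1[of a q] by simp
  qed
  have cw_le: "norm (\<Sum>n<k. c n * w n) \<le> 10 * real q * real R" if "k \<le> R" for k
  proof (cases "k = 0")
    case False
    have "norm (\<Sum>n<k. c n * w n) \<le> 2 * real q * (norm (w k) + (\<Sum>n<k. norm (w (Suc n) - w n)))"
      by (rule norm_sum_abel) (rule c_le)
    also have "norm (w k) = 2 * real k + 1" unfolding w_def norm_of_nat by simp
    also have "(\<Sum>n<k. norm (w (Suc n) - w n)) = 2 * real k" by (simp add: w_def)
    also have "2 * real q * (2 * real k + 1 + 2 * real k) \<le> 2 * real q * (5 * real R)"
      using False that by (intro mult_left_mono) auto
    finally show ?thesis by simp
  qed auto
  have cwv: "norm (\<Sum>n<R. (c n * w n) * v n) \<le> 10 * real q * real R + 190 * real q * real R ^ 3 * \<bar>\<beta>\<bar>"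
  proof -
    have vdiff: "norm (v (Suc n) - v n) \<le> 2 * pi * \<bar>\<beta>\<bar> * (2 * real n + 3)" for n
    proof -
      have "norm (v (Suc n) - v n) \<le> 2 * pi * \<bar>\<beta> * (real (Suc (Suc n)))\<^sup>2 - \<beta> * (real (Suc n))\<^sup>2\<bar>"
        unfolding v_def by (rule norm_ee_diff_le)
      also have "\<beta> * (real (Suc (Suc n)))\<^sup>2 - \<beta> * (real (Suc n))\<^sup>2 = \<beta> * (2 * real n + 3)"
        by (simp add: power2_eq_square algebra_simps)
      finally show ?thesis by (simp add: abs_mult)
    qed
    have s3: "(\<Sum>n<R. 2 * real n + 3) = (real R)\<^sup>2 + 2 * real R"
      by (induction R) (simp_all add: power2_eq_square algebra_simps)
    have RR: "real R \<le> (real R)\<^sup>2" by (cases "R = 0") (simp_all add: power2_eq_square)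
    have "norm (\<Sum>n<R. (c n * w n) * v n) \<le> 10 * real q * real R * (norm (v R) + (\<Sum>n<R. norm (v (Suc n) - v n)))"
      by (rule norm_sum_abel) (rule cw_le)
    also have "\<dots> \<le> 10 * real q * real R * (1 + 19 * (real R)\<^sup>2 * \<bar>\<beta>\<bar>)"
    proof (intro mult_left_mono add_mono)
      have "(\<Sum>n<R. norm (v (Suc n) - v n)) \<le> (\<Sum>n<R. 2 * pi * \<bar>\<beta>\<bar> * (2 * real n + 3))"
        by (rule sum_mono) (rule vdiff)
      also have "\<dots> = 2 * pi * \<bar>\<beta>\<bar> * ((real R)\<^sup>2 + 2 * real R)" by (simp only: sum_distrib_left[symmetric] s3)
      also have "\<dots> \<le> 2 * pi * \<bar>\<beta>\<bar> * (3 * (real R)\<^sup>2)" using RR by (intro mult_left_mono) auto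
      also have "\<dots> = (6 * pi) * ((real R)\<^sup>2 * \<bar>\<beta>\<bar>)" by simp
      also have "\<dots> \<le> 19 * ((real R)\<^sup>2 * \<bar>\<beta>\<bar>)" using pi_approx by (intro mult_right_mono) auto
      finally show "(\<Sum>n<R. norm (v (Suc n) - v n)) \<le> 19 * (real R)\<^sup>2 * \<bar>\<beta>\<bar>" by simp
    qed (auto simp: v_def)
    finally show ?thesis by (simp add: algebra_simps power2_eq_square power3_eq_cube)
  qed
  have zero: "norm (gauss a q * (square_sum R \<beta> - (\<Sum>t\<in>{1..R\<^sup>2}. ee (\<beta> * real t)))) \<le> 26 * real q * real R ^ 3 * \<bar>\<beta>\<bar>"
  proof -
    have "norm (gauss a q * (square_sum R \<beta> - (\<Sum>t\<in>{1..R\<^sup>2}. ee (\<beta> * real t)))) \<le> 1 * (8 * pi * \<bar>\<beta>\<bar> * real R ^ 3)"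
      unfolding norm_mult by (intro mult_mono norm_gauss_le_1 square_sum_near_zero) auto
    also have "\<dots> = (8 * pi) * (\<bar>\<beta>\<bar> * real R ^ 3)" by simp
    also have "\<dots> \<le> (26 * real q) * (\<bar>\<beta>\<bar> * real R ^ 3)" using pi_approx q by (intro mult_right_mono) auto
    finally show ?thesis by (simp add: mult_ac)
  qed
  have "square_sum R (real a / real q + \<beta>) = (\<Sum>n<R. w n * (ee (real a * (real (Suc n))\<^sup>2 / real q) * v n))"
    unfolding square_sum_def w_def v_def ee_add[symmetric] by (simp only: ring_distribs times_divide_eq_left)
  also have "\<dots> = (\<Sum>n<R. (c n * w n) * v n + gauss a q * (w n * v n))"
    by (intro sum.cong refl) (simp add: c_def algebra_simps)
  also have "\<dots> = (\<Sum>n<R. (c n * w n) * v n) + gauss a q * square_sum R \<beta>"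
    unfolding square_sum_def w_def v_def sum.distrib sum_distrib_left ..
  finally have "square_sum R (real a / real q + \<beta>) - gauss a q * (\<Sum>t\<in>{1..R\<^sup>2}. ee (\<beta> * real t))
    = (\<Sum>n<R. (c n * w n) * v n) + gauss a q * (square_sum R \<beta> - (\<Sum>t\<in>{1..R\<^sup>2}. ee (\<beta> * real t)))"
    by (simp add: algebra_simps)
  then have "norm (square_sum R (real a / real q + \<beta>) - gauss a q * (\<Sum>t\<in>{1..R\<^sup>2}. ee (\<beta> * real t)))
    \<le> (10 * real q * real R + 190 * real q * real R ^ 3 * \<bar>\<beta>\<bar>) + 26 * real q * real R ^ 3 * \<bar>\<beta>\<bar>"
    using norm_triangle_mono[OF cwv zero] by simp
  then show ?thesis by (simp add: mult_ac)
qed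

text \<open>The lower limit for \<open>q\<close> is the largest denominator of the model, the upper
  limit is what Dirichlet approximation will supply.\<close>

lemma square_sum_minor:
  fixes a :: int
  assumes P: "1000 \<le> P" and R: "P ^ 20 \<le> R" and q: "P ^ 4 \<le> q" "q * P ^ 14 \<le> R\<^sup>2"
    and cop: "coprime a (int q)" and \<theta>: "\<bar>\<theta> - of_int a / real q\<bar> \<le> 1 / (real q)\<^sup>2"
  shows "norm (square_sum R \<theta>) \<le> 5 / 16 * ((real R)\<^sup>2 / real P)"
proof -
  define p where "p = real P"
  define r where "r = real R"
  have p: "1000 \<le> p" using P by (simp add: p_def)
  have r: "p ^ 20 \<le> r" using R unfolding p_def r_def by (metis of_nat_le_iff of_nat_power)
  have q0: "0 < q" using q(1) P by (metis gr0I not_numeral_le_zero le_zero_eq power_eq_0_iff)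
  have qp: "p ^ 4 \<le> real q" using q(1) unfolding p_def by (metis of_nat_le_iff of_nat_power)
  have qr: "real q * p ^ 14 \<le> r\<^sup>2" using q(2) unfolding p_def r_def by (metis of_nat_le_iff of_nat_mult of_nat_power)
  have r1: "1 \<le> r" using order_trans[OF one_le_power r, of] p by simp
  then have R0: "0 < R" by (simp add: r_def)
  have partial: "norm (\<Sum>n<m. ee (\<theta> * (real (Suc n))\<^sup>2)) \<le> r / (16 * p)" if m: "m \<le> R" for m
  proof -
    \<comment> \<open>Weyl's bound with \<open>\<tau> = P ^ 3\<close>. The target is
      \<open>r\<^sup>2 / (256 * p\<^sup>2)\<close>, while all terms together stay below three times
      \<open>u = r\<^sup>2 / p ^ 3\<close>; the bound \<open>1000 \<le> p\<close> exceeds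
      \<open>3 * 256\<close>.\<close>
    have "(norm (\<Sum>n<m. ee (\<theta> * (real (Suc n))\<^sup>2)))\<^sup>2
       \<le> r + 2 * r\<^sup>2 / p ^ 3 + 2 * r * ((4 * r / real q + 1) * (4 * real q * (p ^ 3 / r) + 3))"
      unfolding r_def by (rule weyl_square_sum[OF q0 cop \<theta> _ m R0]) (use p in simp)
    also have "\<dots> = 7 * r + 2 * r\<^sup>2 / p ^ 3 + 32 * r * p ^ 3 + 24 * r\<^sup>2 / real q + 8 * real q * p ^ 3"
      using q0 r1 by (simp add: field_simps power2_eq_square)
    also have "\<dots> \<le> (r / (16 * p))\<^sup>2"
    proof -
      define u where "u = r\<^sup>2 / p ^ 3"
      have u0: "0 \<le> u" using p by (simp add: u_def)
      have "p ^ 17 \<ge> 1000 ^ 17" using p by (intro power_mono) auto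
      then have p17: "10000 \<le> p ^ 17" by (rule order_trans[rotated]) simp
      have "r * (p ^ 3 * p ^ 17) \<le> r * r" using r r1 by (intro mult_left_mono) (auto simp flip: power_add)
      then have "r * p ^ 3 * 10000 \<le> r * r"
        using mult_left_mono[OF p17, of "r * p ^ 3"] p r1 by (simp add: mult.assoc)
      have p14: "1000 * p ^ 6 \<le> p ^ 14"
      proof -
        have "p ^ 8 \<ge> 1000 ^ 8" using p by (intro power_mono) auto
        then have "1000 \<le> p ^ 8" by (rule order_trans[rotated]) simp
        then have "1000 * p ^ 6 \<le> p ^ 8 * p ^ 6" using p by (intro mult_right_mono) auto
        then show ?thesis by (simp flip: power_add)
      qed
      have 1: "7 * r \<le> u / 1000"
        using order_trans[OF mult_left_mono[of 7000 10000 "r * p ^ 3"] \<open>r * p ^ 3 * 10000 \<le> r * r\<close>] p r1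
        by (simp add: u_def field_simps power2_eq_square)
      have p20: "32000 * p ^ 6 \<le> p ^ 20"
      proof -
        have "p ^ 14 \<ge> 1000 ^ 14" using p by (intro power_mono) auto
        then have "32000 \<le> p ^ 14" by (rule order_trans[rotated]) simp
        then have "32000 * p ^ 6 \<le> p ^ 14 * p ^ 6" using p by (intro mult_right_mono) auto
        then show ?thesis by (simp flip: power_add)
      qed
      have "32000 * p ^ 6 * r \<le> r * r" using p20 r r1 by (intro mult_right_mono) auto
      then have 2: "32 * r * p ^ 3 \<le> u / 1000"
        using p by (simp add: u_def field_simps power2_eq_square flip: power_add)
      have "24 * r\<^sup>2 / real q \<le> 24 * r\<^sup>2 / p ^ 4" using qp p q0 by (intro divide_left_mono mult_pos_pos) auto
      also have "\<dots> = 24 * u / p" using p by (simp add: u_def field_simps eval_nat_numeral)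
      also have "\<dots> \<le> 24 * u / 1000" using p u0 by (intro divide_left_mono) auto
      finally have 3: "24 * r\<^sup>2 / real q \<le> 24 * u / 1000" .
      have "real q * (1000 * p ^ 6) \<le> r\<^sup>2" using qr p14 by (meson mult_left_mono of_nat_0_le_iff order_trans)
      then have 4: "8 * real q * p ^ 3 \<le> 8 * u / 1000"
        using p by (simp add: u_def field_simps flip: power_add)
      have 5: "3 * u \<le> (r / (16 * p))\<^sup>2"
      proof -
        have "(r / (16 * p))\<^sup>2 = u * p / 256" using p by (simp add: u_def power_divide field_simps eval_nat_numeral)
        moreover have "u * 1000 \<le> u * p" using p u0 by (intro mult_left_mono) auto
        ultimately show ?thesis using u0 by simp
      qed
      have "2 * r\<^sup>2 / p ^ 3 = 2 * u" by (simp add: u_def)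
      then show ?thesis using 1 2 3 4 5 u0 by linarith
    qed
    finally show ?thesis by (rule power2_le_imp_le) (use p r1 in simp)
  qed
  have "square_sum R \<theta> = (\<Sum>n<R. ee (\<theta> * (real (Suc n))\<^sup>2) * of_nat (2 * n + 1))"
    unfolding square_sum_def by (simp only: mult.commute)
  also have "norm \<dots> \<le> r / (16 * p) * (norm (of_nat (2 * R + 1) :: complex) 
      + (\<Sum>n<R. norm (of_nat (2 * Suc n + 1) - of_nat (2 * n + 1) :: complex)))"
    by (rule norm_sum_abel) (rule partial)
  also have "norm (of_nat (2 * R + 1) :: complex) = 2 * r + 1" unfolding norm_of_nat r_def by simp
  also have "(\<Sum>n<R. norm (of_nat (2 * Suc n + 1) - of_nat (2 * n + 1) :: complex)) = 2 * r" by (simp add: r_def)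
  also have "r / (16 * p) * (2 * r + 1 + 2 * r) \<le> r / (16 * p) * (5 * r)"
    using r1 p by (intro mult_left_mono) auto
  also have "\<dots> = 5 / 16 * (r\<^sup>2 / p)" by (simp add: power2_eq_square)
  finally show ?thesis by (simp add: r_def p_def)
qed

text \<open>Over the common denominator \<open>q * q'\<close> the numerator is an integer; the
  hypothesis says in integer form that it is nonzero.\<close>

lemma rational_separation:
  fixes h i :: int
  assumes "0 < q" "0 < q'" "h * int q' \<noteq> int a' * int q + i * int q * int q'"
  shows "1 / (real q * real q') \<le> \<bar>of_int h / real q - real a' / real q' - of_int i\<bar>"
proof -
  define m where "m = h * int q' - int a' * int q - i * int q * int q'"
  have "m \<noteq> 0" using assms by (simp add: m_def)
  then have "1 \<le> \<bar>m\<bar>" by linarith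
  then have "1 \<le> real_of_int \<bar>m\<bar>" by linarith
  then have "1 / (real q * real q') \<le> real_of_int \<bar>m\<bar> / (real q * real q')"
    by (intro divide_right_mono) auto
  also have "\<dots> = \<bar>of_int m / (real q * real q')\<bar>" by (simp add: abs_divide)
  also have "of_int m / (real q * real q') = of_int h / real q - real a' / real q' - of_int i"
    using assms by (simp add: m_def field_simps)
  finally show ?thesis .
qed

text \<open>If the Dirichlet denominator of \<theta> is at most \<open>P ^ 4\<close>, one model term
  matches the sum over squares and the other terms are small; otherwise both sums are small
  separately. In the first case the error is at most \<open>P ^ 19 * R\<close>, and
  \<open>P ^ 20 \<le> R\<close> turns this into a saving of \<open>P\<close>.\<close>

theorem square_sum_model_error:
  assumes P: "1000 \<le> P" and R: "P ^ 20 \<le> R"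
  shows "norm (square_sum R \<theta> - model_sum (P ^ 4) (R\<^sup>2) \<theta>) \<le> (real R)\<^sup>2 / real P"
proof -
  define p where "p = real P"
  define r where "r = real R"
  have p: "1000 \<le> p" using P by (simp add: p_def)
  have r: "p ^ 20 \<le> r" using R unfolding p_def r_def by (metis of_nat_le_iff of_nat_power)
  have pk: "1 \<le> p ^ k" for k using p by (intro one_le_power) auto
  have r1: "1 \<le> r" using pk[of 20] r by linarith
  have ppos: "0 < p ^ k" for k using p by simp
  have pmono: "p ^ i \<le> p ^ j" if "i \<le> j" for i j using that p by (intro power_increasing) auto
  \<comment> \<open>This Dirichlet cutoff serves both cases: \<open>q \<le> N\<close> is the upper
    limit in the minor case, and \<open>\<bar>\<beta>\<bar> \<le> 1 / (q * N)\<close> makes the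
    error near \<open>a / q\<close> of order \<open>P ^ 14 * R\<close>.\<close>
  define N where "N = R\<^sup>2 div P ^ 14"
  have rr: "p ^ 20 * r \<le> r\<^sup>2" using r r1 by (simp add: power2_eq_square mult_right_mono)
  have "p ^ 40 \<le> r\<^sup>2"
    using mult_mono[OF r r] r1 ppos[of 20] by (simp add: power2_eq_square flip: power_add)
  then have "p ^ 14 * p ^ 26 \<le> r\<^sup>2" by (simp flip: power_add)
  then have r26: "p ^ 26 \<le> r\<^sup>2 / p ^ 14" using p by (simp add: field_simps)
  have "real (P ^ 14 * N + R\<^sup>2 mod P ^ 14) = real (R\<^sup>2)" unfolding N_def by (simp only: mult_div_mod_eq)
  then have "p ^ 14 * real N + real (R\<^sup>2 mod P ^ 14) = r\<^sup>2" by (simp add: p_def r_def)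
  moreover have "R\<^sup>2 mod P ^ 14 < P ^ 14" using P by (intro mod_less_divisor) auto
  then have "real (R\<^sup>2 mod P ^ 14) < p ^ 14" unfolding p_def by (metis of_nat_less_iff of_nat_power)
  ultimately have "r\<^sup>2 \<le> p ^ 14 * (real N + 1)" unfolding ring_distribs by linarith
  then have "r\<^sup>2 / p ^ 14 \<le> real N + 1" using p by (simp add: field_simps)
  moreover have "2 \<le> r\<^sup>2 / p ^ 14" using r26 pmono[of 1 26] p by simp
  ultimately have N_ge: "r\<^sup>2 / (2 * p ^ 14) \<le> real N" by simp
  have "2 * (2 * p ^ 8) \<le> p ^ 1 * p ^ 8" using p by simp
  also have "\<dots> \<le> p ^ 26" using pmono[of 9 26] by (simp flip: power_Suc)
  also note r26
  finally have "2 * (2 * p ^ 8) \<le> 2 * (r\<^sup>2 / (2 * p ^ 14))" by simp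
  then have N8: "2 * p ^ 8 \<le> real N" using N_ge by linarith
  have "0 < real N" using N8 ppos[of 8] by linarith
  then have N0: "0 < N" by simp
  obtain h k :: int where hk: "coprime h k" "0 < k" "k \<le> int N" "\<bar>of_int k * \<theta> - of_int h\<bar> < 1 / real N"
    using Dirichlet_approx_coprime[OF N0] by metis
  define q where "q = nat k"
  have kq: "k = int q" using hk by (simp add: q_def)
  have q0: "0 < q" using hk by (simp add: q_def)
  have qN: "q \<le> N" using hk kq by simp
  have cop: "coprime h (int q)" using hk kq by simp
  define \<beta> where "\<beta> = \<theta> - of_int h / real q"
  have \<beta>: "\<bar>\<beta>\<bar> \<le> 1 / (real q * real N)"
  proof -
    have "real q * \<beta> = of_int k * \<theta> - of_int h" using q0 by (simp add: \<beta>_def kq field_simps)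
    then have "\<bar>real q * \<beta>\<bar> \<le> 1 / real N" using hk by simp
    then show ?thesis using q0 N0 by (simp add: abs_mult field_simps)
  qed
  define a where "a = nat (h mod int q)"
  have ah: "int a = h mod int q" using q0 by (simp add: a_def)
  have a_red: "a \<in> reduced_residues q"
  proof -
    have "int a < int q" using q0 by (simp add: ah)
    moreover have "coprime (int a) (int q)" using cop q0 by (simp add: ah coprime_commute gcd_red_int[symmetric] coprime_iff_gcd_eq_1)
    ultimately show ?thesis by (simp add: reduced_residues_def)
  qed
  have sep: "1 / (real q * real q') \<le> \<bar>of_int h / real q - real a' / real q' - of_int i\<bar>"
    if "a' \<in> reduced_residues q'" "0 < q'" "(q', a') \<noteq> (q, a)" for q' a' i
  \<comment> \<open>Reduced fractions that agree modulo 1 have denominators dividing each other,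
    hence equal, and then equal numerators as these lie below \<open>q\<close>.\<close>
  proof (rule rational_separation[OF q0 that(2)], rule notI)
    assume eq: "h * int q' = int a' * int q + i * int q * int q'"
    have cop': "coprime (int a') (int q')" using that by (simp add: reduced_residues_def)
    have "int q dvd h * int q'" unfolding eq by simp
    then have "int q dvd int q'" using cop by (simp add: coprime_commute coprime_dvd_mult_right_iff)
    have "int a' * int q = int q' * (h - i * int q)" using eq by (simp add: algebra_simps)
    then have "int q' dvd int a' * int q" by simp
    then have "int q' dvd int q" using cop' by (simp add: coprime_commute coprime_dvd_mult_right_iff)
    with \<open>int q dvd int q'\<close> have qq: "q' = q" by (simp add: dvd_antisym)
    have "(h - int a' - i * int q) * int q = 0" using eq unfolding qq by (simp add: algebra_simps)
    then have "h = int a' + i * int q" using q0 by simp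
    then have "h mod int q = int a'" using that qq by (simp add: reduced_residues_def)
    then show False using that qq ah by simp
  qed
  define T where "T q' a' = gauss a' q' * (\<Sum>t\<in>{1..R\<^sup>2}. ee ((\<theta> - real a' / real q') * real t))" for q' a'
  have T_le: "norm (T q' a') \<le> 1 / \<delta>"
    if "a' \<in> reduced_residues q'" "0 < q'" "(q', a') \<noteq> (q, a)" "0 < \<delta>" "\<delta> \<le> 1 / (real q * real q') - \<bar>\<beta>\<bar>" for q' a' \<delta>
  proof -
    have "norm (\<Sum>t\<in>{1..R\<^sup>2}. ee ((\<theta> - real a' / real q') * real t)) \<le> 1 / \<delta>"
    proof (rule norm_sum_ee_le'[OF _ that(4)])
      fix i :: int
      show "\<delta> \<le> \<bar>\<theta> - real a' / real q' - of_int i\<bar>"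
        using sep[OF that(1-3), of i] that(5) unfolding \<beta>_def by linarith
    qed
    then have "norm (T q' a') \<le> 1 * (1 / \<delta>)"
      unfolding T_def norm_mult by (intro mult_mono norm_gauss_le_1) auto
    then show ?thesis by simp
  qed
  define S where "S = (SIGMA q':{1..P ^ 4}. reduced_residues q')"
  have finS: "finite S" unfolding S_def by (auto simp: reduced_residues_def)
  have model: "model_sum (P ^ 4) (R\<^sup>2) \<theta> = (\<Sum>(q', a')\<in>S. T q' a')"
    unfolding model_sum_def S_def T_def by (rule sum.Sigma) (auto simp: reduced_residues_def)
  have "card S \<le> card ({1..P ^ 4} \<times> {..<P ^ 4})"
    by (intro card_mono) (auto simp: S_def reduced_residues_def)
  then have "card S \<le> P ^ 8" by (simp add: card_cartesian_product flip: power_add)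
  then have cardS: "real (card S) \<le> p ^ 8" unfolding p_def by (metis of_nat_le_iff of_nat_power)
  \<comment> \<open>The model has at most \<open>P ^ 8\<close> fractions, and each geometric sum is
    at most the reciprocal of a lower bound for the distance of \<theta> from that fraction modulo
    1.\<close>
  have S_bound: "norm (\<Sum>(q', a')\<in>S'. T q' a') \<le> p ^ 8 * (1 / \<delta>)"
    if S': "S' \<subseteq> S" "(q, a) \<notin> S'" and \<delta>: "0 < \<delta>" "\<And>q'. 0 < q' \<Longrightarrow> q' \<le> P ^ 4 \<Longrightarrow> \<delta> \<le> 1 / (real q * real q') - \<bar>\<beta>\<bar>" for S' \<delta>
  proof -
    have "norm (\<Sum>(q', a')\<in>S'. T q' a') \<le> real (card S') * (1 / \<delta>)"
    proof (rule sum_norm_bound, clarify)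
      fix q' a' assume "(q', a') \<in> S'"
      then have "a' \<in> reduced_residues q'" "0 < q'" "q' \<le> P ^ 4" "(q', a') \<noteq> (q, a)" using S' by (auto simp: S_def)
      then show "norm (T q' a') \<le> 1 / \<delta>" using \<delta> by (intro T_le) auto
    qed
    also have "\<dots> \<le> p ^ 8 * (1 / \<delta>)"
    proof (intro mult_right_mono)
      have "card S' \<le> card S" using S' finS by (intro card_mono)
      then show "real (card S') \<le> p ^ 8" using cardS by linarith
    qed (use \<delta> in auto)
    finally show ?thesis .
  qed
  have qP: "real q' \<le> p ^ 4" if "q' \<le> P ^ 4" for q' using that unfolding p_def by (metis of_nat_le_iff of_nat_power)
  \<comment> \<open>Half of the separation of two fractions is given up to \<beta>; the other half
    keeps the remaining fractions away from \<theta>.\<close>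
  have gap: "e \<le> u - b" if "w \<le> u" "b \<le> e" "e + e = w" for e b u w :: real using that by linarith
  show ?thesis
  proof (cases "q \<le> P ^ 4")
    case True
    have qa: "(q, a) \<in> S" using True q0 a_red by (simp add: S_def)
    have dec: "model_sum (P ^ 4) (R\<^sup>2) \<theta> = T q a + (\<Sum>(q', a')\<in>S - {(q, a)}. T q' a')"
      unfolding model by (subst sum.remove[OF finS qa]) simp
    have "norm (\<Sum>(q', a')\<in>S - {(q, a)}. T q' a') \<le> p ^ 8 * (1 / (1 / (2 * p ^ 8)))"
    proof (rule S_bound)
      fix q' assume q': "0 < q'" "q' \<le> P ^ 4"
      have "real q * real q' \<le> p ^ 4 * p ^ 4" using qP[OF True] qP[OF q'(2)] p by (intro mult_mono) auto
      also have "\<dots> = p ^ 8" by (simp flip: power_add)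
      finally have "1 / p ^ 8 \<le> 1 / (real q * real q')" using q0 q' p by (intro divide_left_mono) auto
      moreover have "\<bar>\<beta>\<bar> \<le> 1 / (2 * p ^ 8)"
      proof -
        have "1 * (2 * p ^ 8) \<le> real q * real N" using q0 N8 p by (intro mult_mono) auto
        then have "1 / (real q * real N) \<le> 1 / (2 * p ^ 8)" using q0 N0 p by (intro divide_left_mono) auto
        then show ?thesis using \<beta> by simp
      qed
      moreover have "1 / (2 * p ^ 8) + 1 / (2 * p ^ 8) = 1 / p ^ 8" by simp
      ultimately show "1 / (2 * p ^ 8) \<le> 1 / (real q * real q') - \<bar>\<beta>\<bar>" by (rule gap)
    qed (use p in auto)
    moreover have "p ^ 8 * (1 / (1 / (2 * p ^ 8))) = 2 * p ^ 16" by (simp flip: power_add)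
    ultimately have "norm (\<Sum>(q', a')\<in>S - {(q, a)}. T q' a') \<le> 2 * p ^ 16" by (simp only:)
    moreover have "norm (square_sum R \<theta> - T q a) \<le> 442 * p ^ 14 * r"
    proof -
      \<comment> \<open>Passing from \<open>h\<close> to its residue \<open>a\<close> shifts
        \<theta> by an integer, which is invisible as \<theta> is only multiplied by
        integers.\<close>
      have h: "h = int a + h div int q * int q" unfolding ah by simp
      have "of_int h / real q = real a / real q + of_int (h div int q)"
      proof -
        have "of_int h = real a + of_int (h div int q) * real q" using arg_cong[OF h, of real_of_int] by simp
        then show ?thesis using q0 by (simp add: field_simps)
      qed
      then have th: "\<theta> = (real a / real q + \<beta>) + of_int (h div int q)" by (simp add: \<beta>_def)
      have "ee (\<theta> * (real (Suc n))\<^sup>2) = ee ((real a / real q + \<beta>) * (real (Suc n))\<^sup>2)" for n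
        by (rule ee_eq_intdiff[of _ _ "h div int q * int ((Suc n)\<^sup>2)"], subst th) (simp add: algebra_simps)
      then have 1: "square_sum R \<theta> = square_sum R (real a / real q + \<beta>)" by (simp add: square_sum_def)
      have "ee ((\<theta> - real a / real q) * real t) = ee (\<beta> * real t)" for t
        by (rule ee_eq_intdiff[of _ _ "h div int q * int t"], subst th) (simp add: algebra_simps)
      then have 2: "T q a = gauss a q * (\<Sum>t\<in>{1..R\<^sup>2}. ee (\<beta> * real t))" by (simp add: T_def)
      have "norm (square_sum R \<theta> - T q a) \<le> 10 * real q * r + 216 * real q * r ^ 3 * \<bar>\<beta>\<bar>"
        unfolding 1 2 r_def by (rule square_sum_near_rational[OF q0])
      also have "\<dots> \<le> 10 * p ^ 14 * r + 432 * p ^ 14 * r"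
      proof (intro add_mono)
        show "10 * real q * r \<le> 10 * p ^ 14 * r"
          using qP[OF True] pmono[of 4 14] r1 by (intro mult_right_mono mult_left_mono) auto
        have "216 * real q * r ^ 3 * \<bar>\<beta>\<bar> \<le> 216 * real q * r ^ 3 * (1 / (real q * real N))"
          using \<beta> r1 by (intro mult_left_mono) auto
        also have "\<dots> = 216 * r ^ 3 / real N" using q0 by simp
        also have "\<dots> \<le> 216 * r ^ 3 / (r\<^sup>2 / (2 * p ^ 14))"
          using N_ge r1 p N0 by (intro divide_left_mono mult_pos_pos divide_pos_pos) auto
        also have "\<dots> = 432 * p ^ 14 * r" using r1 p by (simp add: field_simps eval_nat_numeral)
        finally show "216 * real q * r ^ 3 * \<bar>\<beta>\<bar> \<le> 432 * p ^ 14 * r" .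
      qed
      finally show ?thesis by (simp add: mult_ac)
    qed
    ultimately have "norm (square_sum R \<theta> - model_sum (P ^ 4) (R\<^sup>2) \<theta>) \<le> 442 * p ^ 14 * r + 2 * p ^ 16"
      using norm_triangle_ineq4[of "square_sum R \<theta> - T q a" "\<Sum>(q', a')\<in>S - {(q, a)}. T q' a'"]
      unfolding dec by (simp add: diff_diff_eq)
    also have "\<dots> \<le> 444 * (p ^ 16 * r)"
    proof -
      have "p ^ 14 * r \<le> p ^ 16 * r" using pmono[of 14 16] r1 by (intro mult_right_mono) auto
      moreover have "p ^ 16 * 1 \<le> p ^ 16 * r" using r1 ppos[of 16] by (intro mult_left_mono) auto
      ultimately show ?thesis by simp
    qed
    also have "\<dots> \<le> p ^ 3 * (p ^ 16 * r)" using order_trans[OF _ pmono[of 1 3]] p r1 by (intro mult_right_mono) auto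
    also have "\<dots> = p ^ 20 * r / p" using p by (simp add: eval_nat_numeral)
    also have "\<dots> \<le> r\<^sup>2 / p" using rr p by (intro divide_right_mono) auto
    finally show ?thesis by (simp add: r_def p_def)
  next
    case False
    have "q * P ^ 14 \<le> N * P ^ 14" using qN by simp
    also have "\<dots> \<le> R\<^sup>2" unfolding N_def by (rule div_times_less_eq_dividend)
    finally have qPR: "q * P ^ 14 \<le> R\<^sup>2" .
    have \<theta>: "\<bar>\<theta> - of_int h / real q\<bar> \<le> 1 / (real q)\<^sup>2"
    proof -
      have "1 / (real q * real N) \<le> 1 / (real q * real q)"
        using qN q0 N0 by (intro divide_left_mono mult_left_mono) auto
      then show ?thesis using \<beta> by (simp add: \<beta>_def power2_eq_square)
    qed
    have "norm (square_sum R \<theta>) \<le> 5 / 16 * (r\<^sup>2 / p)"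
      unfolding r_def p_def by (rule square_sum_minor[OF P R _ qPR cop \<theta>]) (use False in simp)
    moreover have "norm (model_sum (P ^ 4) (R\<^sup>2) \<theta>) \<le> p ^ 8 * (1 / (1 / (2 * real q * p ^ 4)))"
      unfolding model
    proof (rule S_bound)
      show "(q, a) \<notin> S" using False by (simp add: S_def)
      fix q' assume q': "0 < q'" "q' \<le> P ^ 4"
      have "1 / (real q * p ^ 4) \<le> 1 / (real q * real q')"
        using qP[OF q'(2)] q0 q' p by (intro divide_left_mono mult_left_mono) auto
      moreover have "\<bar>\<beta>\<bar> \<le> 1 / (2 * real q * p ^ 4)"
      proof -
        have "2 * p ^ 4 \<le> real N" using N8 pmono[of 4 8] by linarith
        then have "real q * (2 * p ^ 4) \<le> real q * real N" by (intro mult_left_mono) auto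
        then have "1 / (real q * real N) \<le> 1 / (real q * (2 * p ^ 4))" using q0 N0 p by (intro divide_left_mono) auto
        then show ?thesis using \<beta> by (simp add: mult_ac)
      qed
      moreover have "1 / (2 * real q * p ^ 4) + 1 / (2 * real q * p ^ 4) = 1 / (real q * p ^ 4)" by simp
      ultimately show "1 / (2 * real q * p ^ 4) \<le> 1 / (real q * real q') - \<bar>\<beta>\<bar>" by (rule gap)
    qed (use p q0 in auto)
    moreover have "p ^ 8 * (1 / (1 / (2 * real q * p ^ 4))) \<le> 2 / 1000 * (r\<^sup>2 / p)"
    proof -
      have "real (q * P ^ 14) \<le> real (R\<^sup>2)" using qPR by (simp only: of_nat_le_iff)
      then have "real q * p ^ 14 \<le> r\<^sup>2" by (simp add: p_def r_def)
      then have "real q * p ^ 12 \<le> r\<^sup>2 / p\<^sup>2" using p by (simp add: field_simps flip: power_add)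
      also have "\<dots> = (r\<^sup>2 / p) * (1 / p)" by (simp add: power2_eq_square)
      also have "\<dots> \<le> (r\<^sup>2 / p) * (1 / 1000)" using p by (intro mult_left_mono) auto
      finally have "2 * (real q * p ^ 12) \<le> 2 / 1000 * (r\<^sup>2 / p)" by simp
      moreover have "p ^ 8 * (1 / (1 / (2 * real q * p ^ 4))) = 2 * (real q * p ^ 12)"
        by (simp add: mult_ac flip: power_add)
      ultimately show ?thesis by (simp only:)
    qed
    ultimately have "norm (square_sum R \<theta> - model_sum (P ^ 4) (R\<^sup>2) \<theta>) \<le> 5 / 16 * (r\<^sup>2 / p) + 2 / 1000 * (r\<^sup>2 / p)"
      using norm_triangle_ineq4[of "square_sum R \<theta>" "model_sum (P ^ 4) (R\<^sup>2) \<theta>"] by linarith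
    also have "\<dots> \<le> r\<^sup>2 / p" using p by (simp add: field_simps)
    finally show ?thesis by (simp add: r_def p_def)
  qed
qed

section \<open>Products of periodic functions\<close>

lemma sum_residues_mod:
  fixes f :: "int \<Rightarrow> real"
  assumes "0 < q'" "q' dvd q" "0 < q"
  shows "(\<Sum>y\<in>{0..<int q'}. \<Sum>z\<in>{z\<in>{0..<int q}. z mod int q' = y}. f z) = (\<Sum>z\<in>{0..<int q}. f z)"
  by (rule sum.group) (use assms in auto)

text \<open>A Loomis--Whitney type inequality for periodic functions; each prime is removed from the modulus
  by Cauchy--Schwarz applied to the two functions whose period carries its full power.\<close>

lemma sum_prod_periodic_le:
  fixes q :: "'i \<Rightarrow> nat" and F :: "'i \<Rightarrow> int \<Rightarrow> real"
  assumes "finite I" "0 < D"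
    and "\<And>i. i \<in> I \<Longrightarrow> q i dvd D"
    and "\<And>i x. i \<in> I \<Longrightarrow> 0 \<le> F i x"
    and "\<And>i x. i \<in> I \<Longrightarrow> F i (x mod int (q i)) = F i x"
    and "\<And>p. prime p \<Longrightarrow> p dvd D \<Longrightarrow> \<exists>i\<in>I. \<exists>j\<in>I. i \<noteq> j \<and> 
            multiplicity p (q i) = multiplicity p D \<and> multiplicity p (q j) = multiplicity p D"
  shows "(\<Sum>x\<in>{0..<int D}. \<Prod>i\<in>I. F i x) \<le> (\<Prod>i\<in>I. sqrt (\<Sum>x\<in>{0..<int (q i)}. (F i x)\<^sup>2))"
  using assms
proof (induction D arbitrary: q F rule: less_induct)
  case (less D)
  note fin = less.prems(1) and D0 = less.prems(2) and qD = less.prems(3) and Fnn = less.prems(4)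
    and per = less.prems(5) and two = less.prems(6)
  have q0: "0 < q i" if "i \<in> I" for i using qD[OF that] D0 by (auto intro: Nat.gr0I)
  show ?case
  proof (cases "D = 1")
    case True
    then have q1: "q i = 1" if "i \<in> I" for i using qD[OF that] by simp
    have s: "{0..<int (Suc 0)} = {0}" by auto
    have "sqrt (\<Sum>x\<in>{0..<int (q i)}. (F i x)\<^sup>2) = F i 0" if "i \<in> I" for i
      using q1[OF that] Fnn[OF that] s by simp
    then show ?thesis using True s by simp
  next
    case False
    then obtain p where p: "prime p" "p dvd D" using prime_factor_nat by blast
    define v where "v = multiplicity p D"
    define D' where "D' = D div p ^ v"
    have DD: "D = p ^ v * D'" unfolding D'_def v_def by (simp add: multiplicity_dvd)
    have v0: "0 < v" unfolding v_def using p D0 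
      by (metis multiplicity_eq_zero_iff not_prime_unit gr0I neq0_conv)
    have D'0: "0 < D'" using DD D0 by (auto intro: Nat.gr0I)
    have pD': "\<not> p dvd D'"
      unfolding D'_def v_def using p D0 by (intro multiplicity_decompose) auto
    have p1: "1 < p" using p prime_gt_1_nat by blast
    have "1 * D' < p ^ v * D'" using D'0 one_less_power[OF p1 v0] by (intro mult_strict_right_mono) auto
    then have "D' < D" unfolding DD by simp
    have cop: "coprime (p ^ v) D'" using p pD' by (simp add: prime_imp_coprime)
    define q' where "q' i = q i div p ^ multiplicity p (q i)" for i
    have qq: "q i = p ^ multiplicity p (q i) * q' i" for i
      unfolding q'_def by (simp add: multiplicity_dvd)
    have q'0: "0 < q' i" if "i \<in> I" for i using qq[of i] q0[OF that] by (auto intro: Nat.gr0I)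
    have pq': "\<not> p dvd q' i" if "i \<in> I" for i
      unfolding q'_def using p q0[OF that] by (intro multiplicity_decompose) auto
    have q'D: "q' i dvd D'" if "i \<in> I" for i
    proof -
      have "q' i dvd D" using qq[of i] qD[OF that] dvd_mult_right by metis
      moreover have "coprime (q' i) (p ^ v)" 
        using pq'[OF that] p by (simp add: prime_imp_coprime coprime_commute)
      ultimately show ?thesis unfolding DD by (simp add: coprime_dvd_mult_right_iff)
    qed
    have q'q: "q' i dvd q i" for i using qq[of i] dvd_triv_right by metis
    obtain i1 i2 where i12: "i1 \<in> I" "i2 \<in> I" "i1 \<noteq> i2"
      "multiplicity p (q i1) = v" "multiplicity p (q i2) = v"
      using two[OF p] v_def by blast
    \<comment> \<open>\<open>G i\<close> is the \<open>L\<^sup>2\<close> norm of \<open>F i\<close>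
      over the residues modulo \<open>q i\<close> that lie above \<open>y\<close> modulo the
      \<open>p\<close>-free part \<open>q' i\<close>. It has the smaller period and the same total
      \<open>L\<^sup>2\<close> norm, so the bound for \<open>D'\<close> applied to \<open>G\<close>
      has the right-hand side wanted for \<open>D\<close>.\<close>
    define G where "G i y = sqrt (\<Sum>z\<in>{z\<in>{0..<int (q i)}. z mod int (q' i) = y mod int (q' i)}. (F i z)\<^sup>2)" for i y
    have Gnn: "0 \<le> G i y" for i y by (simp add: G_def sum_nonneg)
    have Gper: "G i (y mod int (q' i)) = G i y" for i y by (simp add: G_def)
    have Gnorm: "(\<Sum>y\<in>{0..<int (q' i)}. (G i y)\<^sup>2) = (\<Sum>x\<in>{0..<int (q i)}. (F i x)\<^sup>2)" if "i \<in> I" for i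
    proof -
      have "(\<Sum>y\<in>{0..<int (q' i)}. (G i y)\<^sup>2) 
         = (\<Sum>y\<in>{0..<int (q' i)}. \<Sum>z\<in>{z\<in>{0..<int (q i)}. z mod int (q' i) = y}. (F i z)\<^sup>2)"
        by (intro sum.cong refl) (simp add: G_def sum_nonneg)
      also have "\<dots> = (\<Sum>x\<in>{0..<int (q i)}. (F i x)\<^sup>2)"
        using that by (intro sum_residues_mod q'0 q'q q0)
      finally show ?thesis .
    qed
    have IH: "(\<Sum>x\<in>{0..<int D'}. \<Prod>i\<in>I. G i x) \<le> (\<Prod>i\<in>I. sqrt (\<Sum>x\<in>{0..<int (q' i)}. (G i x)\<^sup>2))"
    proof (rule less.IH[where q = q' and F = G, OF \<open>D' < D\<close> fin D'0 q'D])
      fix r assume r: "prime r" "r dvd D'"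
      then have "r \<noteq> p" using pD' by auto
      have "r dvd D" using r DD by simp
      from two[OF r(1) this] obtain i j where ij: "i \<in> I" "j \<in> I" "i \<noteq> j"
         "multiplicity r (q i) = multiplicity r D" "multiplicity r (q j) = multiplicity r D" by blast
      have np: "multiplicity r (p ^ n) = 0" for n
        using \<open>r \<noteq> p\<close> r(1) p(1) by (simp add: multiplicity_distinct_prime_power)
      have *: "multiplicity r (p ^ n * x) = multiplicity r x" if "0 < x" for n x
        using that r(1) p1 np[of n] by (subst prime_elem_multiplicity_mult_distrib) auto
      have "multiplicity r (q k) = multiplicity r (q' k)" if "k \<in> I" for k
        using *[OF q'0[OF that]] qq[of k] by metis
      moreover have "multiplicity r D = multiplicity r D'" using *[OF D'0] DD by metis
      ultimately show "\<exists>i\<in>I. \<exists>j\<in>I. i \<noteq> j \<and> multiplicity r (q' i) = multiplicity r D' \<and> 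
          multiplicity r (q' j) = multiplicity r D'" using ij by metis
    qed (simp_all add: Gnn Gper)
    define X where "X y = {x\<in>{0..<int D}. x mod int D' = y}" for y
    have Xmod: "x mod int (q' i) = y mod int (q' i)" if "x \<in> X y" "i \<in> I" for x y i
      using that q'D[OF that(2)] by (auto simp: X_def mod_mod_cancel)
    \<comment> \<open>For the factors outside Cauchy-Schwarz a pointwise bound suffices: one value
      is at most the norm over its fibre.\<close>
    have FleG: "F i x \<le> G i y" if "x \<in> X y" "i \<in> I" for x y i
    proof -
      have "(F i (x mod int (q i)))\<^sup>2 \<le> (\<Sum>z\<in>{z\<in>{0..<int (q i)}. z mod int (q' i) = y mod int (q' i)}. (F i z)\<^sup>2)"
      proof (rule member_le_sum)
        show "x mod int (q i) \<in> {z\<in>{0..<int (q i)}. z mod int (q' i) = y mod int (q' i)}"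
          using q0[OF that(2)] Xmod[OF that] q'q[of i] by (simp add: mod_mod_cancel)
        show "finite {z\<in>{0..<int (q i)}. z mod int (q' i) = y mod int (q' i)}"
          by (rule finite_subset[of _ "{0..<int (q i)}"]) auto
      qed auto
      then have "sqrt ((F i x)\<^sup>2) \<le> G i y" unfolding G_def per[OF that(2)] by (rule real_sqrt_le_mono)
      then show ?thesis using Fnn[OF that(2)] by simp
    qed
    have L2: "(\<Sum>x\<in>X y. (F i x)\<^sup>2) \<le> (G i y)\<^sup>2" if i: "i \<in> I" "multiplicity p (q i) = v" for i y
    proof -
      \<comment> \<open>As \<open>p ^ v\<close> divides \<open>q i\<close>, the residue modulo
        \<open>q i\<close> together with \<open>y\<close> modulo \<open>D'\<close> determines
        \<open>x\<close> modulo \<open>D\<close>. So the sum over \<open>X y\<close> meets each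
        residue of the fibre at most once.\<close>
      have inj: "inj_on (\<lambda>x. x mod int (q i)) (X y)"
      proof (rule inj_onI)
        fix x x' assume xx: "x \<in> X y" "x' \<in> X y" "x mod int (q i) = x' mod int (q i)"
        have "p ^ v dvd q i" using qq[of i] i(2) dvd_triv_left by metis
        then have "int (p ^ v) dvd x - x'" using xx(3) by (meson mod_eq_dvd_iff dvd_trans of_nat_dvd_iff)
        moreover have "int D' dvd x - x'" using xx by (auto simp: X_def mod_eq_dvd_iff[symmetric])
        ultimately have "int (p ^ v) * int D' dvd x - x'" 
          using cop by (intro divides_mult) (simp_all only: coprime_int_iff)
        then have "x mod int D = x' mod int D" unfolding DD by (simp add: mod_eq_dvd_iff)
        then show "x = x'" using xx by (auto simp: X_def)
      qed
      have "(\<Sum>x\<in>X y. (F i x)\<^sup>2) = (\<Sum>x\<in>X y. (F i (x mod int (q i)))\<^sup>2)" using per[OF i(1)] by simp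
      also have "\<dots> = (\<Sum>z\<in>(\<lambda>x. x mod int (q i)) ` X y. (F i z)\<^sup>2)" using inj by (simp add: sum.reindex)
      also have "\<dots> \<le> (\<Sum>z\<in>{z\<in>{0..<int (q i)}. z mod int (q' i) = y mod int (q' i)}. (F i z)\<^sup>2)"
      proof (intro sum_mono2)
        show "(\<lambda>x. x mod int (q i)) ` X y \<subseteq> {z\<in>{0..<int (q i)}. z mod int (q' i) = y mod int (q' i)}"
          using Xmod[OF _ i(1)] q'q[of i] q0[OF i(1)] by (auto simp: mod_mod_cancel)
        show "finite {z\<in>{0..<int (q i)}. z mod int (q' i) = y mod int (q' i)}"
          by (rule finite_subset[of _ "{0..<int (q i)}"]) auto
      qed auto
      also have "\<dots> = (G i y)\<^sup>2" by (simp add: G_def sum_nonneg)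
      finally show ?thesis .
    qed
    have key: "(\<Sum>x\<in>X y. \<Prod>i\<in>I. F i x) \<le> (\<Prod>i\<in>I. G i y)" for y
    proof -
      define J where "J = I - {i1} - {i2}"
      have split: "(\<Prod>i\<in>I. f i) = f i1 * f i2 * (\<Prod>i\<in>J. f i)" for f :: "'i \<Rightarrow> real"
        unfolding J_def using fin i12 by (subst prod.remove[of I i1], simp, simp, subst prod.remove[of _ i2]) auto
      have "(\<Sum>x\<in>X y. \<Prod>i\<in>I. F i x) \<le> (\<Sum>x\<in>X y. F i1 x * F i2 x * (\<Prod>i\<in>J. G i y))"
        unfolding split
        by (intro sum_mono mult_left_mono prod_mono conjI FleG mult_nonneg_nonneg Fnn) 
           (auto simp: J_def i12)
      also have "\<dots> = (\<Sum>x\<in>X y. F i1 x * F i2 x) * (\<Prod>i\<in>J. G i y)" by (simp add: sum_distrib_right)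
      also have "\<dots> \<le> (G i1 y * G i2 y) * (\<Prod>i\<in>J. G i y)"
      proof (intro mult_right_mono prod_nonneg Gnn)
        have "(\<Sum>x\<in>X y. F i1 x * F i2 x)\<^sup>2 \<le> (\<Sum>x\<in>X y. (F i1 x)\<^sup>2) * (\<Sum>x\<in>X y. (F i2 x)\<^sup>2)"
          by (rule Cauchy_Schwarz_ineq_sum)
        also have "\<dots> \<le> (G i1 y)\<^sup>2 * (G i2 y)\<^sup>2"
          by (intro mult_mono L2 i12) (auto simp: sum_nonneg)
        finally have "(\<Sum>x\<in>X y. F i1 x * F i2 x)\<^sup>2 \<le> (G i1 y * G i2 y)\<^sup>2" by (simp add: power_mult_distrib)
        then show "(\<Sum>x\<in>X y. F i1 x * F i2 x) \<le> G i1 y * G i2 y"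
          by (rule power2_le_imp_le) (simp add: Gnn)
      qed
      finally show ?thesis unfolding split .
    qed
    have "(\<Sum>x\<in>{0..<int D}. \<Prod>i\<in>I. F i x) = (\<Sum>y\<in>{0..<int D'}. \<Sum>x\<in>X y. \<Prod>i\<in>I. F i x)"
      unfolding X_def using D'0 D0 DD by (intro sum_residues_mod[symmetric]) auto
    also have "\<dots> \<le> (\<Sum>y\<in>{0..<int D'}. \<Prod>i\<in>I. G i y)" by (rule sum_mono) (rule key)
    also note IH
    also have "(\<Prod>i\<in>I. sqrt (\<Sum>x\<in>{0..<int (q' i)}. (G i x)\<^sup>2)) = (\<Prod>i\<in>I. sqrt (\<Sum>x\<in>{0..<int (q i)}. (F i x)\<^sup>2))"
      by (intro prod.cong refl) (simp add: Gnorm)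
    finally show ?thesis .
  qed
qed

section \<open>Moments of the divisor function and sums over least common multiples\<close>

definition ndiv :: "nat \<Rightarrow> nat" where "ndiv d = card {c. c dvd d}"

lemma ndiv_mult_le:
  assumes "0 < a" "0 < b" shows "ndiv (a * b) \<le> ndiv a * ndiv b"
proof -
  have fin: "finite {c. c dvd a}" "finite {c. c dvd b}" using assms by auto
  have "{c. c dvd a * b} \<subseteq> (\<lambda>(x, y). x * y) ` ({c. c dvd a} \<times> {c. c dvd b})"
    by (auto simp: image_iff elim!: dvd_productE)
  then have "card {c. c dvd a * b} \<le> card ({c. c dvd a} \<times> {c. c dvd b})"
    using fin by (meson card_image_le card_mono finite_SigmaI finite_imageI order_trans)
  then show ?thesis by (simp add: ndiv_def card_cartesian_product)
qed

lemma sum_inverse_le_ln: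
  assumes "1 \<le> X" shows "(\<Sum>d\<in>{1..X}. 1 / real d) \<le> 1 + ln (real X)"
  using assms
proof (induction X rule: nat_induct_at_least)
  case (Suc n)
  have "ln (real n / real (Suc n)) \<le> real n / real (Suc n) - 1"
    using Suc.hyps by (intro ln_le_minus_one) auto
  then have "1 / real (Suc n) \<le> ln (real (Suc n)) - ln (real n)"
    using Suc.hyps by (simp add: ln_div field_simps)
  then show ?case using Suc.IH Suc.hyps by simp
qed simp

text \<open>One factor \<open>ndiv d\<close> is opened as a sum over divisors \<open>c\<close>, and
  submultiplicativity splits the summand along \<open>d = c * e\<close>. Relaxing
  \<open>c * e \<le> X\<close> to \<open>c, e \<le> X\<close> gives the square of the sum for
  \<open>k\<close>, whence the exponent \<open>2 ^ k\<close>.\<close>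

lemma sum_ndiv_power_le:
  assumes "1 \<le> X"
  shows "(\<Sum>d\<in>{1..X}. real (ndiv d) ^ k / real d) \<le> (1 + ln (real X)) ^ (2 ^ k)"
proof (induction k)
  case 0
  show ?case using sum_inverse_le_ln[OF assms] by simp
next
  case (Suc k)
  define g where "g d = real (ndiv d) ^ k / real d" for d
  have g0: "0 \<le> g d" for d by (simp add: g_def)
  have "(\<Sum>d\<in>{1..X}. real (ndiv d) ^ Suc k / real d) = (\<Sum>d\<in>{1..X}. \<Sum>c\<in>{c. c dvd d}. g d)"
    by (simp add: ndiv_def g_def mult_ac)
  also have "\<dots> \<le> (\<Sum>d\<in>{1..X}. \<Sum>c\<in>{c. c dvd d}. g c * g (d div c))"
  proof (intro sum_mono)
    fix d c assume "d \<in> {1..X}" "c \<in> {c. c dvd d}"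
    then have "c dvd d" "0 < d" by auto
    then obtain e where e: "d = c * e" "0 < c" "0 < e" by (auto elim: dvdE)
    have "real (ndiv d) ^ k \<le> (real (ndiv c) * real (ndiv e)) ^ k"
      using ndiv_mult_le[OF e(2,3)] unfolding e(1) by (intro power_mono) (simp_all flip: of_nat_mult)
    then show "g d \<le> g c * g (d div c)"
      using e by (simp add: g_def power_mult_distrib divide_right_mono)
  qed
  also have "\<dots> = (\<Sum>(d, c)\<in>(SIGMA d:{1..X}. {c. c dvd d}). g c * g (d div c))"
    by (rule sum.Sigma) auto
  also have "\<dots> \<le> (\<Sum>(c, e)\<in>{1..X} \<times> {1..X}. g c * g e)"
  proof -
    have inj: "inj_on (\<lambda>(d, c). (c, d div c)) (SIGMA d:{1..X}. {c. c dvd d})"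
    proof (rule inj_onI)
      fix u v assume uv: "u \<in> (SIGMA d:{1..X}. {c. c dvd d})" "v \<in> (SIGMA d:{1..X}. {c. c dvd d})"
        "(\<lambda>(d, c). (c, d div c)) u = (\<lambda>(d, c). (c, d div c)) v"
      obtain d c d' c' where eq: "u = (d, c)" "v = (d', c')" by (cases u, cases v)
      then have "c dvd d" "c' dvd d'" "c = c'" "d div c = d' div c'" using uv by auto
      then show "u = v" using eq by (metis dvd_div_mult_self)
    qed
    have "(\<Sum>(d, c)\<in>(SIGMA d:{1..X}. {c. c dvd d}). g c * g (d div c))
        = (\<Sum>(c, e)\<in>(\<lambda>(d, c). (c, d div c)) ` (SIGMA d:{1..X}. {c. c dvd d}). g c * g e)"
      by (subst sum.reindex[OF inj]) (simp add: case_prod_beta o_def)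
    also have "\<dots> \<le> (\<Sum>(c, e)\<in>{1..X} \<times> {1..X}. g c * g e)"
    proof (rule sum_mono2)
      show "(\<lambda>(d, c). (c, d div c)) ` (SIGMA d:{1..X}. {c. c dvd d}) \<subseteq> {1..X} \<times> {1..X}"
      proof
        fix z assume "z \<in> (\<lambda>(d, c). (c, d div c)) ` (SIGMA d:{1..X}. {c. c dvd d})"
        then obtain d c where "d \<in> {1..X}" "c dvd d" and z: "z = (c, d div c)" by auto
        then have "c dvd d" "0 < d" by auto
        then obtain e where e: "d = c * e" "0 < c" "0 < e" by (auto elim: dvdE)
        have "c dvd d" "e dvd d" using e by auto
        then have "c \<le> X" "e \<le> X" using \<open>d \<in> {1..X}\<close> by (auto dest!: dvd_imp_le)
        then show "z \<in> {1..X} \<times> {1..X}" using e z by auto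
      qed
    qed (auto simp: g0)
    finally show ?thesis .
  qed
  also have "\<dots> = (\<Sum>d\<in>{1..X}. g d)\<^sup>2"
    by (simp add: power2_eq_square sum_product sum.cartesian_product)
  also have "\<dots> \<le> ((1 + ln (real X)) ^ (2 ^ k))\<^sup>2"
    using Suc.IH by (intro power_mono sum_nonneg) (auto simp: g_def)
  also have "\<dots> = (1 + ln (real X)) ^ (2 ^ Suc k)" by (simp add: mult.commute flip: power_mult)
  finally show ?case .
qed

lemma Lcm_image_bounds:
  fixes q :: "'i \<Rightarrow> nat"
  assumes "finite I" "q \<in> Pi\<^sub>E I (\<lambda>_. {1..Q})"
  shows "0 < Lcm (q ` I)" and "Lcm (q ` I) \<le> Q ^ card I"
proof -
  have "0 \<notin> q ` I" using assms by (auto simp: PiE_iff)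
  then show "0 < Lcm (q ` I)" using assms by (intro gr0I) (simp add: Lcm_0_iff)
  have pos: "0 < (\<Prod>i\<in>I. q i)" using assms by (intro prod_pos) (auto simp: PiE_iff)
  have "Lcm (q ` I) dvd (\<Prod>i\<in>I. q i)" using assms by (intro Lcm_least) (auto intro: dvd_prodI)
  then have "Lcm (q ` I) \<le> (\<Prod>i\<in>I. q i)" using pos by (rule dvd_imp_le)
  also have "\<dots> \<le> (\<Prod>i\<in>I. Q)" using assms by (intro prod_mono) (auto simp: PiE_iff)
  finally show "Lcm (q ` I) \<le> Q ^ card I" by simp
qed

text \<open>Every component of a tuple with least common multiple \<open>d\<close> divides
  \<open>d\<close>.\<close>

lemma card_Lcm_fibre_le:
  fixes d :: nat
  assumes "finite I" "0 < d"
  shows "card {q\<in>Pi\<^sub>E I B. Lcm (q ` I) = d} \<le> ndiv d ^ card I"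
proof -
  have "card {q\<in>Pi\<^sub>E I B. Lcm (q ` I) = d} \<le> card (Pi\<^sub>E I (\<lambda>_. {c. c dvd d}))"
  proof (rule card_mono)
    show "finite (Pi\<^sub>E I (\<lambda>_. {c. c dvd d}))" using assms by (intro finite_PiE) simp_all
    show "{q\<in>Pi\<^sub>E I B. Lcm (q ` I) = d} \<subseteq> Pi\<^sub>E I (\<lambda>_. {c. c dvd d})"
      by (auto simp: PiE_def)
  qed
  also have "card (Pi\<^sub>E I (\<lambda>_. {c. c dvd d})) = ndiv d ^ card I"
    using assms by (simp add: card_PiE ndiv_def)
  finally show ?thesis .
qed

text \<open>Grouping tuples by their least common multiple reduces to moments of the divisor
  function. The result is a power of a logarithm although there are \<open>Q ^ card I\<close>
  tuples; this is what makes high moments profitable.\<close>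

lemma sum_inverse_Lcm_le:
  fixes Q :: nat
  assumes "1 \<le> Q" "finite I"
  shows "(\<Sum>q\<in>Pi\<^sub>E I (\<lambda>_. {1..Q}). 1 / real (Lcm (q ` I)))
      \<le> (1 + ln (real (Q ^ card I))) ^ (2 ^ card I)"
proof -
  define Pf where "Pf = Pi\<^sub>E I (\<lambda>_. {1..Q})"
  define g where "g q = Lcm (q ` I)" for q :: "'a \<Rightarrow> nat"
  have finP: "finite Pf" unfolding Pf_def using assms(2) by (intro finite_PiE) simp_all
  have sub: "g ` Pf \<subseteq> {1..Q ^ card I}"
    using Lcm_image_bounds[OF assms(2)] by (force simp: Pf_def g_def Suc_le_eq)
  have 1: "(\<Sum>d\<in>{1..Q ^ card I}. \<Sum>q\<in>{q\<in>Pf. g q = d}. 1 / real (g q)) = (\<Sum>q\<in>Pf. 1 / real (g q))"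
    by (rule sum.group[OF finP finite_atLeastAtMost sub])
  have 2: "(\<Sum>q\<in>{q\<in>Pf. g q = d}. 1 / real (g q)) \<le> real (ndiv d) ^ card I / real d"
    if "d \<in> {1..Q ^ card I}" for d
  proof -
    have "(\<Sum>q\<in>{q\<in>Pf. g q = d}. 1 / real (g q)) = real (card {q\<in>Pf. g q = d}) / real d" by simp
    moreover have "card {q\<in>Pf. g q = d} \<le> ndiv d ^ card I"
      unfolding Pf_def g_def using that by (intro card_Lcm_fibre_le[OF assms(2)]) simp
    then have "real (card {q\<in>Pf. g q = d}) \<le> real (ndiv d) ^ card I" by (metis of_nat_le_iff of_nat_power)
    ultimately show ?thesis by (simp add: divide_right_mono)
  qed
  have 3: "1 \<le> Q ^ card I" using assms(1) by (rule one_le_power)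
  have "(\<Sum>q\<in>Pf. 1 / real (g q)) \<le> (\<Sum>d\<in>{1..Q ^ card I}. real (ndiv d) ^ card I / real d)"
    unfolding 1[symmetric] by (rule sum_mono) (rule 2)
  with sum_ndiv_power_le[OF 3, of "card I"] show ?thesis
    unfolding Pf_def g_def by (rule order_trans[rotated])
qed

section \<open>Passing to the local model\<close>

text \<open>Parseval modulo \<open>M\<close>; the diameter condition keeps the elements of
  \<open>A\<close> distinct modulo \<open>M\<close>.\<close>

lemma sum_norm_exponential_sum_squared:
  fixes A :: "int set"
  assumes "finite A" "0 < M" "\<And>x y. x \<in> A \<Longrightarrow> y \<in> A \<Longrightarrow> \<bar>x - y\<bar> < int M"
  shows "(\<Sum>k<M. (norm (\<Sum>x\<in>A. ee (real k * of_int x / real M)))\<^sup>2) = real M * real (card A)"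
proof -
  have sq: "of_real ((norm (\<Sum>x\<in>A. ee (real k * of_int x / real M)))\<^sup>2)
      = (\<Sum>x\<in>A. \<Sum>y\<in>A. ee (real k * of_int (x - y) / real M))" for k
    unfolding complex_norm_square cnj_sum sum_product cnj_ee ee_add[symmetric]
    by (intro sum.cong refl arg_cong[of _ _ ee]) (simp add: diff_divide_distrib right_diff_distrib)
  have "of_real (\<Sum>k<M. (norm (\<Sum>x\<in>A. ee (real k * of_int x / real M)))\<^sup>2)
      = (\<Sum>k<M. \<Sum>x\<in>A. \<Sum>y\<in>A. ee (real k * of_int (x - y) / real M))"
    unfolding of_real_sum sq ..
  also have "\<dots> = (\<Sum>x\<in>A. \<Sum>k<M. \<Sum>y\<in>A. ee (real k * of_int (x - y) / real M))" by (rule sum.swap)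
  also have "\<dots> = (\<Sum>x\<in>A. \<Sum>y\<in>A. \<Sum>k<M. ee (real k * of_int (x - y) / real M))"
    by (intro sum.cong refl sum.swap)
  also have "\<dots> = (\<Sum>x\<in>A. \<Sum>y\<in>A. if y = x then of_nat M else 0)"
  proof (intro sum.cong refl)
    fix x y assume xy: "x \<in> A" "y \<in> A"
    have "int M dvd x - y \<longleftrightarrow> y = x"
    proof
      assume d: "int M dvd x - y"
      show "y = x"
      proof (rule ccontr)
        assume "y \<noteq> x"
        then have "x - y \<noteq> 0" by simp
        from dvd_imp_le_int[OF this d] assms(3)[OF xy] show False by simp
      qed
    qed simp
    then show "(\<Sum>k<M. ee (real k * of_int (x - y) / real M)) = (if y = x then of_nat M else 0)"
      by (simp only: sum_ee_roots[OF assms(2)])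
  qed
  also have "\<dots> = of_real (real M * real (card A))" using assms(1) by simp
  finally show ?thesis by (simp only: of_real_eq_iff)
qed

text \<open>The double sum is written by Fourier inversion modulo \<open>T + 1\<close>; the
  transform of \<open>E\<close> is bounded in sup norm, those of \<open>A\<close> and
  \<open>B\<close> by Cauchy-Schwarz and Parseval.\<close>

lemma fourier_transfer:
  fixes A B :: "int set" and E :: "nat \<Rightarrow> complex"
  assumes fin: "finite A" "finite B"
    and AA: "\<And>x y. x \<in> A \<Longrightarrow> y \<in> A \<Longrightarrow> \<bar>x - y\<bar> \<le> int T"
    and BB: "\<And>x y. x \<in> B \<Longrightarrow> y \<in> B \<Longrightarrow> \<bar>x - y\<bar> \<le> int T"
    and AB: "\<And>x y. x \<in> A \<Longrightarrow> y \<in> B \<Longrightarrow> 1 \<le> y - x \<and> y - x \<le> int T"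
    and C: "\<And>\<theta>. norm (\<Sum>t\<in>{1..T}. E t * ee (\<theta> * real t)) \<le> C"
  shows "norm (\<Sum>x\<in>A. \<Sum>y\<in>B. E (nat (y - x))) \<le> C * sqrt (real (card A) * real (card B))"
proof -
  \<comment> \<open>This exceeds every difference within and between the sets, and every
    \<open>t - (y - x)\<close>, so congruence modulo \<open>M\<close> means equality.\<close>
  define M where "M = Suc T"
  define F where "F S k = (\<Sum>x\<in>S. ee (real k * of_int x / real M))" for S :: "int set" and k
  define H where "H k = (\<Sum>t\<in>{1..T}. E t * ee (real k / real M * real t))" for k
  have M0: "0 < M" by (simp add: M_def)
  have AA': "\<bar>x - y\<bar> < int M" if "x \<in> A" "y \<in> A" for x y using AA[OF that] unfolding M_def by linarith
  have BB': "\<bar>x - y\<bar> < int M" if "x \<in> B" "y \<in> B" for x y using BB[OF that] unfolding M_def by linarith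
  have C0: "0 \<le> C" using C[of 0] norm_ge_zero order_trans by blast
  have "of_nat M * (\<Sum>x\<in>A. \<Sum>y\<in>B. E (nat (y - x)))
      = (\<Sum>x\<in>A. \<Sum>y\<in>B. \<Sum>t\<in>{1..T}. E t * (\<Sum>k<M. ee (real k * of_int (int t - y + x) / real M)))"
    unfolding sum_distrib_left
  proof (intro sum.cong refl)
    fix x y assume xy: "x \<in> A" "y \<in> B"
    define t0 where "t0 = nat (y - x)"
    have t0: "t0 \<in> {1..T}" "int t0 = y - x" using AB[OF xy] by (auto simp: t0_def)
    have "int M dvd int t - y + x \<longleftrightarrow> t = t0" if "t \<in> {1..T}" for t
    proof
      assume "int M dvd int t - y + x"
      moreover have "\<bar>int t - y + x\<bar> < int M" using that t0 AB[OF xy] unfolding M_def by auto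
      ultimately have "int t - y + x = 0" using dvd_imp_le_int[of "int t - y + x" "int M"] by auto
      then show "t = t0" using t0 by simp
    qed (use t0 in simp)
    then have "(\<Sum>t\<in>{1..T}. E t * (\<Sum>k<M. ee (real k * of_int (int t - y + x) / real M)))
        = (\<Sum>t\<in>{1..T}. if t = t0 then of_nat M * E t else 0)"
      unfolding sum_ee_roots[OF M0] by (intro sum.cong refl) auto
    also have "\<dots> = of_nat M * E t0" using t0 by simp
    finally show "of_nat M * E (nat (y - x)) = (\<Sum>t\<in>{1..T}. \<Sum>k<M. E t * ee (real k * of_int (int t - y + x) / real M))"
      by (simp add: t0_def sum_distrib_left)
  qed
  also have "\<dots> = (\<Sum>k<M. H k * F A k * cnj (F B k))"
  proof -
    have "(\<Sum>x\<in>A. \<Sum>y\<in>B. \<Sum>t\<in>{1..T}. E t * (\<Sum>k<M. ee (real k * of_int (int t - y + x) / real M)))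
       = (\<Sum>x\<in>A. \<Sum>y\<in>B. \<Sum>k<M. \<Sum>t\<in>{1..T}. E t * ee (real k * of_int (int t - y + x) / real M))"
      unfolding sum_distrib_left by (intro sum.cong refl sum.swap)
    also have "\<dots> = (\<Sum>x\<in>A. \<Sum>k<M. \<Sum>y\<in>B. \<Sum>t\<in>{1..T}. E t * ee (real k * of_int (int t - y + x) / real M))"
      by (intro sum.cong refl sum.swap)
    also have "\<dots> = (\<Sum>k<M. \<Sum>x\<in>A. \<Sum>y\<in>B. \<Sum>t\<in>{1..T}. E t * ee (real k * of_int (int t - y + x) / real M))"
      by (rule sum.swap)
    also have "\<dots> = (\<Sum>k<M. \<Sum>x\<in>A. \<Sum>y\<in>B. H k * ee (real k * of_int x / real M) * cnj (ee (real k * of_int y / real M)))"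
    proof (intro sum.cong refl)
      fix k x y
      have "ee (real k * of_int (int t - y + x) / real M)
          = ee (real k / real M * real t) * ee (real k * of_int x / real M) * cnj (ee (real k * of_int y / real M))" for t
        unfolding cnj_ee ee_add[symmetric] using M0
        by (intro arg_cong[of _ _ ee]) (simp add: field_simps)
      then show "(\<Sum>t\<in>{1..T}. E t * ee (real k * of_int (int t - y + x) / real M))
          = H k * ee (real k * of_int x / real M) * cnj (ee (real k * of_int y / real M))"
        by (simp add: H_def sum_distrib_right mult.assoc)
    qed
    also have "\<dots> = (\<Sum>k<M. H k * F A k * cnj (F B k))"
    proof (intro sum.cong refl)
      fix k
      have HF: "H k * F A k = (\<Sum>x\<in>A. H k * ee (real k * of_int x / real M))"
        unfolding F_def by (rule sum_distrib_left)
      show "(\<Sum>x\<in>A. \<Sum>y\<in>B. H k * ee (real k * of_int x / real M) * cnj (ee (real k * of_int y / real M)))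
          = H k * F A k * cnj (F B k)"
        unfolding HF unfolding F_def cnj_sum by (rule sum_product[symmetric])
    qed
    finally show ?thesis .
  qed
  finally have eq: "of_nat M * (\<Sum>x\<in>A. \<Sum>y\<in>B. E (nat (y - x))) = (\<Sum>k<M. H k * F A k * cnj (F B k))" .
  have "real M * norm (\<Sum>x\<in>A. \<Sum>y\<in>B. E (nat (y - x))) = norm (\<Sum>k<M. H k * F A k * cnj (F B k))"
    unfolding eq[symmetric] norm_mult norm_of_nat ..
  also have "\<dots> \<le> (\<Sum>k<M. C * (norm (F A k) * norm (F B k)))"
  proof (intro order_trans[OF norm_sum] sum_mono)
    fix k
    have "norm (H k) \<le> C" unfolding H_def by (rule C)
    then show "norm (H k * F A k * cnj (F B k)) \<le> C * (norm (F A k) * norm (F B k))"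
      by (simp add: norm_mult mult.assoc mult_right_mono)
  qed
  also have "\<dots> = C * (\<Sum>k<M. norm (F A k) * norm (F B k))" by (simp add: sum_distrib_left)
  also have "\<dots> \<le> C * (real M * sqrt (real (card A) * real (card B)))"
  proof (rule mult_left_mono[OF _ C0])
    show "(\<Sum>k<M. norm (F A k) * norm (F B k)) \<le> real M * sqrt (real (card A) * real (card B))"
  proof (rule power2_le_imp_le)
    have "(\<Sum>k<M. norm (F A k) * norm (F B k))\<^sup>2 \<le> (\<Sum>k<M. (norm (F A k))\<^sup>2) * (\<Sum>k<M. (norm (F B k))\<^sup>2)"
      by (rule Cauchy_Schwarz_ineq_sum)
    also have "(\<Sum>k<M. (norm (F A k))\<^sup>2) = real M * real (card A)"
      unfolding F_def by (rule sum_norm_exponential_sum_squared[OF fin(1) M0]) (rule AA')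
    also have "(\<Sum>k<M. (norm (F B k))\<^sup>2) = real M * real (card B)"
      unfolding F_def by (rule sum_norm_exponential_sum_squared[OF fin(2) M0]) (rule BB')
    finally show "(\<Sum>k<M. norm (F A k) * norm (F B k))\<^sup>2 \<le> (real M * sqrt (real (card A) * real (card B)))\<^sup>2"
      by (simp add: power_mult_distrib power2_eq_square mult_ac)
  qed auto
  qed
  finally have "real M * norm (\<Sum>x\<in>A. \<Sum>y\<in>B. E (nat (y - x))) \<le> real M * (C * sqrt (real (card A) * real (card B)))"
    by (simp only: mult_ac)
  then show ?thesis using M0 by simp
qed

section \<open>Weights with the given transforms, and the local parts of their correlation with a
  set\<close>

definition square_weight :: "nat \<Rightarrow> nat \<Rightarrow> complex" where
  "square_weight R t = (\<Sum>n<R. if (Suc n)\<^sup>2 = t then of_nat (2 * n + 1) else 0)"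

definition model_weight :: "nat \<Rightarrow> nat \<Rightarrow> complex" where
  "model_weight Q t = (\<Sum>q\<in>{1..Q}. \<Sum>a\<in>reduced_residues q. gauss a q * ee (- (real a * real t / real q)))"

lemma finite_reduced_residues [simp]: "finite (reduced_residues q)" by (simp add: reduced_residues_def)

lemma square_weight_transform:
  "(\<Sum>t\<in>{1..R\<^sup>2}. square_weight R t * ee (\<theta> * real t)) = square_sum R \<theta>"
proof -
  have "(\<Sum>t\<in>{1..R\<^sup>2}. square_weight R t * ee (\<theta> * real t))
     = (\<Sum>t\<in>{1..R\<^sup>2}. \<Sum>n<R. if t = (Suc n)\<^sup>2 then of_nat (2 * n + 1) * ee (\<theta> * real t) else 0)"
    unfolding square_weight_def sum_distrib_right by (intro sum.cong refl) auto
  also have "\<dots> = (\<Sum>n<R. \<Sum>t\<in>{1..R\<^sup>2}. if t = (Suc n)\<^sup>2 then of_nat (2 * n + 1) * ee (\<theta> * real t) else 0)"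
    by (rule sum.swap)
  also have "\<dots> = square_sum R \<theta>"
    unfolding square_sum_def
  proof (intro sum.cong refl)
    fix n assume "n \<in> {..<R}"
    then have "(Suc n)\<^sup>2 \<le> R\<^sup>2" by (intro power_mono) auto
    moreover have "1 \<le> (Suc n)\<^sup>2" by (rule one_le_power) simp
    ultimately have mem: "(Suc n)\<^sup>2 \<in> {1..R\<^sup>2}" by simp
    show "(\<Sum>t\<in>{1..R\<^sup>2}. if t = (Suc n)\<^sup>2 then of_nat (2 * n + 1) * ee (\<theta> * real t) else 0)
       = of_nat (2 * n + 1) * ee (\<theta> * (real (Suc n))\<^sup>2)"
      by (subst sum.delta) (simp, simp only: mem if_True of_nat_power)
  qed
  finally show ?thesis .
qed

lemma model_weight_transform:
  "(\<Sum>t\<in>{1..X}. model_weight Q t * ee (\<theta> * real t)) = model_sum Q X \<theta>"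
proof -
  have "(\<Sum>t\<in>{1..X}. model_weight Q t * ee (\<theta> * real t))
     = (\<Sum>t\<in>{1..X}. \<Sum>q\<in>{1..Q}. \<Sum>a\<in>reduced_residues q. gauss a q * ee ((\<theta> - real a / real q) * real t))"
    unfolding model_weight_def sum_distrib_right mult.assoc ee_add[symmetric]
    by (intro sum.cong refl arg_cong2[of _ _ _ _ "(*)"] arg_cong[of _ _ ee]) (simp add: algebra_simps)
  also have "\<dots> = (\<Sum>q\<in>{1..Q}. \<Sum>t\<in>{1..X}. \<Sum>a\<in>reduced_residues q. gauss a q * ee ((\<theta> - real a / real q) * real t))"
    by (rule sum.swap)
  also have "\<dots> = (\<Sum>q\<in>{1..Q}. \<Sum>a\<in>reduced_residues q. \<Sum>t\<in>{1..X}. gauss a q * ee ((\<theta> - real a / real q) * real t))"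
    by (intro sum.cong refl sum.swap)
  finally show ?thesis by (simp add: model_sum_def sum_distrib_left)
qed

text \<open>The share of denominator \<open>q\<close> in the model weight at \<open>y - x\<close>,
  summed over \<open>y\<close> in \<open>B\<close>. The sum over \<open>B\<close> is put into the
  coefficient so that a trigonometric polynomial in \<open>x\<close> results.\<close>

definition local_part :: "int set \<Rightarrow> nat \<Rightarrow> int \<Rightarrow> complex" where
  "local_part B q x = (\<Sum>a\<in>reduced_residues q.
     (gauss a q * (\<Sum>y\<in>B. ee (- (real a * of_int y / real q)))) * ee (real a * of_int x / real q))"

lemma local_part_1: "local_part B 1 x = of_nat (card B)"
proof -
  have r: "reduced_residues 1 = {0}" by (auto simp: reduced_residues_def)
  have g: "gauss 0 1 = 1" by (simp add: gauss_def)
  show ?thesis unfolding local_part_def r by (simp add: g[simplified])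
qed

text \<open>The square weight vanishes at every \<open>y - x\<close>, so on these differences
  \<open>E\<close> is minus the model weight and the Fourier bound applies to the model alone.
  Splitting off \<open>q = 1\<close>, which contributes \<open>card A * card B\<close>, leaves the
  claim.\<close>

lemma sum_local_part_ge:
  fixes A B :: "int set"
  assumes P: "1000 \<le> P" "P ^ 20 \<le> R"
    and fin: "finite A" "finite B"
    and AA: "\<And>x y. x \<in> A \<Longrightarrow> y \<in> A \<Longrightarrow> \<bar>x - y\<bar> \<le> int (R\<^sup>2)"
    and BB: "\<And>x y. x \<in> B \<Longrightarrow> y \<in> B \<Longrightarrow> \<bar>x - y\<bar> \<le> int (R\<^sup>2)"
    and AB: "\<And>x y. x \<in> A \<Longrightarrow> y \<in> B \<Longrightarrow> 1 \<le> y - x \<and> y - x \<le> int (R\<^sup>2)"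
    and nosq: "\<And>x y n. x \<in> A \<Longrightarrow> y \<in> B \<Longrightarrow> 1 \<le> n \<Longrightarrow> y - x \<noteq> n\<^sup>2"
  shows "real (card A) * real (card B) - (real R)\<^sup>2 / real P * sqrt (real (card A) * real (card B))
      \<le> norm (\<Sum>x\<in>A. \<Sum>q\<in>{2..P ^ 4}. local_part B q x)"
proof -
  define Q where "Q = P ^ 4"
  define E where "E t = square_weight R t - model_weight Q t" for t
  have Q1: "1 \<le> Q" using P by (simp add: Q_def)
  have bnd: "norm (\<Sum>x\<in>A. \<Sum>y\<in>B. E (nat (y - x))) \<le> (real R)\<^sup>2 / real P * sqrt (real (card A) * real (card B))"
  proof (rule fourier_transfer[OF fin AA BB AB])
    fix \<theta>
    have "(\<Sum>t\<in>{1..R\<^sup>2}. E t * ee (\<theta> * real t)) = square_sum R \<theta> - model_sum Q (R\<^sup>2) \<theta>"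
      by (simp only: E_def left_diff_distrib sum_subtractf square_weight_transform model_weight_transform)
    then show "norm (\<Sum>t\<in>{1..R\<^sup>2}. E t * ee (\<theta> * real t)) \<le> (real R)\<^sup>2 / real P"
      using square_sum_model_error[OF P] by (simp add: Q_def)
  qed
  have E: "E (nat (y - x)) = - model_weight Q (nat (y - x))" if xy: "x \<in> A" "y \<in> B" for x y
  proof -
    have "(Suc n)\<^sup>2 \<noteq> nat (y - x)" for n
    proof
      assume "(Suc n)\<^sup>2 = nat (y - x)"
      then have "int ((Suc n)\<^sup>2) = y - x" using AB[OF xy] by simp
      then have "y - x = (int (Suc n))\<^sup>2" by simp
      then show False using nosq[OF xy, of "int (Suc n)"] by simp
    qed
    then have "square_weight R (nat (y - x)) = 0" unfolding square_weight_def by simp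
    then show ?thesis by (simp add: E_def)
  qed
  have mw: "model_weight Q (nat (y - x)) = (\<Sum>q\<in>{1..Q}. \<Sum>a\<in>reduced_residues q.
      gauss a q * ee (- (real a * of_int y / real q)) * ee (real a * of_int x / real q))"
    if xy: "x \<in> A" "y \<in> B" for x y
  proof -
    have "real (nat (y - x)) = of_int y - of_int x" using AB[OF xy] by simp
    then show ?thesis unfolding model_weight_def mult.assoc ee_add[symmetric]
      by (intro sum.cong refl arg_cong2[of _ _ _ _ "(*)"] arg_cong[of _ _ ee])
        (simp add: right_diff_distrib diff_divide_distrib)
  qed
  have inner: "(\<Sum>y\<in>B. E (nat (y - x))) = - (\<Sum>q\<in>{1..Q}. local_part B q x)" if x: "x \<in> A" for x
  proof -
    have "(\<Sum>y\<in>B. E (nat (y - x))) = - (\<Sum>y\<in>B. \<Sum>q\<in>{1..Q}. \<Sum>a\<in>reduced_residues q.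
      gauss a q * ee (- (real a * of_int y / real q)) * ee (real a * of_int x / real q))"
      using E[OF x] mw[OF x] by (simp add: sum_negf)
    also have "(\<Sum>y\<in>B. \<Sum>q\<in>{1..Q}. \<Sum>a\<in>reduced_residues q.
      gauss a q * ee (- (real a * of_int y / real q)) * ee (real a * of_int x / real q))
      = (\<Sum>q\<in>{1..Q}. \<Sum>y\<in>B. \<Sum>a\<in>reduced_residues q.
      gauss a q * ee (- (real a * of_int y / real q)) * ee (real a * of_int x / real q))"
      by (rule sum.swap)
    also have "\<dots> = (\<Sum>q\<in>{1..Q}. \<Sum>a\<in>reduced_residues q. \<Sum>y\<in>B.
      gauss a q * ee (- (real a * of_int y / real q)) * ee (real a * of_int x / real q))"
      by (intro sum.cong refl sum.swap)
    finally show ?thesis by (simp add: local_part_def sum_distrib_left sum_distrib_right)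
  qed
  have "{1..Q} = insert 1 {2..Q}" using Q1 by auto
  then have "(\<Sum>q\<in>{1..Q}. local_part B q x) = of_nat (card B) + (\<Sum>q\<in>{2..Q}. local_part B q x)" for x
    by (simp add: local_part_1[simplified])
  then have "(\<Sum>x\<in>A. \<Sum>y\<in>B. E (nat (y - x))) = - (of_nat (card A) * of_nat (card B) + (\<Sum>x\<in>A. \<Sum>q\<in>{2..Q}. local_part B q x))"
    using inner by (simp add: sum_negf sum.distrib sum_subtractf)
  then have "norm (of_nat (card A) * of_nat (card B) + (\<Sum>x\<in>A. \<Sum>q\<in>{2..Q}. local_part B q x))
      \<le> (real R)\<^sup>2 / real P * sqrt (real (card A) * real (card B))"
    using bnd by (metis norm_minus_cancel)
  moreover have "norm (of_nat (card A) * of_nat (card B) :: complex) = real (card A) * real (card B)"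
    by (simp add: norm_mult)
  ultimately show ?thesis
    using norm_triangle_ineq2[of "of_nat (card A) * of_nat (card B) :: complex" "- (\<Sum>x\<in>A. \<Sum>q\<in>{2..Q}. local_part B q x)"]
    by (simp add: Q_def)
qed

section \<open>Moments of the local terms\<close>

text \<open>Each full period contributes a complete sum; the rest has fewer than \<open>D\<close>
  terms, of size at most \<open>s\<close>.\<close>

lemma norm_sum_periodic_interval_le:
  fixes f :: "nat \<Rightarrow> complex"
  assumes D: "0 < D" and per: "\<And>n. f (n + D) = f n" and s: "\<And>n. norm (f n) \<le> s"
  shows "norm (\<Sum>n<X. f n) \<le> real X / real D * norm (\<Sum>n<D. f n) + real D * s"
proof (induction X rule: less_induct)
  case (less X)
  have s0: "0 \<le> s" using s[of 0] norm_ge_zero order_trans by blast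
  show ?case
  proof (cases "X < D")
    case True
    have "norm (\<Sum>n<X. f n) \<le> real (card {..<X}) * s" by (rule sum_norm_bound) (rule s)
    also have "\<dots> \<le> real D * s" using True s0 by (intro mult_right_mono) auto
    finally show ?thesis by (simp add: add_increasing)
  next
    case False
    then obtain Y where Y: "X = Y + D" by (metis add.commute le_Suc_ex not_less)
    have "(\<Sum>n<Y + D. f n) = (\<Sum>n<Y. f n) + (\<Sum>h<D. f (Y + h))"
      by (induction D) (simp_all add: add_ac)
    then have "(\<Sum>n<X. f n) = (\<Sum>n<Y. f n) + (\<Sum>n<D. f n)"
      using sum_periodic_shift[of f D Y] per Y by simp
    then have "norm (\<Sum>n<X. f n) \<le> (real Y / real D * norm (\<Sum>n<D. f n) + real D * s) + norm (\<Sum>n<D. f n)"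
      using less.IH[of Y] Y D norm_triangle_ineq[of "\<Sum>n<Y. f n" "\<Sum>n<D. f n"] by simp
    moreover have "real X / real D = real Y / real D + 1" using D by (simp add: Y add_divide_distrib)
    ultimately show ?thesis by (simp add: ring_distribs)
  qed
qed

text \<open>Translation by \<open>D'\<close> fixes \<open>g\<close> but multiplies the character by
  \<open>ee (a * D' / q)\<close>, which is not 1 as \<open>a\<close> is prime to \<open>q\<close>
  and \<open>q\<close> does not divide \<open>D'\<close>. A sum over a full period \<open>D\<close>
  is unchanged by translation, so it is 0.\<close>

lemma sum_times_character_eq_0:
  fixes g :: "nat \<Rightarrow> complex" and a :: int
  assumes q: "0 < q" "q dvd D" "\<not> q dvd D'" and dvd: "D' dvd D" and cop: "coprime a (int q)"
    and per: "\<And>n. g (n + D') = g n"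
  shows "(\<Sum>n<D. g n * ee (of_int a * real n / real q)) = 0"
proof -
  define f where "f n = g n * ee (of_int a * real n / real q)" for n
  have perD: "g (n + k * D') = g n" for n k
    by (induction k) (simp_all add: per add.assoc[symmetric] add.commute[of D'])
  obtain k where k: "D = k * D'" using dvd by (metis dvdE mult.commute)
  obtain l where l: "D = q * l" using q by blast
  have "f (n + D) = f n" for n
  proof -
    have "of_int a * real (n + D) / real q - of_int a * real n / real q = of_int (a * int l)"
      using q by (simp add: l field_simps)
    then have "ee (of_int a * real (n + D) / real q) = ee (of_int a * real n / real q)" by (rule ee_eq_intdiff)
    then show ?thesis unfolding f_def using perD[of n k] k by simp
  qed
  then have "(\<Sum>n<D. f n) = (\<Sum>n<D. f (D' + n))" by (rule sum_periodic_shift[symmetric])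
  also have "\<dots> = ee (of_int a * real D' / real q) * (\<Sum>n<D. f n)"
  proof -
    have "f (D' + n) = ee (of_int a * real D' / real q) * f n" for n
    proof -
      have "of_int a * real (D' + n) / real q = of_int a * real D' / real q + of_int a * real n / real q"
        by (simp add: ring_distribs add_divide_distrib)
      then show ?thesis unfolding f_def using per[of n] by (simp add: ee_add add.commute)
    qed
    then show ?thesis by (simp add: sum_distrib_left)
  qed
  finally have eq: "(1 - ee (of_int a * real D' / real q)) * (\<Sum>n<D. f n) = 0" by (simp add: algebra_simps)
  have "ee (of_int a * real D' / real q) \<noteq> 1"
  proof
    assume "ee (of_int a * real D' / real q) = 1"
    then have "of_int a * real D' / real q \<in> \<int>" by (simp add: ee_eq_1_iff)
    then obtain i where "of_int a * real D' / real q = of_int i" by (auto elim: Ints_cases)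
    then have "real_of_int (a * int D') = real_of_int (i * int q)" using q by (simp add: field_simps)
    then have "a * int D' = i * int q" by (simp only: of_int_eq_iff)
    then have "int q dvd a * int D'" by simp
    then have "int q dvd int D'" using cop by (simp add: coprime_commute coprime_dvd_mult_right_iff)
    then show False using q by simp
  qed
  then show ?thesis using eq by (simp add: f_def)
qed

section \<open>Trigonometric polynomials whose frequencies are reduced fractions of one
  denominator\<close>

definition primitive_poly :: "(nat \<Rightarrow> complex) \<Rightarrow> nat \<Rightarrow> int \<Rightarrow> complex" where
  "primitive_poly c q x = (\<Sum>a\<in>reduced_residues q. c a * ee (real a * of_int x / real q))"

lemma primitive_poly_periodic:
  assumes "0 < q" "x mod int q = y mod int q"
  shows "primitive_poly c q x = primitive_poly c q y"
proof -
  obtain k where k: "x - y = int q * k" using assms(2) by (metis mod_eq_dvd_iff dvdE)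
  have "ee (real a * of_int x / real q) = ee (real a * of_int y / real q)" for a
  proof (rule ee_eq_intdiff)
    have "real a * of_int x / real q - real a * of_int y / real q = real a * of_int (x - y) / real q"
      by (simp add: right_diff_distrib diff_divide_distrib)
    then show "real a * of_int x / real q - real a * of_int y / real q = of_int (int a * k)"
      using assms(1) by (simp add: k)
  qed
  then show ?thesis by (simp add: primitive_poly_def)
qed

lemma primitive_poly_norm_squared:
  assumes q: "0 < q"
  shows "(\<Sum>x\<in>{0..<int q}. (norm (primitive_poly c q x))\<^sup>2) = real q * (\<Sum>a\<in>reduced_residues q. (norm (c a))\<^sup>2)"
proof -
  have "of_real (\<Sum>x\<in>{0..<int q}. (norm (primitive_poly c q x))\<^sup>2)
    = (\<Sum>x<q. primitive_poly c q (int x) * cnj (primitive_poly c q (int x)))"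
    unfolding of_real_sum complex_norm_square
    by (rule sum.reindex_bij_witness[of _ int nat]) auto
  also have "\<dots> = (\<Sum>x<q. \<Sum>a\<in>reduced_residues q. \<Sum>b\<in>reduced_residues q. c a * cnj (c b) * ee (real x * of_int (int a - int b) / real q))"
    unfolding primitive_poly_def cnj_sum sum_product
  proof (intro sum.cong refl)
    fix x a b
    have "ee (real a * of_int (int x) / real q) * cnj (ee (real b * of_int (int x) / real q)) 
        = ee (real x * of_int (int a - int b) / real q)"
      unfolding cnj_ee ee_add[symmetric]
      by (intro arg_cong[of _ _ ee]) (use q in \<open>simp add: field_simps\<close>)
    then show "c a * ee (real a * of_int (int x) / real q) * cnj (c b * ee (real b * of_int (int x) / real q))
      = c a * cnj (c b) * ee (real x * of_int (int a - int b) / real q)"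
      by (simp add: mult_ac)
  qed
  also have "\<dots> = (\<Sum>a\<in>reduced_residues q. \<Sum>x<q. \<Sum>b\<in>reduced_residues q. c a * cnj (c b) * ee (real x * of_int (int a - int b) / real q))"
    by (rule sum.swap)
  also have "\<dots> = (\<Sum>a\<in>reduced_residues q. \<Sum>b\<in>reduced_residues q. c a * cnj (c b) * (\<Sum>x<q. ee (real x * of_int (int a - int b) / real q)))"
    unfolding sum_distrib_left by (intro sum.cong refl sum.swap)
  also have "\<dots> = (\<Sum>a\<in>reduced_residues q. \<Sum>b\<in>reduced_residues q. if b = a then of_nat q * (c a * cnj (c a)) else 0)"
  proof (intro sum.cong refl)
    fix a b assume ab: "a \<in> reduced_residues q" "b \<in> reduced_residues q"
    have "int q dvd int a - int b \<longleftrightarrow> b = a"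
      using ab q by (auto simp: reduced_residues_def mod_eq_dvd_iff[symmetric])
    then show "c a * cnj (c b) * (\<Sum>x<q. ee (real x * of_int (int a - int b) / real q))
      = (if b = a then of_nat q * (c a * cnj (c a)) else 0)"
      unfolding sum_ee_roots[OF q] by simp
  qed
  also have "\<dots> = (\<Sum>a\<in>reduced_residues q. of_nat q * (c a * cnj (c a)))" by simp
  also have "\<dots> = of_real (real q * (\<Sum>a\<in>reduced_residues q. (norm (c a))\<^sup>2))"
    by (simp add: sum_distrib_left complex_norm_square del: of_real_power)
  finally show ?thesis by (simp only: of_real_eq_iff)
qed

lemma dvd_div_prime_if_multiplicity_less:
  fixes p q D :: nat
  assumes "prime p" "0 < D" "q dvd D" "multiplicity p q < multiplicity p D"
  shows "q dvd D div p"
proof -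
  obtain e where e: "D = q * e" using assms by blast
  have "multiplicity p D = multiplicity p q + multiplicity p e"
    unfolding e using assms e by (intro prime_elem_multiplicity_mult_distrib) auto
  then have "p dvd e" using assms(4) by (metis add.right_neutral less_irrefl not_dvd_imp_multiplicity_0)
  then show ?thesis unfolding e by (auto elim!: dvdE simp: assms(1) prime_gt_0_nat)
qed

text \<open>If every prime of the lcm \<open>D\<close> has its full power in two of the moduli, the
  Loomis-Whitney type bound handles one period. Otherwise only one modulus carries the full power of
  some \<open>p\<close>, the others divide \<open>D div p\<close>, and its primitive characters sum
  to zero against the rest. \<open>cj\<close> marks the factors to conjugate. \<open>W\<close>
  bounds sums over a period rather than means, which is why a division by \<open>D\<close>
  appears.\<close>

lemma norm_sum_prod_primitive_le:
  fixes c :: "'i \<Rightarrow> nat \<Rightarrow> complex" and q :: "'i \<Rightarrow> nat" and cj :: "'i \<Rightarrow> bool"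
  assumes fin: "finite I" and ne: "I \<noteq> {}" and q0: "\<And>i. i \<in> I \<Longrightarrow> 0 < q i" and W0: "0 \<le> W"
    and W: "\<And>i. i \<in> I \<Longrightarrow> (\<Sum>x\<in>{0..<int (q i)}. (norm (primitive_poly (c i) (q i) x))\<^sup>2) \<le> W"
  defines "F \<equiv> \<lambda>i x. if cj i then cnj (primitive_poly (c i) (q i) x) else primitive_poly (c i) (q i) x"
  shows "norm (\<Sum>n<X. \<Prod>i\<in>I. F i (int n)) \<le> sqrt W ^ card I * (real X / real (Lcm (q ` I)) + real (Lcm (q ` I)))"
proof -
  define D where "D = Lcm (q ` I)"
  define f where "f n = (\<Prod>i\<in>I. F i (int n))" for n
  have "0 \<notin> q ` I" using q0 by force
  then have D0: "0 < D" using fin unfolding D_def by (intro gr0I) (simp add: Lcm_0_iff)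
  have qD: "q i dvd D" if "i \<in> I" for i using that by (simp add: D_def)
  have Fmod: "F i x = F i y" if "i \<in> I" "x mod int (q i) = y mod int (q i)" for i x y
    using primitive_poly_periodic[OF q0[OF that(1)] that(2)] by (simp add: F_def)
  have Fshift: "F i (int (n + k)) = F i (int n)" if "i \<in> I" "q i dvd k" for i n k
    using that by (intro Fmod) (auto simp: mod_eq_dvd_iff)
  have fper: "f (n + D) = f n" for n
    unfolding f_def using Fshift qD by (intro prod.cong) auto
  have nF: "norm (F i x) = norm (primitive_poly (c i) (q i) x)" for i x by (simp add: F_def)
  have Fle: "norm (F i x) \<le> sqrt W" if i: "i \<in> I" for i x
  proof -
    have "(norm (primitive_poly (c i) (q i) (x mod int (q i))))\<^sup>2 \<le> (\<Sum>x\<in>{0..<int (q i)}. (norm (primitive_poly (c i) (q i) x))\<^sup>2)"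
      using q0[OF i] by (intro member_le_sum) auto
    also have "\<dots> \<le> W" by (rule W[OF i])
    finally have "(norm (F i (x mod int (q i))))\<^sup>2 \<le> W" by (simp add: nF)
    moreover have "F i (x mod int (q i)) = F i x" by (rule Fmod[OF i]) simp
    ultimately show ?thesis by (simp add: real_le_rsqrt)
  qed
  have fle: "norm (f n) \<le> sqrt W ^ card I" for n
  proof -
    have "norm (f n) = (\<Prod>i\<in>I. norm (F i (int n)))" by (simp add: f_def prod_norm)
    also have "\<dots> \<le> (\<Prod>i\<in>I. sqrt W)" using Fle by (intro prod_mono) auto
    finally show ?thesis by simp
  qed
  have main: "norm (\<Sum>n<D. f n) \<le> sqrt W ^ card I"
  proof (cases "\<forall>p. prime p \<longrightarrow> p dvd D \<longrightarrow> (\<exists>i\<in>I. \<exists>j\<in>I. i \<noteq> j \<and>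
            multiplicity p (q i) = multiplicity p D \<and> multiplicity p (q j) = multiplicity p D)")
    case True
    have "norm (\<Sum>n<D. f n) \<le> (\<Sum>n<D. \<Prod>i\<in>I. norm (F i (int n)))"
      by (rule order_trans[OF norm_sum]) (simp add: f_def prod_norm)
    also have "\<dots> = (\<Sum>x\<in>{0..<int D}. \<Prod>i\<in>I. norm (F i x))"
      by (rule sum.reindex_bij_witness[of _ nat int]) auto
    also have "\<dots> \<le> (\<Prod>i\<in>I. sqrt (\<Sum>x\<in>{0..<int (q i)}. (norm (F i x))\<^sup>2))"
    proof (rule sum_prod_periodic_le[OF fin D0 qD])
      show "norm (F i (x mod int (q i))) = norm (F i x)" if "i \<in> I" for i x
        using Fmod[OF that, of "x mod int (q i)" x] by simp
      show "\<exists>i\<in>I. \<exists>j\<in>I. i \<noteq> j \<and> multiplicity p (q i) = multiplicity p D \<and> multiplicity p (q j) = multiplicity p D"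
        if "prime p" "p dvd D" for p using True that by blast
    qed auto
    also have "\<dots> \<le> (\<Prod>i\<in>I. sqrt W)"
      using W by (intro prod_mono) (auto simp: nF sum_nonneg)
    finally show ?thesis by simp
  next
    case False
    then obtain p where p: "prime p" "p dvd D" and no: "\<And>i j. i \<in> I \<Longrightarrow> j \<in> I \<Longrightarrow> i \<noteq> j \<Longrightarrow>
            multiplicity p (q i) = multiplicity p D \<Longrightarrow> multiplicity p (q j) = multiplicity p D \<Longrightarrow> False"
      by blast
    define D' where "D' = D div p"
    have D'D: "D' dvd D" unfolding D'_def using p by (metis dvd_mult_div_cancel dvd_triv_right)
    \<comment> \<open>Otherwise \<open>D div p\<close> would be a smaller common multiple. A modulus
      not dividing it carries the full power of \<open>p\<close>, so by \<open>no\<close> there is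
      only one.\<close>
    have "\<exists>i\<in>I. \<not> q i dvd D'"
    proof (rule ccontr)
      assume "\<not> (\<exists>i\<in>I. \<not> q i dvd D')"
      then have "D dvd D'" unfolding D_def by (intro Lcm_least) auto
      moreover have "0 < D'" "D' < D" unfolding D'_def using p D0 prime_gt_1_nat[OF p(1)]
        by (auto simp: dvd_imp_le div_greater_zero_iff prime_gt_0_nat)
      ultimately show False using dvd_imp_le[of D D'] by simp
    qed
    then obtain i0 where i0: "i0 \<in> I" "\<not> q i0 dvd D'" by blast
    have "multiplicity p (q i) \<le> multiplicity p D" if "i \<in> I" for i
      using qD[OF that] D0 by (intro dvd_imp_multiplicity_le) auto
    then have m_eq: "multiplicity p (q i) = multiplicity p D" if "i \<in> I" "\<not> q i dvd D'" for i
      using dvd_div_prime_if_multiplicity_less[OF p(1) D0 qD[OF that(1)]] that unfolding D'_def by force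
    have others: "q i dvd D'" if "i \<in> I" "i \<noteq> i0" for i
      using no[OF that(1) i0(1) that(2)] m_eq that i0 by blast
    define g where "g n = (\<Prod>i\<in>I - {i0}. F i (int n))" for n
    have gper: "g (n + D') = g n" for n
      unfolding g_def using Fshift others by (intro prod.cong) auto
    have fg: "f n = g n * F i0 (int n)" for n
      unfolding f_def g_def using prod.remove[OF fin i0(1), of "\<lambda>i. F i (int n)"] by (simp add: mult.commute)
    have zero: "(\<Sum>n<D. g n * ee (of_int a * real n / real (q i0))) = 0" if "coprime a (int (q i0))" for a
      by (rule sum_times_character_eq_0[where g = g, OF q0[OF i0(1)] qD[OF i0(1)] i0(2) D'D that gper])
    have "(\<Sum>n<D. f n) = 0"
    \<comment> \<open>Conjugation only changes the sign of the frequencies, which stay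
      reduced.\<close>
    proof (cases "cj i0")
      case True
      have "(\<Sum>n<D. f n) = (\<Sum>n<D. \<Sum>a\<in>reduced_residues (q i0). cnj (c i0 a) * (g n * ee (of_int (- int a) * real n / real (q i0))))"
        using True by (simp add: fg F_def primitive_poly_def cnj_ee sum_distrib_left mult_ac)
      also have "\<dots> = (\<Sum>a\<in>reduced_residues (q i0). cnj (c i0 a) * (\<Sum>n<D. g n * ee (of_int (- int a) * real n / real (q i0))))"
        unfolding sum_distrib_left by (rule sum.swap)
      also have "\<dots> = 0" by (intro sum.neutral ballI, subst zero) (auto simp: reduced_residues_def)
      finally show ?thesis .
    next
      case False
      have "(\<Sum>n<D. f n) = (\<Sum>n<D. \<Sum>a\<in>reduced_residues (q i0). c i0 a * (g n * ee (of_int (int a) * real n / real (q i0))))"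
        using False by (simp add: fg F_def primitive_poly_def sum_distrib_left mult_ac)
      also have "\<dots> = (\<Sum>a\<in>reduced_residues (q i0). c i0 a * (\<Sum>n<D. g n * ee (of_int (int a) * real n / real (q i0))))"
        unfolding sum_distrib_left by (rule sum.swap)
      also have "\<dots> = 0" by (intro sum.neutral ballI, subst zero) (auto simp: reduced_residues_def)
      finally show ?thesis .
    qed
    then show ?thesis using W0 by simp
  qed
  have "norm (\<Sum>n<X. f n) \<le> real X / real D * norm (\<Sum>n<D. f n) + real D * sqrt W ^ card I"
    by (rule norm_sum_periodic_interval_le[where f = f, OF D0 fper fle])
  also have "\<dots> \<le> real X / real D * sqrt W ^ card I + real D * sqrt W ^ card I"
    using main by (intro add_right_mono mult_left_mono) auto
  finally show ?thesis by (simp add: f_def D_def algebra_simps)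
qed

text \<open>The power is expanded as \<open>g ^ m * cnj g ^ m\<close> over tuples of
  \<open>2 * m\<close> moduli, each treated by the dichotomy above. The incomplete periods cost at
  most \<open>Q ^ (2 * m)\<close> for each of at most \<open>Q ^ (2 * m)\<close> tuples, negligible
  once \<open>X\<close> is a large power of \<open>Q\<close>.\<close>

lemma moment_bound:
  fixes c :: "nat \<Rightarrow> nat \<Rightarrow> complex"
  assumes Q: "1 \<le> Q" and S: "S \<subseteq> {1..Q}" and m: "0 < m" and W0: "0 \<le> W"
    and W: "\<And>q. q \<in> S \<Longrightarrow> (\<Sum>x\<in>{0..<int q}. (norm (primitive_poly (c q) q x))\<^sup>2) \<le> W"
  shows "(\<Sum>n<X. norm (\<Sum>q\<in>S. primitive_poly (c q) q (int n)) ^ (2 * m))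
     \<le> W ^ m * (real X * (1 + ln (real (Q ^ (2 * m)))) ^ (2 ^ (2 * m)) + real Q ^ (4 * m))"
proof -
  define I where "I = {..<2 * m}"
  define g where "g n = (\<Sum>q\<in>S. primitive_poly (c q) q (int n))" for n
  define \<phi> where "\<phi> i z = (if i < m then z else cnj z)" for i :: nat and z
  define P where "P = Pi\<^sub>E I (\<lambda>_. S)"
  have finS: "finite S" using S finite_subset by blast
  have finI: "finite I" and cardI: "card I = 2 * m" by (auto simp: I_def)
  have finP: "finite P" unfolding P_def using finS finI by (intro finite_PiE) auto
  have sub: "P \<subseteq> Pi\<^sub>E I (\<lambda>_. {1..Q})" unfolding P_def using S by (intro PiE_mono)
  have fin2: "finite (Pi\<^sub>E I (\<lambda>_. {1..Q}))" using finI by (intro finite_PiE) auto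
  have gpow: "of_real (norm (g n) ^ (2 * m)) = (\<Sum>p\<in>P. \<Prod>i\<in>I. \<phi> i (primitive_poly (c (p i)) (p i) (int n)))" for n
  proof -
    have "of_real (norm (g n) ^ (2 * m)) = (g n) ^ m * (cnj (g n)) ^ m"
      unfolding power_mult of_real_power complex_norm_square[symmetric, unfolded of_real_power] power_mult_distrib[symmetric] ..
    also have "\<dots> = (\<Prod>i\<in>I. \<phi> i (g n))"
    proof -
      have I: "I = {..<m} \<union> {m..<2*m}" by (auto simp: I_def)
      show ?thesis unfolding I by (subst prod.union_disjoint) (auto simp: \<phi>_def)
    qed
    also have "\<dots> = (\<Prod>i\<in>I. \<Sum>q\<in>S. \<phi> i (primitive_poly (c q) q (int n)))"
      by (intro prod.cong refl) (simp add: \<phi>_def g_def)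
    also have "\<dots> = (\<Sum>p\<in>P. \<Prod>i\<in>I. \<phi> i (primitive_poly (c (p i)) (p i) (int n)))"
      unfolding P_def using finI finS by (intro prod_sum_PiE) auto
    finally show ?thesis .
  qed
  have sqW: "sqrt W ^ card I = W ^ m" using W0 by (simp add: cardI power_mult)
  have each: "norm (\<Sum>n<X. \<Prod>i\<in>I. \<phi> i (primitive_poly (c (p i)) (p i) (int n)))
      \<le> W ^ m * (real X * (1 / real (Lcm (p ` I))) + real Q ^ (2 * m))" if p: "p \<in> P" for p
  proof -
    have pS: "p i \<in> S" if "i \<in> I" for i using p that by (auto simp: P_def)
    have "norm (\<Sum>n<X. \<Prod>i\<in>I. if \<not> i < m then cnj (primitive_poly (c (p i)) (p i) (int n)) else primitive_poly (c (p i)) (p i) (int n))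
       \<le> sqrt W ^ card I * (real X / real (Lcm (p ` I)) + real (Lcm (p ` I)))"
    proof (rule norm_sum_prod_primitive_le[OF finI _ _ W0])
      have "0 \<in> I" using m by (simp add: I_def)
      then show "I \<noteq> {}" by blast
      show "0 < p i" if "i \<in> I" for i using pS[OF that] S by auto
    qed (use W pS in auto)
    also have "(\<Sum>n<X. \<Prod>i\<in>I. if \<not> i < m then cnj (primitive_poly (c (p i)) (p i) (int n)) else primitive_poly (c (p i)) (p i) (int n))
       = (\<Sum>n<X. \<Prod>i\<in>I. \<phi> i (primitive_poly (c (p i)) (p i) (int n)))"
      by (intro sum.cong prod.cong refl) (simp add: \<phi>_def)
    also have "sqrt W ^ card I * (real X / real (Lcm (p ` I)) + real (Lcm (p ` I)))
       \<le> W ^ m * (real X * (1 / real (Lcm (p ` I))) + real Q ^ (2 * m))"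
    proof -
      have "Lcm (p ` I) \<le> Q ^ (2 * m)" using Lcm_image_bounds(2)[OF finI subsetD[OF sub p]] by (simp add: cardI)
      then have "real (Lcm (p ` I)) \<le> real Q ^ (2 * m)" by (metis of_nat_le_iff of_nat_power)
      then show ?thesis unfolding sqW using W0 by (intro mult_left_mono) auto
    qed
    finally show ?thesis .
  qed
  have "(\<Sum>n<X. norm (g n) ^ (2 * m)) = norm (of_real (\<Sum>n<X. norm (g n) ^ (2 * m)) :: complex)"
    unfolding norm_of_real by (rule abs_of_nonneg[symmetric]) (simp add: sum_nonneg)
  also have "of_real (\<Sum>n<X. norm (g n) ^ (2 * m)) = (\<Sum>p\<in>P. \<Sum>n<X. \<Prod>i\<in>I. \<phi> i (primitive_poly (c (p i)) (p i) (int n)))"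
    unfolding of_real_sum gpow by (rule sum.swap)
  also have "norm \<dots> \<le> (\<Sum>p\<in>P. W ^ m * (real X * (1 / real (Lcm (p ` I))) + real Q ^ (2 * m)))"
    by (intro order_trans[OF norm_sum] sum_mono each)
  also have "\<dots> \<le> (\<Sum>p\<in>Pi\<^sub>E I (\<lambda>_. {1..Q}). W ^ m * (real X * (1 / real (Lcm (p ` I))) + real Q ^ (2 * m)))"
    using W0 by (intro sum_mono2[OF fin2 sub]) auto
  also have "\<dots> = W ^ m * (real X * (\<Sum>p\<in>Pi\<^sub>E I (\<lambda>_. {1..Q}). 1 / real (Lcm (p ` I))) + real (card (Pi\<^sub>E I (\<lambda>_. {1..Q}))) * real Q ^ (2 * m))"
    by (simp only: sum_distrib_left[symmetric] sum.distrib sum_constant)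
  also have "card (Pi\<^sub>E I (\<lambda>_. {1..Q})) = Q ^ (2 * m)" using finI by (simp add: card_PiE cardI)
  also have "W ^ m * (real X * (\<Sum>p\<in>Pi\<^sub>E I (\<lambda>_. {1..Q}). 1 / real (Lcm (p ` I))) + real (Q ^ (2 * m)) * real Q ^ (2 * m))
     \<le> W ^ m * (real X * (1 + ln (real (Q ^ (2 * m)))) ^ (2 ^ (2 * m)) + real Q ^ (4 * m))"
  proof (intro mult_left_mono add_mono)
    show "(\<Sum>p\<in>Pi\<^sub>E I (\<lambda>_. {1..Q}). 1 / real (Lcm (p ` I))) \<le> (1 + ln (real (Q ^ (2 * m)))) ^ (2 ^ (2 * m))"
      using sum_inverse_Lcm_le[OF Q finI] unfolding cardI .
    show "real (Q ^ (2 * m)) * real Q ^ (2 * m) \<le> real Q ^ (4 * m)" by (simp flip: power_add)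
  qed (use W0 in auto)
  finally show ?thesis by (simp add: g_def)
qed

section \<open>Density increment\<close>

text \<open>Jensen's inequality for an even power with uniform weights.\<close>

lemma sum_power_mean_le:
  fixes f :: "'a \<Rightarrow> real"
  assumes "finite A" "0 < m"
  shows "(\<Sum>x\<in>A. f x) ^ (2 * m) \<le> real (card A) ^ (2 * m - 1) * (\<Sum>x\<in>A. f x ^ (2 * m))"
proof (cases "A = {}")
  case False
  define n where "n = real (card A)"
  have n: "0 < n" using False assms by (simp add: n_def card_gt_0_iff)
  have "(\<Sum>x\<in>A. (1 / n) *\<^sub>R f x) ^ (2 * m) \<le> (\<Sum>x\<in>A. 1 / n * f x ^ (2 * m))"
    by (rule convex_on_sum[OF assms(1) _ convex_power_even]) (use False n in \<open>auto simp: n_def\<close>)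
  then have "((\<Sum>x\<in>A. f x) / n) ^ (2 * m) \<le> (\<Sum>x\<in>A. f x ^ (2 * m)) / n"
    by (simp add: sum_divide_distrib)
  then have "(\<Sum>x\<in>A. f x) ^ (2 * m) \<le> (\<Sum>x\<in>A. f x ^ (2 * m)) / n * n ^ (2 * m)"
    using n by (simp add: power_divide pos_divide_le_eq)
  also have "n ^ (2 * m) = n ^ (2 * m - 1) * n" using assms(2) by (simp flip: power_Suc2)
  finally show ?thesis using n by (simp add: n_def mult.commute)
qed (use assms in \<open>simp add: zero_power\<close>)

text \<open>Parseval produces a factor \<open>q\<close>, which the Gauss bound \<open>2 / q\<close>
  cancels; what remains is at most twice the energy of the class counts at nonzero frequencies. An
  upper bound \<open>Y\<close> on the counts suffices, because their total is fixed and so the sum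
  of their squares is at most \<open>Y * card B\<close>.\<close>

lemma local_part_norm_squared_le:
  assumes q: "2 \<le> q" and B: "finite B"
    and Y: "\<And>r. r \<in> {0..<int q} \<Longrightarrow> real (card {y\<in>B. y mod int q = r}) \<le> Y"
  shows "(\<Sum>x\<in>{0..<int q}. (norm (local_part B q x))\<^sup>2) \<le> 2 * real (card B) * (real q * Y - real (card B))"
proof -
  define C where "C a = (\<Sum>y\<in>B. ee (real a * of_int y / real q))" for a :: nat
  define y where "y r = real (card {y\<in>B. y mod int q = r})" for r
  have q0: "0 < q" using q by simp
  have C_classes: "C a = (\<Sum>r<q. of_real (y (int r)) * ee (real r * of_int (int a) / real q))" for a
  proof -
    have "C a = (\<Sum>r\<in>{0..<int q}. \<Sum>y\<in>{y\<in>B. y mod int q = r}. ee (real a * of_int y / real q))"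
      unfolding C_def by (rule sum.group[symmetric]) (use q0 B in auto)
    also have "\<dots> = (\<Sum>r\<in>{0..<int q}. of_real (y r) * ee (real a * of_int r / real q))"
    proof (intro sum.cong refl)
      fix r
      have "ee (real a * of_int z / real q) = ee (real a * of_int r / real q)" if "z mod int q = r" for z
      proof (rule ee_eq_intdiff)
        have "of_int z = of_int r + real q * of_int (z div int q)"
          using arg_cong[OF mult_div_mod_eq[of "int q" z], of real_of_int] that by simp
        then show "real a * of_int z / real q - real a * of_int r / real q = of_int (int a * (z div int q))"
          using q0 by (simp add: field_simps)
      qed
      then have "(\<Sum>z\<in>{z\<in>B. z mod int q = r}. ee (real a * of_int z / real q))
          = (\<Sum>z\<in>{z\<in>B. z mod int q = r}. ee (real a * of_int r / real q))"
        by (intro sum.cong) auto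
      then show "(\<Sum>z\<in>{z\<in>B. z mod int q = r}. ee (real a * of_int z / real q)) = of_real (y r) * ee (real a * of_int r / real q)"
        by (simp add: y_def)
    qed
    also have "\<dots> = (\<Sum>r<q. of_real (y (int r)) * ee (real r * of_int (int a) / real q))"
      by (rule sum.reindex_bij_witness[of _ int nat]) (auto simp: mult.commute)
    finally show ?thesis .
  qed
  have cardB: "real (card B) = (\<Sum>r<q. y (int r))"
  proof -
    have "real (card B) = (\<Sum>z\<in>B. 1)" by simp
    also have "\<dots> = (\<Sum>r\<in>{0..<int q}. \<Sum>z\<in>{z\<in>B. z mod int q = r}. 1)"
      by (rule sum.group[symmetric]) (use q0 B in auto)
    also have "\<dots> = (\<Sum>r<q. y (int r))"
      by (rule sum.reindex_bij_witness[of _ int nat]) (auto simp: y_def)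
    finally show ?thesis .
  qed
  have yY: "y (int r) \<le> Y" if "r < q" for r using Y[of "int r"] that by (simp add: y_def)
  have plancherel: "(\<Sum>a<q. (norm (C a))\<^sup>2) = real q * (\<Sum>r<q. (y (int r))\<^sup>2)"
  proof -
    have "of_real (\<Sum>a<q. (norm (C a))\<^sup>2) = (\<Sum>a<q. \<Sum>r<q. \<Sum>s<q. of_real (y (int r) * y (int s)) * ee (real a * of_int (int r - int s) / real q))"
      unfolding of_real_sum complex_norm_square C_classes cnj_sum sum_product
    proof (intro sum.cong refl)
      fix a r s
      have "ee (real r * of_int (int a) / real q) * cnj (ee (real s * of_int (int a) / real q)) = ee (real a * of_int (int r - int s) / real q)"
        unfolding cnj_ee ee_add[symmetric]
        by (intro arg_cong[of _ _ ee]) (use q0 in \<open>simp add: field_simps\<close>)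
      then show "of_real (y (int r)) * ee (real r * of_int (int a) / real q) * cnj (of_real (y (int s)) * ee (real s * of_int (int a) / real q))
        = of_real (y (int r) * y (int s)) * ee (real a * of_int (int r - int s) / real q)"
        by (simp add: mult_ac)
    qed
    also have "\<dots> = (\<Sum>r<q. \<Sum>a<q. \<Sum>s<q. of_real (y (int r) * y (int s)) * ee (real a * of_int (int r - int s) / real q))"
      by (rule sum.swap)
    also have "\<dots> = (\<Sum>r<q. \<Sum>s<q. of_real (y (int r) * y (int s)) * (\<Sum>a<q. ee (real a * of_int (int r - int s) / real q)))"
      unfolding sum_distrib_left by (intro sum.cong refl sum.swap)
    also have "\<dots> = (\<Sum>r<q. \<Sum>s<q. if s = r then of_real (real q * (y (int r))\<^sup>2) else 0)"
    proof (intro sum.cong refl)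
      fix r s assume rs: "r \<in> {..<q}" "s \<in> {..<q}"
      have "int q dvd int r - int s \<longleftrightarrow> s = r" using rs by (auto simp: mod_eq_dvd_iff[symmetric])
      then show "of_real (y (int r) * y (int s)) * (\<Sum>a<q. ee (real a * of_int (int r - int s) / real q))
        = (if s = r then of_real (real q * (y (int r))\<^sup>2) else 0)"
        unfolding sum_ee_roots[OF q0] by (simp add: power2_eq_square)
    qed
    also have "\<dots> = of_real (real q * (\<Sum>r<q. (y (int r))\<^sup>2))" by (simp add: sum_distrib_left)
    finally show ?thesis by (simp only: of_real_eq_iff)
  qed
  have squares: "(\<Sum>r<q. (y (int r))\<^sup>2) \<le> Y * real (card B)"
  proof -
    have "(\<Sum>r<q. (y (int r))\<^sup>2) \<le> (\<Sum>r<q. Y * y (int r))"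
      unfolding power2_eq_square using yY by (intro sum_mono mult_right_mono) (auto simp: y_def)
    then show ?thesis by (simp add: cardB sum_distrib_left)
  qed
  have "local_part B q x = primitive_poly (\<lambda>a. gauss a q * cnj (C a)) q x" for x
    by (simp add: local_part_def primitive_poly_def C_def cnj_ee)
  then have "(\<Sum>x\<in>{0..<int q}. (norm (local_part B q x))\<^sup>2) = real q * (\<Sum>a\<in>reduced_residues q. (norm (gauss a q * cnj (C a)))\<^sup>2)"
    using primitive_poly_norm_squared[OF q0] by simp
  also have "\<dots> \<le> real q * (\<Sum>a\<in>reduced_residues q. 2 / real q * (norm (C a))\<^sup>2)"
  proof (intro mult_left_mono sum_mono)
    fix a assume "a \<in> reduced_residues q"
    then have "(norm (gauss a q))\<^sup>2 \<le> 2 / real q" by (intro norm_gauss_squared_le q0) (simp add: reduced_residues_def)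
    then have "(norm (gauss a q))\<^sup>2 * (norm (C a))\<^sup>2 \<le> 2 / real q * (norm (C a))\<^sup>2"
      by (rule mult_right_mono) simp
    then show "(norm (gauss a q * cnj (C a)))\<^sup>2 \<le> 2 / real q * (norm (C a))\<^sup>2"
      by (simp only: norm_mult power_mult_distrib complex_mod_cnj)
  qed auto
  also have "\<dots> = 2 * (\<Sum>a\<in>reduced_residues q. (norm (C a))\<^sup>2)" unfolding sum_distrib_left[symmetric] using q0 by simp
  \<comment> \<open>As \<open>2 \<le> q\<close>, the residue 0 is not reduced; leaving out its
    contribution \<open>(card B)\<^sup>2\<close> creates the cancellation.\<close>
  also have "(\<Sum>a\<in>reduced_residues q. (norm (C a))\<^sup>2) \<le> (\<Sum>a\<in>{..<q} - {0}. (norm (C a))\<^sup>2)"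
    using q by (intro sum_mono2) (auto simp: reduced_residues_def)
  also have "\<dots> = real q * (\<Sum>r<q. (y (int r))\<^sup>2) - (real (card B))\<^sup>2"
  proof -
    have "norm (C 0) = real (card B)" by (simp add: C_def)
    then show ?thesis using plancherel sum.remove[of "{..<q}" 0 "\<lambda>a. (norm (C a))\<^sup>2"] q0 by simp
  qed
  also have "\<dots> \<le> real q * (Y * real (card B)) - (real (card B))\<^sup>2"
    using squares by (intro diff_right_mono mult_left_mono) auto
  finally show ?thesis by (simp add: power2_eq_square algebra_simps)
qed

definition square_difference_free :: "int set \<Rightarrow> bool" where
  "square_difference_free A \<longleftrightarrow> \<not> (\<exists>a\<in>A. \<exists>b\<in>A. \<exists>n\<ge>1. a - b = n ^ 2)"

text \<open>A class modulo \<open>q\<close> splits into \<open>q\<close> classes modulo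
  \<open>q\<^sup>2\<close>, which are progressions of square difference and so fall under the
  density hypothesis. All get the same rounded-up length \<open>Y div q\<^sup>2 + 1\<close>, which
  costs the summand \<open>\<rho> * q\<close>.\<close>

lemma card_residue_class_le:
  fixes A :: "int set"
  assumes q: "0 < q"
    and dens: "\<And>s. real (card {j\<in>{1..int (Y div q\<^sup>2 + 1)}. s + int (q\<^sup>2) * j \<in> A}) \<le> \<rho> * real (Y div q\<^sup>2 + 1)"
    and \<rho>: "0 \<le> \<rho>"
  shows "real (card {y\<in>A \<inter> {X<..X + int Y}. y mod int q = r}) \<le> \<rho> * (real Y / real q + real q)"
proof -
  define L where "L = Y div q\<^sup>2 + 1"
  \<comment> \<open>The term at \<open>j = 1\<close>, \<open>s t + q\<^sup>2\<close>, is the least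
    integer from \<open>X\<close> on that is congruent to \<open>r + q * t\<close> modulo
    \<open>q\<^sup>2\<close>.\<close>
  define s where "s t = X - int (q\<^sup>2) + (r + int q * int t - X) mod int (q\<^sup>2)" for t :: nat
  have q2: "0 < int (q\<^sup>2)" using q by simp
  have cover: "{y\<in>A \<inter> {X<..X + int Y}. y mod int q = r} 
      \<subseteq> (\<Union>t<q. (\<lambda>j. s t + int (q\<^sup>2) * j) ` {j\<in>{1..int L}. s t + int (q\<^sup>2) * j \<in> A})"
  proof
    fix y assume "y \<in> {y\<in>A \<inter> {X<..X + int Y}. y mod int q = r}"
    then have y: "y \<in> A" "X < y" "y \<le> X + int Y" "y mod int q = r" by auto
    define t where "t = nat ((y div int q) mod int q)"
    have tq: "t < q" "int t = (y div int q) mod int q" using q by (auto simp: t_def nat_less_iff)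
    define u where "u = y div int q"
    define w where "w = u div int q"
    have yu: "y = r + int q * u" using mult_div_mod_eq[of "int q" y] y(4) unfolding u_def by linarith
    have uw: "u = int q * w + int t" using mult_div_mod_eq[of "int q" u] unfolding w_def tq(2) u_def by linarith
    have yt: "y = r + int q * int t + int (q\<^sup>2) * w"
      unfolding yu uw by (simp add: ring_distribs power2_eq_square)
    have "y mod int (q\<^sup>2) = (r + int q * int t) mod int (q\<^sup>2)"
      using arg_cong[OF yt, of "\<lambda>z. z mod int (q\<^sup>2)"] by (simp only: mod_mult_self2)
    then have md: "(y - X) mod int (q\<^sup>2) = (r + int q * int t - X) mod int (q\<^sup>2)" by (rule mod_diff_cong[OF _ refl])
    define j where "j = (y - X) div int (q\<^sup>2) + 1"
    have "y - X = int (q\<^sup>2) * ((y - X) div int (q\<^sup>2)) + (y - X) mod int (q\<^sup>2)" by simp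
    then have yj: "y = s t + int (q\<^sup>2) * j" unfolding j_def s_def md by (simp add: algebra_simps)
    have "0 \<le> (y - X) div int (q\<^sup>2)" using y q2 by (simp add: pos_imp_zdiv_nonneg_iff)
    moreover have "(y - X) div int (q\<^sup>2) \<le> int Y div int (q\<^sup>2)" using y q2 by (intro zdiv_mono1) auto
    then have "(y - X) div int (q\<^sup>2) \<le> int (Y div q\<^sup>2)" by (simp only: zdiv_int)
    ultimately have "j \<in> {1..int L}" unfolding j_def L_def by auto
    then show "y \<in> (\<Union>t<q. (\<lambda>j. s t + int (q\<^sup>2) * j) ` {j\<in>{1..int L}. s t + int (q\<^sup>2) * j \<in> A})"
      using tq(1) yj y(1) by blast
  qed
  have finj: "finite {j\<in>{1..int L}. s t + int (q\<^sup>2) * j \<in> A}" for t by (rule finite_subset[of _ "{1..int L}"]) auto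
  have "card {y\<in>A \<inter> {X<..X + int Y}. y mod int q = r}
      \<le> card (\<Union>t<q. (\<lambda>j. s t + int (q\<^sup>2) * j) ` {j\<in>{1..int L}. s t + int (q\<^sup>2) * j \<in> A})"
    using finj by (intro card_mono[OF _ cover]) blast
  also have "\<dots> \<le> (\<Sum>t<q. card ((\<lambda>j. s t + int (q\<^sup>2) * j) ` {j\<in>{1..int L}. s t + int (q\<^sup>2) * j \<in> A}))"
    by (rule card_UN_le) simp
  also have "\<dots> \<le> (\<Sum>t<q. card {j\<in>{1..int L}. s t + int (q\<^sup>2) * j \<in> A})"
    using finj by (intro sum_mono card_image_le) blast
  finally have "real (card {y\<in>A \<inter> {X<..X + int Y}. y mod int q = r})
      \<le> real (\<Sum>t<q. card {j\<in>{1..int L}. s t + int (q\<^sup>2) * j \<in> A})" by (rule of_nat_mono)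
  also have "\<dots> = (\<Sum>t<q. real (card {j\<in>{1..int L}. s t + int (q\<^sup>2) * j \<in> A}))" by (rule of_nat_sum)
  also have "\<dots> \<le> (\<Sum>t<q. \<rho> * real L)" unfolding L_def by (intro sum_mono dens)
  also have "\<dots> = \<rho> * (real q * real L)" by simp
  also have "\<dots> \<le> \<rho> * (real q * (real Y / real (q\<^sup>2) + 1))"
    unfolding L_def of_nat_add using \<rho> of_nat_div_le_of_nat[of Y "q\<^sup>2", where 'a = real] by (intro mult_left_mono) auto
  also have "real q * (real Y / real (q\<^sup>2) + 1) = real Y / real q + real q"
    using q by (simp add: power2_eq_square ring_distribs)
  finally show ?thesis .
qed

lemma obtain_square_between:
  assumes "9 \<le> N"
  obtains R :: nat where "real N \<le> (real R)\<^sup>2" "(real R)\<^sup>2 \<le> 2 * real N" "sqrt (real N) \<le> real R"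
proof -
  define w where "w = sqrt (real N)"
  have "sqrt (3\<^sup>2) \<le> w" unfolding w_def using assms by (intro real_sqrt_le_mono) simp
  then have w: "3 \<le> w" by simp
  have ww: "w\<^sup>2 = real N" by (simp add: w_def)
  define R where "R = nat \<lceil>w\<rceil>"
  have R: "w \<le> real R" "real R \<le> w + 1" unfolding R_def using w by linarith+
  have "w\<^sup>2 \<le> (real R)\<^sup>2" using R w by (intro power_mono) auto
  moreover have "(real R)\<^sup>2 \<le> (w + 1)\<^sup>2" using R by (intro power_mono) auto
  moreover have "(w + 1)\<^sup>2 \<le> 2 * w\<^sup>2"
  proof -
    have "3 * w \<le> w * w" using w by (intro mult_right_mono) auto
    moreover have "(w + 1)\<^sup>2 = w * w + 2 * w + 1" "2 * w\<^sup>2 = 2 * (w * w)"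
      by (simp_all add: power2_eq_square algebra_simps)
    ultimately show ?thesis using w by linarith
  qed
  ultimately have "real N \<le> (real R)\<^sup>2" "(real R)\<^sup>2 \<le> 2 * real N" using ww by linarith+
  then show ?thesis using that[of R] R(1) unfolding w_def by blast
qed

text \<open>The loss \<open>4 * P ^ 8\<close> in length reflects \<open>q \<le> P ^ 4\<close>, the
  moduli in the model for error \<open>1 / P\<close>. The condition \<open>key\<close> says that
  without an increment the upper bound for the moment would fall below the lower one.\<close>

lemma density_increment:
  fixes A :: "int set" and N P m :: nat and \<alpha> \<nu> :: real
  assumes sf: "square_difference_free A" and AN: "A \<subseteq> {1..int N}" and dens: "\<alpha> * real N \<le> real (card A)"
    and \<alpha>: "0 < \<alpha>" and \<nu>: "0 < \<nu>" "\<nu> \<le> 1 / 8" and m: "0 < m"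
    and P: "1000 \<le> P" "24 \<le> \<alpha> * real P"
    and N: "P ^ 40 \<le> N" "4 * P ^ (16 * m) \<le> N" "8 * real P ^ 8 \<le> \<nu> * real N"
    and key: "(32 * \<nu>) ^ m * (2 * (1 + ln (real ((P ^ 4) ^ (2 * m)))) ^ (2 ^ (2 * m)) + 1) < \<alpha> / 2"
  shows "\<exists>q s L. 1 \<le> q \<and> N \<le> 4 * P ^ 8 * L \<and>
      (1 + \<nu>) * \<alpha> * real L < real (card {j\<in>{1..int L}. s + int (q\<^sup>2) * j \<in> A})"
proof (rule ccontr)
  assume "\<not> ?thesis"
  then have no: "real (card {j\<in>{1..int L}. s + int (q\<^sup>2) * j \<in> A}) \<le> (1 + \<nu>) * \<alpha> * real L"
    if "1 \<le> q" "N \<le> 4 * P ^ 8 * L" for q s L using that not_less by blast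
  define \<rho> where "\<rho> = (1 + \<nu>) * \<alpha>"
  have \<rho>0: "0 \<le> \<rho>" using \<alpha> \<nu> by (simp add: \<rho>_def)
  define X where "X = N div 2"
  define Y where "Y = N - X"
  have "1000 \<le> P ^ 40" using P(1) self_le_power[of P 40] by simp
  then have N1000: "1000 \<le> N" using N(1) by simp
  have XY: "X + Y = N" "X \<le> Y" "Y \<le> X + 1" unfolding X_def Y_def by linarith+
  have X: "100 \<le> X" using N1000 unfolding X_def by linarith
  have P8: "1 \<le> P ^ 8" using P(1) by simp
  have big: "N \<le> 4 * P ^ 8 * L" if "N \<le> 4 * L" for L
  proof -
    have "1 * (4 * L) \<le> P ^ 8 * (4 * L)" by (rule mult_le_mono1[OF P8])
    then have "4 * L \<le> 4 * P ^ 8 * L" by (simp only: mult_ac mult_1_right)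
    then show ?thesis using that by (rule order_trans[rotated])
  qed
  \<comment> \<open>With \<open>A1\<close> to the left of \<open>A2\<close> every difference
    \<open>y - x\<close> is positive, as the Fourier argument requires.\<close>
  define A1 where "A1 = A \<inter> {0<..int X}"
  define A2 where "A2 = A \<inter> {int X<..int X + int Y}"
  define n1 where "n1 = real (card A1)"
  define n2 where "n2 = real (card A2)"
  have finA: "finite A" using AN finite_subset by blast
  have fin: "finite A1" "finite A2" using finA by (auto simp: A1_def A2_def)
  have "A = A1 \<union> A2" using AN XY by (auto simp: A1_def A2_def)
  moreover have "A1 \<inter> A2 = {}" by (auto simp: A1_def A2_def)
  ultimately have "card A = card A1 + card A2" using fin by (metis card_Un_disjoint)
  then have n12: "\<alpha> * (real X + real Y) \<le> n1 + n2" using dens XY(1) by (simp add: n1_def n2_def flip: of_nat_add)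
  have n1_le: "n1 \<le> \<rho> * real X"
  proof -
    have "A1 = {j\<in>{1..int X}. 0 + int (1\<^sup>2) * j \<in> A}" by (auto simp: A1_def)
    moreover have "N \<le> 4 * P ^ 8 * X" using XY X by (intro big) linarith
    ultimately show ?thesis using no[of 1 X 0] unfolding n1_def \<rho>_def by simp
  qed
  have n2_le: "n2 \<le> \<rho> * real Y"
  proof -
    have "A2 \<subseteq> (\<lambda>j. int X + j) ` {j\<in>{1..int Y}. int X + int (1\<^sup>2) * j \<in> A}"
    proof
      fix y assume "y \<in> A2"
      then show "y \<in> (\<lambda>j. int X + j) ` {j\<in>{1..int Y}. int X + int (1\<^sup>2) * j \<in> A}"
        by (intro image_eqI[of _ _ "y - int X"]) (auto simp: A2_def)
    qed
    moreover have fin': "finite {j\<in>{1..int Y}. int X + int (1\<^sup>2) * j \<in> A}" by (rule finite_subset[of _ "{1..int Y}"]) auto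
    ultimately have "card A2 \<le> card {j\<in>{1..int Y}. int X + int (1\<^sup>2) * j \<in> A}"
      by (meson card_image_le card_mono finite_imageI order_trans)
    moreover have "N \<le> 4 * P ^ 8 * Y" using XY by (intro big) linarith
    ultimately show ?thesis using no[of 1 Y "int X"] unfolding n2_def \<rho>_def by linarith
  qed
  have rXY: "real X \<le> real Y" "real Y \<le> real X + 1" "100 \<le> real X" "real X + real Y = real N"
    using XY X by linarith+
  have \<nu>\<alpha>: "\<nu> * \<alpha> \<le> \<alpha> / 8" using \<nu> \<alpha> mult_right_mono[of \<nu> "1/8" \<alpha>] by simp
  \<comment> \<open>The total is at least \<open>\<alpha> * N\<close>, so the upper bound for one
    half is a lower bound for the other.\<close>
  have n1_ge: "3 / 4 * \<alpha> * real X \<le> n1"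
  proof -
    have "n1 \<ge> \<alpha> * real X - \<nu> * \<alpha> * real Y" using n12 n2_le unfolding \<rho>_def by (simp add: algebra_simps)
    moreover have "\<nu> * \<alpha> * real Y \<le> \<alpha> / 8 * (2 * real X)" using \<nu>\<alpha> rXY \<alpha> \<nu> by (intro mult_mono) auto
    ultimately show ?thesis by (simp add: algebra_simps)
  qed
  have n2_ge: "(1 - \<nu>) * \<alpha> * real Y \<le> n2"
  proof -
    have "n2 \<ge> \<alpha> * real Y - \<nu> * \<alpha> * real X" using n12 n1_le unfolding \<rho>_def by (simp add: algebra_simps)
    moreover have "\<nu> * \<alpha> * real X \<le> \<nu> * \<alpha> * real Y" using rXY \<alpha> \<nu> by (intro mult_left_mono) auto
    ultimately show ?thesis by (simp add: algebra_simps)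
  qed
  have N3: "real N \<le> 3 * real X" using rXY by linarith
  have n1_ge': "\<alpha> * real N / 6 \<le> n1"
  proof -
    have "\<alpha> * real N / 6 \<le> \<alpha> * (3 * real X) / 6" using N3 \<alpha> by (intro divide_right_mono mult_left_mono) auto
    also have "\<dots> \<le> 3 / 4 * \<alpha> * real X" using \<alpha> by simp
    finally show ?thesis using n1_ge by linarith
  qed
  have n2_ge': "\<alpha> * real N / 6 \<le> n2"
  proof -
    have "\<alpha> * real N / 6 \<le> \<alpha> * (3 * real Y) / 6" using N3 rXY \<alpha> by (intro divide_right_mono mult_left_mono) auto
    also have "\<dots> = 1 / 2 * (\<alpha> * real Y)" by simp
    also have "\<dots> \<le> (1 - \<nu>) * (\<alpha> * real Y)" using \<alpha> \<nu> by (intro mult_right_mono) auto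
    finally show ?thesis using n2_ge by (simp add: mult.assoc)
  qed
  have \<alpha>N: "0 < \<alpha> * real N" using \<alpha> N1000 by simp
  have n0: "0 < n1" "0 < n2" using n1_ge' n2_ge' \<alpha>N by linarith+
  obtain R :: nat where R: "real N \<le> (real R)\<^sup>2" "(real R)\<^sup>2 \<le> 2 * real N" "sqrt (real N) \<le> real R"
    using obtain_square_between[of N] N1000 by auto
  have RN: "N \<le> R\<^sup>2" using R(1) by (metis of_nat_le_iff of_nat_power)
  have PR: "P ^ 20 \<le> R"
  proof -
    have "real P ^ 40 \<le> real N" using N(1) by (metis of_nat_le_iff of_nat_power)
    then have "(real P ^ 20)\<^sup>2 \<le> real N" by (simp flip: power_mult)
    then have "real P ^ 20 \<le> sqrt (real N)" by (rule real_le_rsqrt)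
    then have "real P ^ 20 \<le> real R" using R(3) by linarith
    then show ?thesis by (metis of_nat_le_iff of_nat_power)
  qed
  define G where "G x = (\<Sum>q\<in>{2..P ^ 4}. local_part A2 q x)" for x
  have lower: "n1 * n2 / 2 \<le> norm (\<Sum>x\<in>A1. G x)"
  proof -
    define s where "s = sqrt (n1 * n2)"
    have ss: "s * s = n1 * n2" using n0 by (simp add: s_def)
    have "(\<alpha> * real N / 6)\<^sup>2 \<le> n1 * n2"
      unfolding power2_eq_square using n1_ge' n2_ge' \<alpha>N n0 by (intro mult_mono) auto
    then have s_ge: "\<alpha> * real N / 6 \<le> s" unfolding s_def by (rule real_le_rsqrt)
    have "n1 * n2 - (real R)\<^sup>2 / real P * s \<le> norm (\<Sum>x\<in>A1. G x)"
      unfolding n1_def n2_def G_def s_def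
    proof (rule sum_local_part_ge[OF P(1) PR fin])
      have NR: "int N \<le> int (R\<^sup>2)" using RN by (simp only: of_nat_le_iff)
      have XYi: "int X + int Y = int N" using XY by simp
      show "\<bar>x - y\<bar> \<le> int (R\<^sup>2)" if "x \<in> A1" "y \<in> A1" for x y
      proof -
        have "0 < x" "x \<le> int X" "0 < y" "y \<le> int X" using that by (auto simp: A1_def)
        then show ?thesis using NR XYi by linarith
      qed
      show "\<bar>x - y\<bar> \<le> int (R\<^sup>2)" if "x \<in> A2" "y \<in> A2" for x y
      proof -
        have "int X < x" "x \<le> int X + int Y" "int X < y" "y \<le> int X + int Y" using that by (auto simp: A2_def)
        then show ?thesis using NR XYi by linarith
      qed
      show "1 \<le> y - x \<and> y - x \<le> int (R\<^sup>2)" if "x \<in> A1" "y \<in> A2" for x y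
      proof -
        have "0 < x" "x \<le> int X" "int X < y" "y \<le> int X + int Y" using that by (auto simp: A1_def A2_def)
        then show ?thesis using NR XYi by linarith
      qed
      show "y - x \<noteq> n\<^sup>2" if "x \<in> A1" "y \<in> A2" "1 \<le> n" for x y n
        using sf that unfolding square_difference_free_def A1_def A2_def by blast
    qed
    \<comment> \<open>\<open>R\<^sup>2 \<le> 2 * N\<close> and \<open>24 \<le> \<alpha> * P\<close>
      bound the model error by \<open>\<alpha> * N / 12\<close>, half of the lower bound for
      \<open>s\<close>. So it consumes at most half of the main term.\<close>
    moreover have "(real R)\<^sup>2 / real P * s \<le> s / 2 * s"
    proof (rule mult_right_mono)
      have "(real R)\<^sup>2 / real P \<le> 2 * real N / real P" using R(2) by (intro divide_right_mono) auto
      also have "\<dots> \<le> \<alpha> * real N / 12"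
      proof -
        have "24 * real N \<le> \<alpha> * real P * real N" using P(2) by (intro mult_right_mono) auto
        then show ?thesis using P(1) by (simp add: field_simps)
      qed
      also have "\<dots> \<le> s / 2" using s_ge by simp
      finally show "(real R)\<^sup>2 / real P \<le> s / 2" .
    qed (use n0 in \<open>simp add: s_def\<close>)
    ultimately show ?thesis using ss by simp
  qed
  \<comment> \<open>\<open>q\<close> times the class bound exceeds \<open>n2\<close> by at most
    \<open>4 * \<nu> * n2\<close>, and the \<open>L\<^sup>2\<close> estimate multiplies this excess
    by \<open>2 * n2\<close>.\<close>
  define W where "W = 8 * \<nu> * n2\<^sup>2"
  have W0: "0 \<le> W" using \<nu> by (simp add: W_def)
  have W_bound: "(\<Sum>x\<in>{0..<int q}. (norm (local_part A2 q x))\<^sup>2) \<le> W" if q: "q \<in> {2..P ^ 4}" for q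
  proof -
    have "q\<^sup>2 \<le> (P ^ 4)\<^sup>2" using q by (intro power_mono) auto
    then have q8: "q\<^sup>2 \<le> P ^ 8" by (simp flip: power_mult)
    have q0: "0 < q" using q by simp
    have classes: "real (card {y\<in>A2. y mod int q = r}) \<le> \<rho> * (real Y / real q + real q)" for r
      unfolding A2_def
    proof (rule card_residue_class_le[OF q0 _ \<rho>0])
      fix s
      have "Y < q\<^sup>2 * (Y div q\<^sup>2 + 1)" using q0 dividend_less_div_times[of "q\<^sup>2" Y] by (simp add: algebra_simps)
      also have "\<dots> \<le> P ^ 8 * (Y div q\<^sup>2 + 1)" by (rule mult_le_mono1[OF q8])
      finally have "Y \<le> P ^ 8 * (Y div q\<^sup>2 + 1)" by simp
      then have "N \<le> 4 * (P ^ 8 * (Y div q\<^sup>2 + 1))" using XY by linarith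
      then show "real (card {j\<in>{1..int (Y div q\<^sup>2 + 1)}. s + int (q\<^sup>2) * j \<in> A}) \<le> \<rho> * real (Y div q\<^sup>2 + 1)"
        unfolding \<rho>_def using q0 by (intro no) (auto simp: mult.assoc)
    qed
    have "(\<Sum>x\<in>{0..<int q}. (norm (local_part A2 q x))\<^sup>2)
       \<le> 2 * n2 * (real q * (\<rho> * (real Y / real q + real q)) - n2)"
      unfolding n2_def by (rule local_part_norm_squared_le[OF _ fin(2) classes]) (use q in simp)
    also have "real q * (\<rho> * (real Y / real q + real q)) = \<rho> * (real Y + (real q)\<^sup>2)"
      using q0 by (simp add: field_simps power2_eq_square)
    also have "2 * n2 * (\<rho> * (real Y + (real q)\<^sup>2) - n2) \<le> 2 * n2 * (4 * \<nu> * n2)"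
    proof (rule mult_left_mono)
      \<comment> \<open>The rounding term \<open>q\<^sup>2\<close> is absorbed into a factor
        \<open>1 + \<nu> / 4\<close> through \<open>8 * P ^ 8 \<le> \<nu> * N\<close>.\<close>
      have "(real q)\<^sup>2 \<le> real P ^ 8" using q8 by (metis of_nat_le_iff of_nat_power)
      also have "\<dots> \<le> \<nu> * real N / 8" using N(3) by simp
      also have "\<dots> \<le> \<nu> * (2 * real Y) / 8" using rXY \<nu> by (intro divide_right_mono mult_left_mono) auto
      finally have "real Y + (real q)\<^sup>2 \<le> (1 + \<nu> / 4) * real Y" by (simp add: algebra_simps)
      then have "\<rho> * (real Y + (real q)\<^sup>2) \<le> \<rho> * ((1 + \<nu> / 4) * real Y)" by (intro mult_left_mono \<rho>0)
      also have "\<dots> = ((1 + \<nu>) * (1 + \<nu> / 4)) * (\<alpha> * real Y)" by (simp add: \<rho>_def)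
      also have "\<dots> \<le> ((1 + 4 * \<nu>) * (1 - \<nu>)) * (\<alpha> * real Y)"
      proof (rule mult_right_mono)
        have "\<nu> * \<nu> \<le> 1 / 8 * \<nu>" using \<nu> by (intro mult_right_mono) auto
        moreover have "(1 + \<nu>) * (1 + \<nu> / 4) = 1 + 5 / 4 * \<nu> + \<nu> * \<nu> / 4"
          "(1 + 4 * \<nu>) * (1 - \<nu>) = 1 + 3 * \<nu> - 4 * (\<nu> * \<nu>)"
          by (simp_all add: field_simps)
        ultimately show "(1 + \<nu>) * (1 + \<nu> / 4) \<le> (1 + 4 * \<nu>) * (1 - \<nu>)" using \<nu> by linarith
      qed (use \<alpha> in simp)
      also have "\<dots> = (1 + 4 * \<nu>) * ((1 - \<nu>) * \<alpha> * real Y)" by simp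
      also have "\<dots> \<le> (1 + 4 * \<nu>) * n2" using n2_ge \<nu> by (intro mult_left_mono) auto
      finally show "\<rho> * (real Y + (real q)\<^sup>2) - n2 \<le> 4 * \<nu> * n2" by (simp add: algebra_simps)
    qed (use n0 in simp)
    finally show ?thesis by (simp add: W_def power2_eq_square mult_ac)
  qed
  define loss where "loss = (1 + ln (real ((P ^ 4) ^ (2 * m)))) ^ (2 ^ (2 * m))"
  have P1: "1 \<le> P ^ 4" using P(1) by simp
  have loss0: "0 \<le> loss" unfolding loss_def using P(1) by (intro zero_le_power add_nonneg_nonneg ln_ge_zero) (auto simp: one_le_power)
  have upper: "(\<Sum>x\<in>A1. norm (G x) ^ (2 * m)) \<le> W ^ m * (real (Suc X) * loss + real P ^ (16 * m))"
  proof -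
    define c where "c q a = gauss a q * (\<Sum>y\<in>A2. ee (- (real a * of_int y / real q)))" for q a
    have lp: "local_part A2 q x = primitive_poly (c q) q x" for q x
      by (simp add: local_part_def primitive_poly_def c_def)
    have "(\<Sum>x\<in>A1. norm (G x) ^ (2 * m)) \<le> (\<Sum>x\<in>int ` {..<Suc X}. norm (G x) ^ (2 * m))"
    proof (rule sum_mono2)
      show "A1 \<subseteq> int ` {..<Suc X}"
      proof
        fix x assume "x \<in> A1"
        then show "x \<in> int ` {..<Suc X}" by (intro image_eqI[of _ _ "nat x"]) (auto simp: A1_def)
      qed
    qed auto
    also have "\<dots> = (\<Sum>n<Suc X. norm (G (int n)) ^ (2 * m))" by (simp add: sum.reindex)
    also have "\<dots> \<le> W ^ m * (real (Suc X) * (1 + ln (real ((P ^ 4) ^ (2 * m)))) ^ (2 ^ (2 * m)) + real (P ^ 4) ^ (4 * m))"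
      unfolding G_def lp by (rule moment_bound[OF P1 _ m W0]) (use W_bound in \<open>auto simp: lp\<close>)
    also have "real (P ^ 4) ^ (4 * m) = real P ^ (16 * m)" by (simp flip: power_mult)
    finally show ?thesis by (simp add: loss_def)
  qed
  \<comment> \<open>Lower bound against moment: the factor
    \<open>n1 ^ (2 * m - 1) * n2 ^ (2 * m)\<close> cancels, and the 2 in the denominator costs
    \<open>4 ^ m\<close>, which turns \<open>8 * \<nu>\<close> into
    \<open>32 * \<nu>\<close>.\<close>
  have "(n1 * n2 / 2) ^ (2 * m) \<le> (\<Sum>x\<in>A1. norm (G x)) ^ (2 * m)"
    using order_trans[OF lower norm_sum] n0 by (intro power_mono) auto
  also have "\<dots> \<le> n1 ^ (2 * m - 1) * (\<Sum>x\<in>A1. norm (G x) ^ (2 * m))"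
    unfolding n1_def by (rule sum_power_mean_le[OF fin(1) m])
  also have "\<dots> \<le> n1 ^ (2 * m - 1) * (W ^ m * (real (Suc X) * loss + real P ^ (16 * m)))"
    using upper n0 by (intro mult_left_mono) auto
  also have "W ^ m = (8 * \<nu>) ^ m * n2 ^ (2 * m)" unfolding W_def by (simp only: power_mult_distrib power_mult)
  also have "(n1 * n2 / 2) ^ (2 * m) = n1 ^ (2 * m - 1) * n2 ^ (2 * m) * (n1 / 4 ^ m)"
  proof -
    have "(n1 * n2 / 2) ^ (2 * m) = n1 ^ (2 * m) * n2 ^ (2 * m) / 2 ^ (2 * m)" by (simp only: power_divide power_mult_distrib)
    also have "n1 ^ (2 * m) = n1 ^ (2 * m - 1) * n1" using m by (simp flip: power_Suc2)
    also have "(2::real) ^ (2 * m) = 4 ^ m" by (simp add: power_mult)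
    finally show ?thesis by simp
  qed
  finally have "(n1 ^ (2 * m - 1) * n2 ^ (2 * m)) * (n1 / 4 ^ m)
     \<le> (n1 ^ (2 * m - 1) * n2 ^ (2 * m)) * ((8 * \<nu>) ^ m * (real (Suc X) * loss + real P ^ (16 * m)))"
    by (simp only: mult_ac)
  then have "n1 / 4 ^ m \<le> (8 * \<nu>) ^ m * (real (Suc X) * loss + real P ^ (16 * m))"
    by (rule mult_left_le_imp_le) (use n0 in simp)
  then have "n1 \<le> (8 * \<nu>) ^ m * (real (Suc X) * loss + real P ^ (16 * m)) * 4 ^ m"
    by (subst (asm) pos_divide_le_eq) simp_all
  also have "\<dots> = (8 * \<nu> * 4) ^ m * (real (Suc X) * loss + real P ^ (16 * m))"
    unfolding power_mult_distrib[of "8 * \<nu>" 4 m] by (simp only: mult_ac)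
  also have "8 * \<nu> * 4 = 32 * \<nu>" by simp
  also have "(32 * \<nu>) ^ m * (real (Suc X) * loss + real P ^ (16 * m)) \<le> (32 * \<nu>) ^ m * (2 * real X * loss + real X * 1)"
  proof (intro mult_left_mono add_mono mult_right_mono)
    have "real (4 * P ^ (16 * m)) \<le> real N" using N(2) by (simp only: of_nat_le_iff)
    then have "4 * real P ^ (16 * m) \<le> real N" by simp
    then show "real P ^ (16 * m) \<le> real X * 1" using N3 rXY by linarith
  qed (use rXY loss0 \<nu> in auto)
  also have "\<dots> = (32 * \<nu>) ^ m * (2 * loss + 1) * real X" by (simp add: algebra_simps)
  also have "\<dots> < \<alpha> / 2 * real X" using key rXY by (intro mult_strict_right_mono) (auto simp: loss_def)
  finally have "n1 < \<alpha> / 2 * real X" .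
  moreover have "\<alpha> / 2 * real X \<le> 3 / 4 * \<alpha> * real X" using \<alpha> by simp
  ultimately show False using n1_ge by linarith
qed

text \<open>\<open>k\<close> increments are carried out, and a density cannot exceed 1. The size of
  \<open>N\<close> keeps every interval that is still to be treated at least as long as
  \<open>M\<close>, and the density never decreases, so the same \<open>P\<close>, \<open>m\<close>
  and \<nu> serve throughout.\<close>

lemma density_iteration:
  fixes A :: "int set" and N P m :: nat and \<alpha> \<nu> M :: real
  assumes sf: "square_difference_free A" and AN: "A \<subseteq> {1..int N}" and dens: "\<alpha> * real N \<le> real (card A)"
    and \<alpha>: "0 < \<alpha>" and \<nu>: "0 < \<nu>" "\<nu> \<le> 1 / 8" and m: "0 < m"
    and P: "1000 \<le> P" "24 \<le> \<alpha> * real P"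
    and M: "real P ^ 40 \<le> M" "4 * real P ^ (16 * m) \<le> M" "8 * real P ^ 8 \<le> \<nu> * M"
    and key: "(32 * \<nu>) ^ m * (2 * (1 + ln (real ((P ^ 4) ^ (2 * m)))) ^ (2 ^ (2 * m)) + 1) < \<alpha> / 2"
    and N: "(4 * real P ^ 8) ^ k * M \<le> real N"
  shows "(1 + \<nu>) ^ k * \<alpha> \<le> 1"
proof -
  have M0: "0 < M" using M(1) P(1) zero_less_power[of "real P" 40] by linarith
  have P8: "1 \<le> 4 * real P ^ 8" proof -
    have "1 \<le> real P ^ 8" using P(1) by (intro one_le_power) simp
    then show ?thesis by linarith
  qed
  have "\<exists>B N'. square_difference_free B \<and> B \<subseteq> {1..int N'} \<and> ((1 + \<nu>) ^ i * \<alpha>) * real N' \<le> real (card B)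
      \<and> real N \<le> (4 * real P ^ 8) ^ i * real N'" if "i \<le> k" for i
    using that
  proof (induction i)
    case 0
    then show ?case using sf AN dens by auto
  next
    case (Suc i)
    then obtain B N' where B: "square_difference_free B" "B \<subseteq> {1..int N'}"
      "((1 + \<nu>) ^ i * \<alpha>) * real N' \<le> real (card B)" "real N \<le> (4 * real P ^ 8) ^ i * real N'" by auto
    define \<beta> where "\<beta> = (1 + \<nu>) ^ i * \<alpha>"
    have "1 \<le> (1 + \<nu>) ^ i" using \<nu> by (intro one_le_power) auto
    then have \<beta>: "\<alpha> \<le> \<beta>" unfolding \<beta>_def using \<alpha> by simp
    have "(4 * real P ^ 8) ^ i * M \<le> (4 * real P ^ 8) ^ k * M"
      using Suc.prems P8 M0 by (intro mult_right_mono power_increasing) auto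
    then have "(4 * real P ^ 8) ^ i * M \<le> (4 * real P ^ 8) ^ i * real N'" using N B(4) by linarith
    then have MN: "M \<le> real N'" by (rule mult_left_le_imp_le) (use P in simp)
    have "\<exists>q s L. 1 \<le> q \<and> N' \<le> 4 * P ^ 8 * L \<and>
      (1 + \<nu>) * \<beta> * real L < real (card {j\<in>{1..int L}. s + int (q\<^sup>2) * j \<in> B})"
    proof (rule density_increment[OF B(1,2) _ _ \<nu> m P(1)])
      show "\<beta> * real N' \<le> real (card B)" using B(3) by (simp add: \<beta>_def)
      show "0 < \<beta>" using \<alpha> \<beta> by simp
      show "24 \<le> \<beta> * real P" using P(2) mult_right_mono[OF \<beta>, of "real P"] by simp
      have "real P ^ 40 \<le> real N'" using M(1) MN by linarith
      then show "P ^ 40 \<le> N'" by (metis of_nat_le_iff of_nat_power)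
      have "real (4 * P ^ (16 * m)) = 4 * real P ^ (16 * m)" by simp
      then have "real (4 * P ^ (16 * m)) \<le> real N'" using M(2) MN by linarith
      then show "4 * P ^ (16 * m) \<le> N'" by (simp only: of_nat_le_iff)
      show "8 * real P ^ 8 \<le> \<nu> * real N'" using M(3) mult_left_mono[OF MN less_imp_le[OF \<nu>(1)]] by linarith
      show "(32 * \<nu>) ^ m * (2 * (1 + ln (real ((P ^ 4) ^ (2 * m)))) ^ (2 ^ (2 * m)) + 1) < \<beta> / 2"
        using key \<beta> by linarith
    qed
    then obtain q s L where qsL: "1 \<le> q" "N' \<le> 4 * P ^ 8 * L"
      "(1 + \<nu>) * \<beta> * real L < real (card {j\<in>{1..int L}. s + int (q\<^sup>2) * j \<in> B})" by blast
    define C where "C = {j\<in>{1..int L}. s + int (q\<^sup>2) * j \<in> B}"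
    \<comment> \<open>A difference \<open>n\<^sup>2\<close> in \<open>C\<close> becomes
      \<open>(q * n)\<^sup>2\<close> in \<open>B\<close>; this is the reason for progressions of
      square difference.\<close>
    have "square_difference_free C"
      unfolding square_difference_free_def
    proof clarify
      fix a b n :: int assume ab: "a \<in> C" "b \<in> C" "1 \<le> n" "a - b = n\<^sup>2"
      have "(s + int (q\<^sup>2) * a) - (s + int (q\<^sup>2) * b) = int (q\<^sup>2) * (a - b)" by (simp add: algebra_simps)
      also have "\<dots> = (int q * n)\<^sup>2" by (simp add: ab(4) power_mult_distrib)
      finally have "(s + int (q\<^sup>2) * a) - (s + int (q\<^sup>2) * b) = (int q * n)\<^sup>2" .
      moreover have "1 * 1 \<le> int q * n" using qsL(1) ab(3) by (intro mult_mono) auto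
      moreover have "s + int (q\<^sup>2) * a \<in> B" "s + int (q\<^sup>2) * b \<in> B" using ab(1,2) by (simp_all add: C_def)
      ultimately show False using B(1) unfolding square_difference_free_def mult_1 by blast
    qed
    moreover have "C \<subseteq> {1..int L}" by (auto simp: C_def)
    moreover have "((1 + \<nu>) ^ Suc i * \<alpha>) * real L \<le> real (card C)" using qsL(3) by (simp add: C_def \<beta>_def mult.assoc)
    moreover have "real N \<le> (4 * real P ^ 8) ^ Suc i * real L"
    proof -
      have "real N' \<le> real (4 * P ^ 8 * L)" using qsL(2) by (simp only: of_nat_le_iff)
      then have "(4 * real P ^ 8) ^ i * real N' \<le> (4 * real P ^ 8) ^ i * (4 * real P ^ 8 * real L)"
        by (intro mult_left_mono) auto
      with B(4) have "real N \<le> (4 * real P ^ 8) ^ i * (4 * real P ^ 8 * real L)" by (rule order_trans)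
      then show ?thesis by (simp only: power_Suc mult_ac)
    qed
    ultimately show ?case by blast
  qed
  from this[of k] obtain B N' where B: "B \<subseteq> {1..int N'}" "((1 + \<nu>) ^ k * \<alpha>) * real N' \<le> real (card B)"
    "real N \<le> (4 * real P ^ 8) ^ k * real N'" by auto
  have "(4 * real P ^ 8) ^ k * M \<le> (4 * real P ^ 8) ^ k * real N'" using N B(3) by linarith
  then have "M \<le> real N'" by (rule mult_left_le_imp_le) (use P in simp)
  then have N'0: "0 < real N'" using M0 by linarith
  have "card B \<le> card {1..int N'}" using B(1) by (intro card_mono) auto
  then have "((1 + \<nu>) ^ k * \<alpha>) * real N' \<le> 1 * real N'" using B(2) by simp
  then show ?thesis using N'0 by (rule mult_right_le_imp_le)
qed

section \<open>Choice of parameters\<close>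

text \<open>What the parameters demand of \<open>y = ln (ln (ln N))\<close>. The fourth conjunct
  bounds the logarithm inside the moment loss, the fifth is the exponent form of \<open>key\<close>,
  and the last says that all increments together fit into \<open>ln N\<close>.\<close>

definition large_enough :: "real \<Rightarrow> bool" where
  "large_enough y \<longleftrightarrow> 8 \<le> y \<and> 2000 \<le> y * exp y \<and> 20 \<le> exp y \<and> 1 + 2 * y * (y * exp y) \<le> (exp y)\<^sup>2 \<and>
     (y / 4 - 1) * (5 - exp y / 4) + 2 * y * exp (y / 2) + 3 \<le> - (y * exp y / 40) \<and>
     (y * exp y * exp (exp y / 4) + 1) * (2 + 8 * (y * exp y)) + (3 + (48 + 4 * y) * (y * exp y) + exp y / 4)
        \<le> exp (exp y)"

lemma no_dense_square_difference_free:
  fixes A :: "int set" and N :: nat and y :: real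
  assumes sf: "square_difference_free A" and AN: "A \<subseteq> {1..int N}"
    and x: "real N = exp (exp (exp y))"
    and dens: "exp (- (y * exp y / 40)) * real N \<le> real (card A)"
    and large: "large_enough y"
  shows False
proof -
  have y: "8 \<le> y" "2000 \<le> y * exp y" "20 \<le> exp y" "1 + 2 * y * (y * exp y) \<le> (exp y)\<^sup>2"
    and key: "(y / 4 - 1) * (5 - exp y / 4) + 2 * y * exp (y / 2) + 3 \<le> - (y * exp y / 40)"
    and size: "(y * exp y * exp (exp y / 4) + 1) * (2 + 8 * (y * exp y)) + (3 + (48 + 4 * y) * (y * exp y) + exp y / 4)
        \<le> exp (exp y)"
    using large by (simp_all add: large_enough_def)
  \<comment> \<open>Since \<open>exp y = ln (ln N)\<close>, \<alpha> is \<open>ln N\<close> to the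
    power \<open>- y / 40\<close> and \<nu> the power -1/4. \<open>P\<close> is the least integer
    with \<open>24 \<le> \<alpha> * P\<close>, and \<open>k\<close> is about
    \<open>T / \<nu>\<close>, enough to raise the density by \<open>exp (T / 2)\<close>.\<close>
  define T where "T = y * exp y"
  define \<alpha> where "\<alpha> = exp (- (T / 40))"
  define \<nu> where "\<nu> = exp (- (exp y / 4))"
  define P where "P = nat \<lceil>24 / \<alpha>\<rceil>"
  define m where "m = nat \<lfloor>y / 4\<rfloor>"
  define k where "k = nat \<lceil>T * exp (exp y / 4)\<rceil>"
  define p where "p = real P"
  \<comment> \<open>One value for all three size conditions: the exponent covers 40,
    \<open>16 * m\<close> and 8, and the division by \<nu> serves the condition on
    \<open>\<nu> * M\<close>.\<close>
  define M where "M = 8 * p ^ (48 + 16 * m) / \<nu>"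
  have T: "2000 \<le> T" using y(2) by (simp add: T_def)
  have e2: "2 \<le> exp (1::real)" using exp_ge_add_one_self[of 1] by simp
  have pow2: "2 ^ n \<le> exp (real n)" for n
  proof -
    have "2 ^ n \<le> exp (1::real) ^ n" using e2 by (intro power_mono) auto
    then show ?thesis by (simp flip: exp_of_nat_mult)
  qed
  have \<alpha>0: "0 < \<alpha>" "\<alpha> \<le> 1" using T by (auto simp: \<alpha>_def)
  have \<nu>0: "0 < \<nu>" by (simp add: \<nu>_def)
  have \<nu>8: "\<nu> \<le> 1 / 8"
  proof -
    have "8 \<le> exp (3::real)" using pow2[of 3] by simp
    also have "\<dots> \<le> exp (exp y / 4)" using y(3) by simp
    finally show ?thesis by (simp add: \<nu>_def exp_minus field_simps)
  qed
  have m: "0 < m" "real m \<le> y / 4" "y / 4 - 1 \<le> real m"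
  proof -
    have "1 \<le> \<lfloor>y / 4\<rfloor>" using y(1) by linarith
    then show "0 < m" "real m \<le> y / 4" "y / 4 - 1 \<le> real m" unfolding m_def by linarith+
  qed
  have inv: "1 / \<alpha> = exp (T / 40)" by (simp add: \<alpha>_def exp_minus field_simps)
  have "0 \<le> 24 / \<alpha>" using \<alpha>0 by simp
  then have p: "24 / \<alpha> \<le> p" "p \<le> 24 / \<alpha> + 1" unfolding p_def P_def by linarith+
  have p1000: "1000 \<le> p"
  proof -
    have "1024 \<le> exp (10::real)" using pow2[of 10] by simp
    also have "exp (10::real) \<le> exp (T / 40)" using T by simp
    also have "\<dots> = 1 / \<alpha>" by (rule inv[symmetric])
    also have "1 / \<alpha> \<le> 24 / \<alpha>" using \<alpha>0 by (intro divide_right_mono) auto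
    finally show ?thesis using p(1) by linarith
  qed
  have P1000: "1000 \<le> P" using p1000 by (simp add: p_def)
  have Pa: "24 \<le> \<alpha> * real P" using p(1) \<alpha>0 by (simp add: p_def field_simps)
  have lnp: "ln p \<le> T" "0 \<le> ln p"
  proof -
    have "1 \<le> 1 / \<alpha>" using \<alpha>0 by simp
    then have "p \<le> 25 * (1 / \<alpha>)" using p(2) by simp
    also have "\<dots> \<le> exp 5 * exp (T / 40)" unfolding inv using pow2[of 5] by (intro mult_right_mono) auto
    also have "\<dots> \<le> exp T" using T by (simp flip: exp_add)
    finally have "ln p \<le> ln (exp T)" using p1000 by (intro ln_mono) auto
    then show "ln p \<le> T" by simp
    show "0 \<le> ln p" using p1000 by simp
  qed
  have keyP: "(32 * \<nu>) ^ m * (2 * (1 + ln (real ((P ^ 4) ^ (2 * m)))) ^ (2 ^ (2 * m)) + 1) < \<alpha> / 2"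
  proof -
    have "real ((P ^ 4) ^ (2 * m)) = p ^ (8 * m)" by (simp add: p_def flip: power_mult)
    then have "ln (real ((P ^ 4) ^ (2 * m))) = real (8 * m) * ln p" using p1000 by (simp add: ln_realpow)
    also have "\<dots> \<le> (8 * (y / 4)) * T" using m lnp y(1) by (intro mult_mono) auto
    finally have "1 + ln (real ((P ^ 4) ^ (2 * m))) \<le> (exp y)\<^sup>2" using y(4) by (simp add: T_def)
    moreover have "(exp y)\<^sup>2 = exp (2 * y)" by (simp add: power2_eq_square flip: exp_add)
    moreover have "0 \<le> 1 + ln (real ((P ^ 4) ^ (2 * m)))"
      using P1000 by (intro add_nonneg_nonneg ln_ge_zero) (auto simp: one_le_power)
    ultimately have "(1 + ln (real ((P ^ 4) ^ (2 * m)))) ^ (2 ^ (2 * m)) \<le> exp (2 * y) ^ (2 ^ (2 * m))"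
      by (intro power_mono) auto
    also have "\<dots> = exp (2 ^ (2 * m) * (2 * y))" by (simp flip: exp_of_nat_mult)
    \<comment> \<open>The choice \<open>m \<le> y / 4\<close> pays here:
      \<open>4 ^ m \<le> exp (2 * m) \<le> exp (y / 2)\<close> keeps the exponent of the loss far
      below \<open>y * exp y\<close>.\<close>
    also have "\<dots> \<le> exp (exp (y / 2) * (2 * y))"
    proof -
      have "(2::real) ^ (2 * m) \<le> exp (real (2 * m))" by (rule pow2)
      also have "\<dots> \<le> exp (y / 2)" using m by simp
      finally show ?thesis using y(1) by (simp add: mult_right_mono)
    qed
    finally have loss: "(1 + ln (real ((P ^ 4) ^ (2 * m)))) ^ (2 ^ (2 * m)) \<le> exp (2 * y * exp (y / 2))" by (simp add: mult_ac)
    have "32 * \<nu> \<le> exp 5 * \<nu>" using pow2[of 5] \<nu>0 by (intro mult_right_mono) auto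
    also have "\<dots> = exp (5 - exp y / 4)" by (simp add: \<nu>_def flip: exp_add)
    finally have "(32 * \<nu>) ^ m \<le> exp (5 - exp y / 4) ^ m" using \<nu>0 by (intro power_mono) auto
    also have "\<dots> = exp (real m * (5 - exp y / 4))" by (simp flip: exp_of_nat_mult)
    \<comment> \<open>\<open>20 \<le> exp y\<close> makes the second factor nonpositive, so the
      lower bound for \<open>m\<close> is the relevant one.\<close>
    also have "\<dots> \<le> exp ((y / 4 - 1) * (5 - exp y / 4))"
      using m(3) y(3) by (simp add: mult_right_mono_neg)
    finally have nu: "(32 * \<nu>) ^ m \<le> exp ((y / 4 - 1) * (5 - exp y / 4))" .
    have "1 \<le> exp (2 * y * exp (y / 2))" using y(1) by simp
    then have "2 * (1 + ln (real ((P ^ 4) ^ (2 * m)))) ^ (2 ^ (2 * m)) + 1 \<le> 3 * exp (2 * y * exp (y / 2))"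
      using loss by linarith
    then have "(32 * \<nu>) ^ m * (2 * (1 + ln (real ((P ^ 4) ^ (2 * m)))) ^ (2 ^ (2 * m)) + 1)
      \<le> exp ((y / 4 - 1) * (5 - exp y / 4)) * (3 * exp (2 * y * exp (y / 2)))"
      using nu \<nu>0 \<open>0 \<le> 1 + ln (real ((P ^ 4) ^ (2 * m)))\<close> by (intro mult_mono) auto
    also have "\<dots> = 3 * exp ((y / 4 - 1) * (5 - exp y / 4) + 2 * y * exp (y / 2))" by (simp add: exp_add)
    \<comment> \<open>The summand 3 in \<open>key\<close> pays for the constants, as
      \<open>3 / exp 3 < 1 / 2\<close>.\<close>
    also have "\<dots> \<le> 3 * exp (- (T / 40) - 3)" using key by (simp add: T_def)
    also have "\<dots> = 3 * \<alpha> / exp 3" by (simp add: \<alpha>_def exp_diff)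
    also have "\<dots> \<le> 3 * \<alpha> / 8" using pow2[of 3] \<alpha>0 by (intro divide_left_mono) auto
    also have "\<dots> < \<alpha> / 2" using \<alpha>0 by simp
    finally show ?thesis .
  qed
  have lnM: "ln M \<le> 3 + (48 + 4 * y) * T + exp y / 4" and M0: "0 < M"
  proof -
    show "0 < M" using p1000 \<nu>0 by (simp add: M_def)
    have "ln M = ln 8 + real (48 + 16 * m) * ln p + exp y / 4"
      using p1000 by (simp add: M_def \<nu>_def ln_mult ln_div ln_realpow)
    moreover have "ln 8 \<le> (3::real)"
    proof -
      have "ln 8 \<le> ln (exp (3::real))" using pow2[of 3] by (intro ln_mono) auto
      then show ?thesis by simp
    qed
    moreover have "real (48 + 16 * m) * ln p \<le> (48 + 4 * y) * T" using m lnp y(1) by (intro mult_mono) auto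
    ultimately show "ln M \<le> 3 + (48 + 4 * y) * T + exp y / 4" by linarith
  qed
  have k: "T * exp (exp y / 4) \<le> real k" "real k \<le> T * exp (exp y / 4) + 1"
  proof -
    have "0 \<le> T * exp (exp y / 4)" using T by simp
    then show "T * exp (exp y / 4) \<le> real k" "real k \<le> T * exp (exp y / 4) + 1" unfolding k_def by linarith+
  qed
  have big: "(4 * real P ^ 8) ^ k * M \<le> real N"
  proof -
    have pos: "0 < (4 * p ^ 8) ^ k" using p1000 by simp
    have "ln (4 * p ^ 8) = ln 4 + 8 * ln p" using p1000 by (simp add: ln_mult ln_realpow)
    moreover have "ln 4 \<le> (2::real)"
    proof -
      have "ln 4 \<le> ln (exp (2::real))" using pow2[of 2] by (intro ln_mono) auto
      then show ?thesis by simp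
    qed
    ultimately have l4: "ln (4 * p ^ 8) \<le> 2 + 8 * T" using lnp by linarith
    have "1 \<le> 4 * p ^ 8" using p1000 one_le_power[of p 8] by linarith
    then have l0: "0 \<le> ln (4 * p ^ 8)" by simp
    have "ln ((4 * p ^ 8) ^ k * M) = real k * ln (4 * p ^ 8) + ln M"
    proof -
      have "ln ((4 * p ^ 8) ^ k) = real k * ln (4 * p ^ 8)" using p1000 by (intro ln_realpow)
      then show ?thesis using ln_mult_pos[OF pos M0] by simp
    qed
    also have "\<dots> \<le> (T * exp (exp y / 4) + 1) * (2 + 8 * T) + (3 + (48 + 4 * y) * T + exp y / 4)"
      using k l4 l0 lnM T by (intro add_mono mult_mono) auto
    also have "\<dots> \<le> exp (exp y)" using size by (simp add: T_def)
    finally have "exp (ln ((4 * p ^ 8) ^ k * M)) \<le> exp (exp (exp y))" by simp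
    moreover have "exp (ln ((4 * p ^ 8) ^ k * M)) = (4 * p ^ 8) ^ k * M" using pos M0 by (intro exp_ln) simp
    ultimately have "(4 * p ^ 8) ^ k * M \<le> exp (exp (exp y))" by linarith
    then show ?thesis unfolding x p_def .
  qed
  have "(1 + \<nu>) ^ k * \<alpha> \<le> 1"
  proof (rule density_iteration[OF sf AN _ \<alpha>0(1) \<nu>0 \<nu>8 m(1) P1000 Pa _ _ _ keyP big])
    show "\<alpha> * real N \<le> real (card A)" using dens by (simp add: \<alpha>_def T_def)
    have "1 \<le> 1 / \<nu>" using \<nu>0 \<nu>8 by simp
    have pw: "p ^ n \<le> p ^ (48 + 16 * m)" if "n \<le> 48 + 16 * m" for n using that p1000 by (intro power_increasing) auto
    have M_ge: "8 * p ^ (48 + 16 * m) \<le> M"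
      using mult_left_mono[OF \<open>1 \<le> 1 / \<nu>\<close>, of "8 * p ^ (48 + 16 * m)"] p1000 by (simp add: M_def)
    have pp: "0 < p ^ n" for n using p1000 by simp
    show "real P ^ 40 \<le> M" unfolding p_def[symmetric] using M_ge pw[of 40] pp[of "48 + 16 * m"] by linarith
    show "4 * real P ^ (16 * m) \<le> M" unfolding p_def[symmetric] using M_ge pw[of "16 * m"] pp[of "48 + 16 * m"] by linarith
    show "8 * real P ^ 8 \<le> \<nu> * M" using pw[of 8] \<nu>0 by (simp add: M_def p_def)
  qed
  \<comment> \<open>From \<open>exp (\<nu> / 2) \<le> 1 + \<nu>\<close> and
    \<open>T \<le> k * \<nu>\<close>. This growth exceeds
    \<open>1 / \<alpha> = exp (T / 40)\<close>, the most that the iteration allows.\<close>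
  moreover have "exp (T / 2) \<le> (1 + \<nu>) ^ k"
  proof -
    have "exp (\<nu> / 2) \<le> 1 + \<nu> / 2 + (\<nu> / 2)\<^sup>2" using \<nu>0 \<nu>8 by (intro exp_bound) auto
    also have "(\<nu> / 2)\<^sup>2 \<le> \<nu> / 2" using \<nu>0 \<nu>8 power_decreasing[of 1 2 "\<nu> / 2"] by simp
    finally have "exp (\<nu> / 2) ^ k \<le> (1 + \<nu>) ^ k" by (intro power_mono) auto
    moreover have "exp (\<nu> / 2) ^ k = exp (real k * (\<nu> / 2))" by (simp flip: exp_of_nat_mult)
    moreover have "T / 2 \<le> real k * (\<nu> / 2)"
    proof -
      have "T * exp (exp y / 4) * \<nu> \<le> real k * \<nu>" using k(1) \<nu>0 by (intro mult_right_mono) auto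
      moreover have "T * exp (exp y / 4) * \<nu> = T" by (simp add: \<nu>_def mult.assoc flip: exp_add)
      ultimately show ?thesis by simp
    qed
    ultimately show ?thesis by (metis exp_le_cancel_iff order_trans)
  qed
  ultimately have "exp (T / 2) * \<alpha> \<le> 1" using \<alpha>0 by (meson mult_right_mono less_imp_le order_trans)
  then have "exp (T / 2 - T / 40) \<le> exp 0" by (simp add: \<alpha>_def flip: exp_add)
  then show False using T by simp
qed

text \<open>In the fifth conjunct the left side is asymptotic to \<open>- (y * exp y / 16)\<close>,
  below \<open>- (y * exp y / 40)\<close>; in the last, \<open>exp (exp y / 4)\<close> times
  polynomial factors in \<open>y\<close> and \<open>exp y\<close> meets
  \<open>exp (exp y)\<close>.\<close>

lemma eventually_large_enough:
  "eventually large_enough at_top"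
  unfolding large_enough_def by (intro eventually_conj; real_asymp)

theorem theorem1:
  shows "\<exists>(c::real) (C::real) (N0::int). c > 0 \<and> C > 0 \<and>
    (\<forall>N\<ge>N0. \<forall>A::int set.
       A \<subseteq> {1..N} \<longrightarrow>
       \<not> (\<exists>a\<in>A. \<exists>b\<in>A. \<exists>n\<ge>1. a - b = n ^ 2) \<longrightarrow>
       real (card A) \<le> C * (real_of_int N / (ln (real_of_int N) powr (c * ln (ln (ln (real_of_int N)))))))"
proof -
  have "filterlim (\<lambda>x::real. ln (ln (ln x))) at_top at_top" by real_asymp
  from eventually_compose_filterlim[OF eventually_large_enough this]
  have "eventually (\<lambda>x::real. large_enough (ln (ln (ln x)))) at_top"
    .
  moreover have "eventually (\<lambda>x::real. 1 < x \<and> 1 < ln x \<and> 1 < ln (ln x)) at_top"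
    by (intro eventually_conj; real_asymp)
  ultimately have "eventually (\<lambda>x::real. large_enough (ln (ln (ln x))) \<and> 1 < x \<and> 1 < ln x \<and> 1 < ln (ln x)) at_top"
    by (rule eventually_conj)
  then obtain x0 :: real where x0: "\<And>x. x0 \<le> x \<Longrightarrow> large_enough (ln (ln (ln x))) \<and> 1 < x \<and> 1 < ln x \<and> 1 < ln (ln x)"
    unfolding eventually_at_top_linorder by blast
  have "real (card A) \<le> 1 * (real_of_int N / (ln (real_of_int N) powr (1 / 40 * ln (ln (ln (real_of_int N))))))"
    if N: "\<lceil>x0\<rceil> \<le> N" and A: "A \<subseteq> {1..N}" and nosq: "\<not> (\<exists>a\<in>A. \<exists>b\<in>A. \<exists>n\<ge>1. a - b = n ^ 2)" for N :: int and A
  proof (rule ccontr)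
    assume contra: "\<not> ?thesis"
    define y where "y = ln (ln (ln (real_of_int N)))"
    have "x0 \<le> real_of_int N" using N by linarith
    note props = x0[OF this, folded y_def]
    have big: "1 < real_of_int N" "1 < ln (real_of_int N)" "1 < ln (ln (real_of_int N))" using props by auto
    have e1: "exp y = ln (ln (real_of_int N))" unfolding y_def using big by (intro exp_ln) linarith
    have e2: "exp (exp y) = ln (real_of_int N)" unfolding e1 using big by (intro exp_ln) linarith
    have e3: "exp (exp (exp y)) = real_of_int N" unfolding e2 using big by (intro exp_ln) linarith
    have N0: "0 < N" using big by simp
    then have rN: "real (nat N) = real_of_int N" by simp
    \<comment> \<open>As \<open>exp y = ln (ln N)\<close>, the saving is the reciprocal of the
      density excluded above; this fixes \<open>c = 1 / 40\<close> and \<open>C = 1\<close>.\<close>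
    have powr: "ln (real_of_int N) powr (1 / 40 * y) = exp (y * exp y / 40)"
      using big by (simp add: powr_def e1)
    show False
    proof (rule no_dense_square_difference_free[of A "nat N" y])
      show "square_difference_free A" using nosq by (simp add: square_difference_free_def)
      show "A \<subseteq> {1..int (nat N)}" using A N0 by simp
      show "real (nat N) = exp (exp (exp y))" using rN e3 by simp
      show "exp (- (y * exp y / 40)) * real (nat N) \<le> real (card A)"
        using contra unfolding y_def[symmetric] powr rN by (simp add: exp_minus field_simps)
    qed (use props in simp_all)
  qed
  then show ?thesis by (intro exI[of _ "1 / 40 :: real"] exI[of _ "1 :: real"] exI[of _ "\<lceil>x0\<rceil>"]) auto
qed

end
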